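(* Let $M=(\mathbb R^{n_1}\times M_1)\#\cdots\#(\mathbb R^{n_l}\times M_l)$ be a manifold with ends as described in the context, with $l\ge2$ and $n_*=\min_i n_i\ge3$, with compact connecting part $K$, and let $\widetilde K$ be a small (bounded) neighbourhood of $K$ with smooth boundary. Then there is a constant $C$ such that $$\|u\|_{L^1(\widetilde K)}\le C\,\|\nabla u\|_{L^1(M)}$$ for all $u\in C_c^\infty(M)$.
   Context: $\nabla$ is the Riemannian gradient, and $L^1$ norms are with respect to the Riemannian measure. Manifold with ends: let $l\ge2$ and, for $1\le i\le l$, let $M_i$ be a compact (connected, boundaryless) Riemannian manifold with $n_i+\dim(M_i)=N$ for a common integer $N$, where $n_i\ge3$. The connected sum $M=(\mathbb R^{n_1}\times M_1)\#\cdots\#(\mathbb R^{n_l}\times M_l)$ is a complete connected $N$-dimensional Riemannian manifold which decomposes as a disjoint union $M=K\cup\bigcup_{i=1}^lE_i$, where $K$ is compact and each end $E_i$ is isometric to $(\mathbb R^{n_i}\times M_i)\setminus K_i$ for some compact set $K_i\subset\mathbb R^{n_i}\times M_i$, $\mathbb R^{n_i}\times M_i$ carrying the product metric. *)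

theory Defs
  imports "HOL-Analysis.Analysis"
begin

section \<open>Calculus on coordinate subspaces\<close>

text \<open>
  A set \<open>A\<close> of coordinates of \<^typ>\<open>real^'n\<close> determines the coordinate subspace of dimension
  \<^term>\<open>card A\<close> on which all other coordinates vanish. These subspaces serve as model spaces, so
  that manifolds of every dimension \<open>0, \<dots>, CARD('n)\<close> can be handled without one type per dimension;
  for \<open>A = UNIV\<close> the model space is all of \<^typ>\<open>real^'n\<close>.
\<close>

definition coords :: "'n::finite set \<Rightarrow> (real^'n) set" where
  "coords A = {x. \<forall>j. j \<notin> A \<longrightarrow> x $ j = 0}"

definition partial :: "'n::finite \<Rightarrow> (real^'n \<Rightarrow> 'b::real_normed_vector) \<Rightarrow> real^'n \<Rightarrow> 'b" where
  "partial j f x = vector_derivative (\<lambda>t. f (x + t *\<^sub>R axis j 1)) (at 0)"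

text \<open>\<open>Ck k A S f\<close> means that \<open>f\<close> is of class \<open>C^k\<close> on \<open>S\<close>. It is only used for \<open>S\<close> relatively
  open in \<^term>\<open>coords A\<close>; a derivative within \<open>S\<close> is then a derivative on \<^term>\<open>coords A\<close>.\<close>

primrec Ck ::
  "nat \<Rightarrow> 'n::finite set \<Rightarrow> (real^'n) set \<Rightarrow> (real^'n \<Rightarrow> 'b::real_normed_vector) \<Rightarrow> bool" where
  "Ck 0 A S f \<longleftrightarrow> continuous_on S f"
| "Ck (Suc k) A S f \<longleftrightarrow>
     (\<forall>x\<in>S. f differentiable (at x within S)) \<and> (\<forall>j\<in>A. Ck k A S (partial j f))"

definition smooth_in ::
  "'n::finite set \<Rightarrow> (real^'n) set \<Rightarrow> (real^'n \<Rightarrow> 'b::real_normed_vector) \<Rightarrow> bool" where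
  "smooth_in A S f \<longleftrightarrow> (\<forall>k. Ck k A S f)"


section \<open>Riemannian manifolds\<close>

text \<open>
  Each chart carries the matrix \<open>(g\<^sub>i\<^sub>j)\<close> of the metric with respect to its coordinate frame, as a
  function of the point. For a manifold modelled on \<^term>\<open>coords A\<close> only the entries with
  \<open>i, j \<in> A\<close> are meaningful. The maps are total functions, but only their values on the chart
  domain are ever used.
\<close>

record ('a, 'n::finite) chart =
  chart_dom :: "'a set"
  chart_map :: "'a \<Rightarrow> real^'n"
  chart_gram :: "'a \<Rightarrow> real^'n^'n"

record ('a, 'n::finite) manifold =
  mtop :: "'a topology"
  atlas :: "('a, 'n) chart set"

abbreviation points :: "('a, 'n::finite) manifold \<Rightarrow> 'a set" where
  "points M \<equiv> topspace (mtop M)"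

definition chart_inv :: "('a, 'n::finite) chart \<Rightarrow> real^'n \<Rightarrow> 'a" where
  "chart_inv c = inv_into (chart_dom c) (chart_map c)"

definition topological_chart :: "'n::finite set \<Rightarrow> 'a topology \<Rightarrow> ('a, 'n) chart \<Rightarrow> bool" where
  "topological_chart A X c \<longleftrightarrow>
     openin X (chart_dom c) \<and>
     openin (top_of_set (coords A)) (chart_map c ` chart_dom c) \<and>
     homeomorphic_map (subtopology X (chart_dom c)) (top_of_set (chart_map c ` chart_dom c))
       (chart_map c)"

definition smooth_metric :: "'n::finite set \<Rightarrow> ('a, 'n) chart \<Rightarrow> bool" where
  "smooth_metric A c \<longleftrightarrow>
     (\<forall>i\<in>A. \<forall>j\<in>A. smooth_in A (chart_map c ` chart_dom c)
        (\<lambda>x. chart_gram c (chart_inv c x) $ i $ j)) \<and>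
     (\<forall>p\<in>chart_dom c.
        (\<forall>i\<in>A. \<forall>j\<in>A. chart_gram c p $ i $ j = chart_gram c p $ j $ i) \<and>
        (\<forall>v\<in>coords A. v \<noteq> 0 \<longrightarrow> 0 < v \<bullet> (chart_gram c p *v v)))"

text \<open>\<open>pulls_back A \<tau> x g h\<close>: the \<open>A\<close>-block of \<open>g\<close> is the pullback \<open>J\<^sup>T h J\<close> of \<open>h\<close>, where \<open>J\<close> is the
  Jacobian matrix of \<open>\<tau>\<close> at \<open>x\<close>, whose columns are the partial derivatives of \<open>\<tau>\<close>.\<close>

definition pulls_back ::
  "'n::finite set \<Rightarrow> (real^'n \<Rightarrow> real^'n) \<Rightarrow> real^'n \<Rightarrow> real^'n^'n \<Rightarrow> real^'n^'n \<Rightarrow> bool" where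
  "pulls_back A \<tau> x g h \<longleftrightarrow>
     (\<forall>i\<in>A. \<forall>j\<in>A. g $ i $ j = partial i \<tau> x \<bullet> (h *v partial j \<tau> x))"

definition compatible_charts ::
  "'n::finite set \<Rightarrow> ('a, 'n) chart \<Rightarrow> ('a, 'n) chart \<Rightarrow> bool" where
  "compatible_charts A c d \<longleftrightarrow>
     smooth_in A (chart_map c ` (chart_dom c \<inter> chart_dom d)) (chart_map d \<circ> chart_inv c) \<and>
     (\<forall>p\<in>chart_dom c \<inter> chart_dom d.
        pulls_back A (chart_map d \<circ> chart_inv c) (chart_map c p) (chart_gram c p) (chart_gram d p))"

definition second_countable_space :: "'a topology \<Rightarrow> bool" where
  "second_countable_space X \<longleftrightarrow>
     (\<exists>\<B>. countable \<B> \<and> (\<forall>V\<in>\<B>. openin X V) \<and>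
        (\<forall>U p. openin X U \<and> p \<in> U \<longrightarrow> (\<exists>V\<in>\<B>. p \<in> V \<and> V \<subseteq> U)))"

text \<open>Nonempty Riemannian manifold (without boundary, not necessarily connected) of dimension
  \<^term>\<open>card A\<close>.\<close>

definition riemannian_manifold :: "'n::finite set \<Rightarrow> ('a, 'n) manifold \<Rightarrow> bool" where
  "riemannian_manifold A M \<longleftrightarrow>
     points M \<noteq> {} \<and> Hausdorff_space (mtop M) \<and> second_countable_space (mtop M) \<and>
     (\<forall>c\<in>atlas M. topological_chart A (mtop M) c \<and> smooth_metric A c) \<and>
     (\<Union>c\<in>atlas M. chart_dom c) = points M \<and>
     (\<forall>c\<in>atlas M. \<forall>d\<in>atlas M. compatible_charts A c d)"

definition closed_riemannian_manifold :: "'n::finite set \<Rightarrow> ('a, 'n) manifold \<Rightarrow> bool" where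
  "closed_riemannian_manifold A M \<longleftrightarrow>
     riemannian_manifold A M \<and> compact_space (mtop M) \<and> connected_space (mtop M)"

text \<open>
  The Riemannian product of the Euclidean space \<^term>\<open>coords A\<close> and a manifold modelled on the
  complementary subspace \<^term>\<open>coords (- A)\<close>; it is modelled on \<^typ>\<open>real^'n\<close>.
\<close>

definition euclidean_product ::
  "'n::finite set \<Rightarrow> ('b, 'n) manifold \<Rightarrow> ((real^'n) \<times> 'b, 'n) manifold" where
  "euclidean_product A F =
     \<lparr> mtop = prod_topology (top_of_set (coords A)) (mtop F),
       atlas = (\<lambda>c. \<lparr> chart_dom = coords A \<times> chart_dom c,
                      chart_map = (\<lambda>(x, p). x + chart_map c p),
                      chart_gram = (\<lambda>(x, p). \<chi> i j.
                        if i \<in> A \<or> j \<in> A then (if i = j then 1 else 0)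
                        else chart_gram c p $ i $ j) \<rparr>) ` atlas F \<rparr>"


section \<open>Functions and maps\<close>

text \<open>From here on manifolds are modelled on the whole space \<^typ>\<open>real^'n\<close>, i.e. have dimension
  \<open>CARD('n)\<close>.\<close>

definition smooth_on_mfd :: "('a, 'n::finite) manifold \<Rightarrow> 'a set \<Rightarrow> ('a \<Rightarrow> real) \<Rightarrow> bool" where
  "smooth_on_mfd M W u \<longleftrightarrow>
     (\<forall>c\<in>atlas M. smooth_in UNIV (chart_map c ` (chart_dom c \<inter> W)) (u \<circ> chart_inv c))"

definition test_functions :: "('a, 'n::finite) manifold \<Rightarrow> ('a \<Rightarrow> real) set" where
  "test_functions M =
     {u. smooth_on_mfd M (points M) u \<and>
         compactin (mtop M) (mtop M closure_of {p \<in> points M. u p \<noteq> 0})}"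

text \<open>Isometry of Riemannian manifolds from the open subset \<open>E\<close> of \<open>M\<close> onto the open subset \<open>Q\<close>
  of \<open>P\<close>: a diffeomorphism which pulls the metric of \<open>P\<close> back to that of \<open>M\<close>.\<close>

definition smooth_map_mfd ::
  "('a, 'n::finite) manifold \<Rightarrow> 'a set \<Rightarrow> ('b, 'n) manifold \<Rightarrow> ('a \<Rightarrow> 'b) \<Rightarrow> bool" where
  "smooth_map_mfd M E P f \<longleftrightarrow>
     (\<forall>c\<in>atlas M. \<forall>d\<in>atlas P.
        smooth_in UNIV (chart_map c ` {p \<in> chart_dom c \<inter> E. f p \<in> chart_dom d})
          (chart_map d \<circ> f \<circ> chart_inv c))"

definition riemannian_isometry ::
  "('a, 'n::finite) manifold \<Rightarrow> 'a set \<Rightarrow> ('b, 'n) manifold \<Rightarrow> 'b set \<Rightarrow> ('a \<Rightarrow> 'b) \<Rightarrow> bool" where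
  "riemannian_isometry M E P Q f \<longleftrightarrow>
     homeomorphic_map (subtopology (mtop M) E) (subtopology (mtop P) Q) f \<and>
     smooth_map_mfd M E P f \<and> smooth_map_mfd P Q M (inv_into E f) \<and>
     (\<forall>c\<in>atlas M. \<forall>d\<in>atlas P. \<forall>p\<in>chart_dom c \<inter> E. f p \<in> chart_dom d \<longrightarrow>
        pulls_back UNIV (chart_map d \<circ> f \<circ> chart_inv c) (chart_map c p)
          (chart_gram c p) (chart_gram d (f p)))"

text \<open>The norm of the tangent vector with components \<open>v\<close> in the chart \<open>c\<close>, and the components
  \<open>g\<^sup>i\<^sup>j \<partial>\<^sub>j u\<close> of the gradient. Quantities that do not depend on the chart are computed in an arbitrary
  chart around the point.\<close>

definition tangent_norm :: "('a, 'n::finite) chart \<Rightarrow> 'a \<Rightarrow> real^'n \<Rightarrow> real" where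
  "tangent_norm c p v = sqrt (v \<bullet> (chart_gram c p *v v))"

definition gradient :: "('a, 'n::finite) chart \<Rightarrow> ('a \<Rightarrow> real) \<Rightarrow> 'a \<Rightarrow> real^'n" where
  "gradient c u p =
     matrix_inv (chart_gram c p) *v (\<chi> j. partial j (u \<circ> chart_inv c) (chart_map c p))"

definition chart_at :: "('a, 'n::finite) manifold \<Rightarrow> 'a \<Rightarrow> ('a, 'n) chart" where
  "chart_at M p = (SOME c. c \<in> atlas M \<and> p \<in> chart_dom c)"

definition grad_norm :: "('a, 'n::finite) manifold \<Rightarrow> ('a \<Rightarrow> real) \<Rightarrow> 'a \<Rightarrow> real" where
  "grad_norm M u p = tangent_norm (chart_at M p) p (gradient (chart_at M p) u p)"


section \<open>Riemannian distance and measure\<close>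

definition C1_curve :: "('a, 'n::finite) manifold \<Rightarrow> (real \<Rightarrow> 'a) \<Rightarrow> real \<Rightarrow> real \<Rightarrow> bool" where
  "C1_curve M \<gamma> a b \<longleftrightarrow>
     continuous_map (top_of_set {a..b}) (mtop M) \<gamma> \<and>
     (\<forall>c\<in>atlas M. \<exists>D. continuous_on {t \<in> {a..b}. \<gamma> t \<in> chart_dom c} D \<and>
        (\<forall>t\<in>{a..b}. \<gamma> t \<in> chart_dom c \<longrightarrow>
           ((chart_map c \<circ> \<gamma>) has_vector_derivative D t) (at t within {a..b})))"

definition piecewise_C1_curve :: "('a, 'n::finite) manifold \<Rightarrow> (real \<Rightarrow> 'a) \<Rightarrow> bool" where
  "piecewise_C1_curve M \<gamma> \<longleftrightarrow>
     (\<exists>S. finite S \<and>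
        (\<forall>a b. 0 \<le> a \<and> a < b \<and> b \<le> 1 \<and> {a<..<b} \<inter> S = {} \<longrightarrow> C1_curve M \<gamma> a b))"

definition curve_length :: "('a, 'n::finite) manifold \<Rightarrow> (real \<Rightarrow> 'a) \<Rightarrow> real" where
  "curve_length M \<gamma> = integral {0..1} (\<lambda>t. tangent_norm (chart_at M (\<gamma> t)) (\<gamma> t)
     (vector_derivative (chart_map (chart_at M (\<gamma> t)) \<circ> \<gamma>) (at t)))"

definition riemannian_dist :: "('a, 'n::finite) manifold \<Rightarrow> 'a \<Rightarrow> 'a \<Rightarrow> real" where
  "riemannian_dist M p q =
     Inf {curve_length M \<gamma> | \<gamma>. piecewise_C1_curve M \<gamma> \<and> \<gamma> 0 = p \<and> \<gamma> 1 = q}"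

definition complete_manifold :: "('a, 'n::finite) manifold \<Rightarrow> bool" where
  "complete_manifold M \<longleftrightarrow>
     (\<forall>\<sigma>. range \<sigma> \<subseteq> points M \<and>
        (\<forall>\<epsilon>>0. \<exists>n0. \<forall>m\<ge>n0. \<forall>n\<ge>n0. riemannian_dist M (\<sigma> m) (\<sigma> n) < \<epsilon>) \<longrightarrow>
        (\<exists>p\<in>points M. (\<lambda>n. riemannian_dist M (\<sigma> n) p) \<longlonglongrightarrow> 0))"

definition bounded_in_mfd :: "('a, 'n::finite) manifold \<Rightarrow> 'a set \<Rightarrow> bool" where
  "bounded_in_mfd M S \<longleftrightarrow> S \<subseteq> points M \<and> (\<exists>p\<in>points M. \<exists>B. \<forall>q\<in>S. riemannian_dist M p q \<le> B)"

text \<open>The Riemannian measure is the unique Borel measure which in every chart has density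
  \<open>sqrt (det (g\<^sub>i\<^sub>j))\<close> with respect to Lebesgue measure; this predicate says that \<open>\<mu>\<close> is that measure.\<close>

definition riemannian_measure :: "('a, 'n::finite) manifold \<Rightarrow> 'a measure \<Rightarrow> bool" where
  "riemannian_measure M \<mu> \<longleftrightarrow>
     space \<mu> = points M \<and> sets \<mu> = sigma_sets (points M) {U. openin (mtop M) U} \<and>
     (\<forall>c\<in>atlas M. \<forall>B\<in>sets \<mu>. B \<subseteq> chart_dom c \<longrightarrow>
        emeasure \<mu> B =
          (\<integral>\<^sup>+x\<in>chart_map c ` B. ennreal (sqrt (det (chart_gram c (chart_inv c x)))) \<partial>lborel))"

definition L1_norm :: "'a measure \<Rightarrow> 'a set \<Rightarrow> ('a \<Rightarrow> real) \<Rightarrow> ennreal" where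
  "L1_norm \<mu> S u = (\<integral>\<^sup>+p\<in>S. ennreal \<bar>u p\<bar> \<partial>\<mu>)"

text \<open>Smooth boundary: near each boundary point, \<open>S\<close> is up to boundary points the sublevel set
  of a smooth function without critical points. \<open>S\<close> need be neither open nor closed.\<close>

definition smooth_boundary :: "('a, 'n::finite) manifold \<Rightarrow> 'a set \<Rightarrow> bool" where
  "smooth_boundary M S \<longleftrightarrow>
     (\<forall>p\<in>mtop M frontier_of S. \<exists>W \<rho>. openin (mtop M) W \<and> p \<in> W \<and>
        smooth_on_mfd M W \<rho> \<and> (\<forall>q\<in>W. grad_norm M \<rho> q \<noteq> 0) \<and>
        W \<inter> mtop M interior_of S = {q \<in> W. \<rho> q < 0} \<and>
        W \<inter> mtop M frontier_of S = {q \<in> W. \<rho> q = 0})"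


section \<open>Manifolds with ends\<close>

text \<open>
  \<open>M\<close> is a connected sum of the products \<open>coords (A i) \<times> F i\<close>, \<open>1 \<le> i \<le> l\<close>, with compact part \<open>K\<close>
  and ends \<open>E i\<close>. The Euclidean factor has dimension \<^term>\<open>card (A i)\<close> and the closed manifold \<open>F i\<close>
  the complementary dimension.
\<close>

definition manifold_with_ends ::
  "('a, 'n::finite) manifold \<Rightarrow> nat \<Rightarrow> (nat \<Rightarrow> 'n set) \<Rightarrow> (nat \<Rightarrow> ('b, 'n) manifold) \<Rightarrow>
     'a set \<Rightarrow> (nat \<Rightarrow> 'a set) \<Rightarrow> bool" where
  "manifold_with_ends M l A F K E \<longleftrightarrow>
     riemannian_manifold UNIV M \<and> connected_space (mtop M) \<and> complete_manifold M \<and>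
     (\<forall>i\<in>{1..l}. closed_riemannian_manifold (- A i) (F i)) \<and>
     compactin (mtop M) K \<and>
     points M = K \<union> (\<Union>i\<in>{1..l}. E i) \<and>
     (\<forall>i\<in>{1..l}. K \<inter> E i = {}) \<and> disjoint_family_on E {1..l} \<and>
     (\<forall>i\<in>{1..l}. openin (mtop M) (E i) \<and>
        (\<exists>C f. compactin (mtop (euclidean_product (A i) (F i))) C \<and>
           riemannian_isometry M (E i) (euclidean_product (A i) (F i))
             (points (euclidean_product (A i) (F i)) - C) f))"

end

theory Submission
  imports Defs
begin

text \<open>
  Call a set \<open>W\<close> controlled if the \<open>L\<^sup>1\<close> norm over \<open>W\<close> of every test function is at most a constant times
  the \<open>L\<^sup>1\<close> norm of its gradient over \<open>M\<close>. The claim is that \<open>Kt\<close> is controlled, and it is obtained by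
  moving control around by translations in charts.

  Translations. If \<open>U\<close> is \<open>C\<^sup>1\<close> then \<open>\<bar>U x\<bar> \<le> \<bar>U (x + T v)\<bar> + \<integral>\<^sub>0\<^sup>T \<bar>\<partial>\<^sub>v U (x + t v)\<bar> dt\<close>. Integrating over a set
  \<open>S\<close> and exchanging the integrals bounds the integral of \<open>\<bar>U\<bar>\<close> over \<open>S\<close> by the integral over the
  translate \<open>S + T v\<close> plus a multiple of the integral of \<open>\<bar>\<partial>\<^sub>v U\<bar>\<close> over the region swept out
  (\<open>nn_integral_translate_bound\<close>). By Cauchy--Schwarz, \<open>\<bar>\<partial>\<^sub>v U\<bar>\<close> is at most the length of \<open>v\<close> times the norm
  of the gradient (\<open>directional_derivative_le_grad_norm\<close>).

  Start. An end contains a half-space of a Euclidean direction \<open>e\<close> in which the metric is invariant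
  under translations along \<open>e\<close>. The translates of a small ball by multiples of its diameter are
  disjoint, and a test function is integrable, so its integrals over these translates have infimum \<open>0\<close>.
  Comparing the ball with its far translates shows that the ball is controlled
  (\<open>half_space_controlled\<close>, \<open>end_controlled\<close>). The constant depends only on the time that a point of
  the half-space spends in the moving ball. The Riemannian volume has to be known in the
  product coordinates of the end, which is the change of variables formula
  (\<open>nn_integral_adapted_chart\<close>).

  Spreading. Inside a small coordinate ball the metric and the volume are comparable with the Euclidean
  ones, so control passes from a ball to its translates. Hence the points with a controlled
  neighbourhood form an open and closed set, which is all of the connected manifold
  (\<open>gradient_controlled_nhd\<close>), and every compact set is controlled (\<open>gradient_controlled_compact\<close>).

  Boundedness. As \<open>M\<close> is complete, the bounded set \<open>Kt\<close> lies in a compact set: this is the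
  Hopf--Rinow theorem (\<open>Hopf_Rinow\<close>, \<open>bounded_in_compact\<close>). For it, the Riemannian distance has to be
  recognised as a metric inducing the manifold topology, which rests on two estimates in coordinate
  balls: segments are short (\<open>joins_chart_segment\<close>) and curves leaving the ball are long
  (\<open>joins_exit\<close>).
\<close>

section \<open>Change of variables over an arbitrary finite index type\<close>

text \<open>A copy of the index type that is ordered by a numbering. Reindexing along a bijection transfers the
  change of variables theorem, which is formulated for well-ordered index types, to all finite ones.\<close>

typedef 'n index = "{..<CARD('n::finite)}"
  by (rule exI[of _ 0]) (simp add: card_gt_0_iff)

instantiation index :: (finite) linorder
begin

definition less_eq_index :: "'a index \<Rightarrow> 'a index \<Rightarrow> bool" where
  "less_eq_index i j \<longleftrightarrow> Rep_index i \<le> Rep_index j"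

definition less_index :: "'a index \<Rightarrow> 'a index \<Rightarrow> bool" where
  "less_index i j \<longleftrightarrow> Rep_index i < Rep_index j"

instance
  by standard (auto simp: less_eq_index_def less_index_def Rep_index_inject)

end

instance index :: (finite) wellorder
proof
  fix P :: "'a index \<Rightarrow> bool" and a
  assume step: "\<And>x. (\<And>y. y < x \<Longrightarrow> P y) \<Longrightarrow> P x"
  show "P a"
    by (induction a rule: measure_induct_rule[of Rep_index]) (auto intro: step simp: less_index_def)
qed

instance index :: (finite) finite
proof
  show "finite (UNIV :: 'a index set)"
    using type_definition.univ[OF type_definition_index] by (metis finite_imageI finite_lessThan)
qed

lemma ex_bij_index: "\<exists>\<phi> :: 'n::finite index \<Rightarrow> 'n. bij \<phi>"
proof -
  have "card (UNIV :: 'n index set) = card (UNIV :: 'n set)"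
    using type_definition.card[OF type_definition_index] by (metis card_lessThan)
  then show ?thesis
    using finite_same_card_bij[of "UNIV :: 'n index set" "UNIV :: 'n set"] by auto
qed

definition reindex :: "('m \<Rightarrow> 'n) \<Rightarrow> real^'n::finite \<Rightarrow> real^'m::finite" where
  "reindex \<phi> x = (\<chi> k. x $ \<phi> k)"

lemma reindex_nth [simp]: "reindex \<phi> x $ k = x $ \<phi> k"
  by (simp add: reindex_def)

lemma bounded_linear_reindex: "bounded_linear (reindex \<phi>)"
proof -
  have "linear (reindex \<phi>)"
    by (intro linearI) (auto simp: vec_eq_iff)
  then show ?thesis
    by (rule linear_conv_bounded_linear[THEN iffD1])
qed

lemma continuous_on_reindex: "continuous_on S (reindex \<phi>)"
  by (rule bounded_linear.continuous_on[OF bounded_linear_reindex continuous_on_id])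

lemma borel_measurable_reindex [measurable]: "reindex \<phi> \<in> borel_measurable borel"
  by (rule borel_measurable_continuous_onI) (rule continuous_on_reindex)

lemma reindex_inv:
  assumes "bij \<phi>"
  shows "reindex (inv \<phi>) (reindex \<phi> x) = x" "reindex \<phi> (reindex (inv \<phi>) y) = y"
  using assms by (auto simp: vec_eq_iff bij_is_surj bij_is_inj surj_f_inv_f inv_f_f)

lemma emeasure_lborel_box_cart:
  fixes l u :: "real^'n::finite"
  assumes "\<And>i. l $ i \<le> u $ i"
  shows "emeasure lborel (box l u) = ennreal (\<Prod>i\<in>UNIV. u $ i - l $ i)"
proof -
  have *: "b \<in> Basis \<Longrightarrow> l \<bullet> b \<le> u \<bullet> b" for b
    using assms by (auto simp: Basis_vec_def inner_axis)
  then have "cbox l u \<noteq> {}"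
    by (simp add: box_ne_empty)
  then have "measure lborel (cbox l u) = (\<Prod>i\<in>UNIV. u $ i - l $ i)"
    by (rule content_cbox_cart)
  moreover have "measure lborel (cbox l u) = (\<Prod>b\<in>Basis. (u - l) \<bullet> b)"
    using * by (simp add: content_cbox inner_diff_left)
  ultimately show ?thesis
    using * by (simp add: emeasure_lborel_box)
qed

lemma distr_reindex_lborel:
  fixes \<phi> :: "'m::finite \<Rightarrow> 'n::finite"
  assumes \<phi>: "bij \<phi>"
  shows "distr lborel borel (reindex \<phi>) = lborel"
proof (rule lborel_eqI[symmetric])
  fix l u :: "real^'m"
  assume lu: "\<And>b. b \<in> Basis \<Longrightarrow> l \<bullet> b \<le> u \<bullet> b"
  have lu': "l $ i \<le> u $ i" for i
    using lu[of "axis i 1"] by (auto simp: Basis_vec_def inner_axis)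
  have "reindex \<phi> -` box l u = box (reindex (inv \<phi>) l) (reindex (inv \<phi>) u)"
  proof -
    have "(\<forall>k. l $ k < x $ \<phi> k \<and> x $ \<phi> k < u $ k)
        \<longleftrightarrow> (\<forall>i. l $ inv \<phi> i < x $ i \<and> x $ i < u $ inv \<phi> i)" for x
      using \<phi> by (metis bij_inv_eq_iff)
    then show ?thesis
      by (auto simp: mem_box_cart)
  qed
  then have "emeasure (distr lborel borel (reindex \<phi>)) (box l u)
      = emeasure lborel (box (reindex (inv \<phi>) l) (reindex (inv \<phi>) u))"
    by (subst emeasure_distr) (auto simp: borel_measurable_reindex)
  also have "\<dots> = ennreal (\<Prod>i\<in>UNIV. u $ (inv \<phi>) i - l $ (inv \<phi>) i)"
    by (subst emeasure_lborel_box_cart) (auto simp: lu')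
  also have "(\<Prod>i\<in>UNIV. u $ (inv \<phi>) i - l $ (inv \<phi>) i) = (\<Prod>i\<in>UNIV. u $ i - l $ i)"
    using prod.reindex_bij_betw[OF bij_imp_bij_inv[OF \<phi>], of "\<lambda>i. u $ i - l $ i"] by simp
  also have "ennreal \<dots> = emeasure lborel (box l u)"
    by (subst emeasure_lborel_box_cart) (auto simp: lu')
  finally show "emeasure (distr lborel borel (reindex \<phi>)) (box l u) = (\<Prod>b\<in>Basis. (u - l) \<bullet> b)"
    using lu by (simp add: emeasure_lborel_box)
qed simp

text \<open>Conjugation by the bijection matches the permutations of the two index types and preserves their
  signs.\<close>

lemma det_reindex:
  fixes A :: "real^'n^'n::finite" and \<phi> :: "'m::finite \<Rightarrow> 'n"
  assumes \<phi>: "bij \<phi>"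
  shows "det (\<chi> i j. A $ \<phi> i $ \<phi> j) = det A"
proof -
  let ?m = "map_permutation UNIV \<phi>"
  have inj: "inj \<phi>" and surj: "\<phi> ` UNIV = UNIV"
    using \<phi> by (auto simp: bij_def)
  have bij: "bij_betw ?m {p. p permutes UNIV} {p. p permutes UNIV}"
  proof (rule bij_betw_byWitness[where f' = "map_permutation UNIV (inv \<phi>)"])
    show "\<forall>p\<in>{p. p permutes UNIV}. map_permutation UNIV (inv \<phi>) (?m p) = p"
      using \<phi> by (auto intro!: map_permutation_compose_inv bij_imp_bij_inv simp: bij_is_inj inv_f_f)
    show "\<forall>p\<in>{p. p permutes UNIV}. ?m (map_permutation UNIV (inv \<phi>) p) = p"
      using \<phi> by (auto intro!: map_permutation_compose_inv bij_imp_bij_inv simp: bij_is_surj surj_f_inv_f)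
    show "?m ` {p. p permutes UNIV} \<subseteq> {p. p permutes UNIV}"
      using map_permutation_permutes[OF \<phi>] by blast
    show "map_permutation UNIV (inv \<phi>) ` {p. p permutes UNIV} \<subseteq> {p. p permutes UNIV}"
      using map_permutation_permutes[OF bij_imp_bij_inv[OF \<phi>]] by blast
  qed
  have "det A = (\<Sum>q | q permutes UNIV. of_int (sign q) * (\<Prod>i\<in>UNIV. A $ i $ q i))"
    by (simp add: det_def)
  also have "\<dots> = (\<Sum>p | p permutes UNIV. of_int (sign (?m p)) * (\<Prod>i\<in>UNIV. A $ i $ (?m p) i))"
    by (rule sum.reindex_bij_betw[OF bij, symmetric])
  also have "\<dots> = (\<Sum>p | p permutes UNIV. of_int (sign p) * (\<Prod>k\<in>UNIV. A $ \<phi> k $ \<phi> (p k)))"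
  proof (rule sum.cong[OF refl], goal_cases)
    case (1 p)
    then have p: "p permutes UNIV" by simp
    have "(\<Prod>i\<in>UNIV. A $ i $ (?m p) i) = (\<Prod>k\<in>UNIV. A $ \<phi> k $ (?m p) (\<phi> k))"
      by (rule prod.reindex_bij_betw[OF \<phi>, symmetric])
    also have "\<dots> = (\<Prod>k\<in>UNIV. A $ \<phi> k $ \<phi> (p k))"
      by (simp add: map_permutation_apply[OF inj])
    finally show ?case
      using sign_map_permutation[OF inj p] by simp
  qed
  finally show ?thesis
    by (simp add: det_def)
qed

text \<open>Finiteness of the measure and existence of the gauge integral of \<open>\<bar>det \<sigma>'\<bar>\<close> are equivalent, so the two sides
  are infinite at the same time.\<close>

lemma emeasure_differentiable_image_wellorder:
  fixes \<sigma> :: "real^'n::{finite,wellorder} \<Rightarrow> real^'n::_"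
  assumes S: "S \<in> sets borel" "\<sigma> ` S \<in> sets borel"
    and der: "\<And>x. x \<in> S \<Longrightarrow> (\<sigma> has_derivative \<sigma>' x) (at x)"
    and inj: "inj_on \<sigma> S"
    and [measurable]: "(\<lambda>x. indicator S x * \<bar>det (matrix (\<sigma>' x))\<bar>) \<in> borel_measurable borel"
  shows "emeasure lborel (\<sigma> ` S) = (\<integral>\<^sup>+x. ennreal (indicator S x * \<bar>det (matrix (\<sigma>' x))\<bar>) \<partial>lborel)"
proof -
  let ?f = "\<lambda>x. indicator S x * \<bar>det (matrix (\<sigma>' x))\<bar>"
  have f_eq: "?f = (\<lambda>x. if x \<in> S then \<bar>det (matrix (\<sigma>' x))\<bar> else 0)"
    by (auto simp: fun_eq_iff)
  have SL: "S \<in> sets lebesgue"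
    using S(1) by simp
  have der': "\<And>x. x \<in> S \<Longrightarrow> (\<sigma> has_derivative \<sigma>' x) (at x within S)"
    using der has_derivative_at_withinI by blast
  show ?thesis
  proof (cases "(\<integral>\<^sup>+x. ennreal (?f x) \<partial>lborel) < \<infinity>")
    case True
    then have "?f integrable_on UNIV"
      by (intro nn_integral_integrable_on) auto
    then obtain m where m: "(?f has_integral m) UNIV"
      by (auto simp: integrable_on_def)
    then have nn: "(\<integral>\<^sup>+x. ennreal (?f x) \<partial>lborel) = ennreal m"
      by (intro nn_integral_has_integral_lborel) auto
    have "((\<lambda>x. \<bar>det (matrix (\<sigma>' x))\<bar>) has_integral m) S"
      using m unfolding f_eq by (subst (asm) has_integral_restrict_UNIV) 
    then have *: "\<sigma> ` S \<in> lmeasurable" "measure lebesgue (\<sigma> ` S) = m"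
      using has_measure_differentiable_image[OF SL der' inj, of m] by auto
    then have "emeasure lebesgue (\<sigma> ` S) = ennreal m"
      by (metis emeasure_eq_measure2)
    then show ?thesis
      using nn S(2) by simp
  next
    case False
    have "\<sigma> ` S \<notin> lmeasurable"
    proof
      assume "\<sigma> ` S \<in> lmeasurable"
      then have "((\<lambda>x. \<bar>det (matrix (\<sigma>' x))\<bar>) has_integral (measure lebesgue (\<sigma> ` S))) S"
        using has_measure_differentiable_image[OF SL der' inj] by blast
      then have "(?f has_integral (measure lebesgue (\<sigma> ` S))) UNIV"
        unfolding f_eq by (subst has_integral_restrict_UNIV)
      then have "(\<integral>\<^sup>+x. ennreal (?f x) \<partial>lborel) = ennreal (measure lebesgue (\<sigma> ` S))"
        by (intro nn_integral_has_integral_lborel) auto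
      with False show False by simp
    qed
    have "\<not> emeasure lborel (\<sigma> ` S) < \<infinity>"
    proof
      assume "emeasure lborel (\<sigma> ` S) < \<infinity>"
      then have "\<sigma> ` S \<in> lmeasurable"
        using S(2) by (intro fmeasurableI) auto
      with \<open>\<sigma> ` S \<notin> lmeasurable\<close> show False ..
    qed
    with False show ?thesis
      by (metis infinity_ennreal_def top.not_eq_extremum)
  qed
qed

lemma emeasure_differentiable_image:
  fixes \<sigma> :: "real^'n::finite \<Rightarrow> real^'n"
  assumes S: "S \<in> sets borel" "\<sigma> ` S \<in> sets borel"
    and der: "\<And>x. x \<in> S \<Longrightarrow> (\<sigma> has_derivative \<sigma>' x) (at x)"
    and inj: "inj_on \<sigma> S"
    and meas [measurable]: "(\<lambda>x. indicator S x * \<bar>det (matrix (\<sigma>' x))\<bar>) \<in> borel_measurable borel"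
  shows "emeasure lborel (\<sigma> ` S) = (\<integral>\<^sup>+x. ennreal (indicator S x * \<bar>det (matrix (\<sigma>' x))\<bar>) \<partial>lborel)"
proof -
  let ?D = "\<lambda>x. indicator S x * \<bar>det (matrix (\<sigma>' x))\<bar>"
  obtain \<phi> :: "'n index \<Rightarrow> 'n" where \<phi>: "bij \<phi>"
    using ex_bij_index by blast
  define P :: "real^'n \<Rightarrow> real^'n index" where "P = reindex \<phi>"
  define Q where "Q = reindex (inv \<phi>)"
  have PQ [simp]: "P (Q y) = y" and QP [simp]: "Q (P x) = x" for x y
    using reindex_inv[OF \<phi>] by (auto simp: P_def Q_def)
  have blP: "bounded_linear P" and blQ: "bounded_linear Q"
    by (auto simp: P_def Q_def bounded_linear_reindex)
  have [measurable]: "P \<in> borel_measurable borel" "Q \<in> borel_measurable borel"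
    by (auto simp: P_def Q_def)
  have imP: "P ` T = Q -` T" for T
    by (auto simp: image_iff) (metis PQ)
  have P_sets: "P ` T \<in> sets borel" if "T \<in> sets borel" for T
    unfolding imP using measurable_sets[of Q borel borel T] that by simp
  have emP: "emeasure lborel (P ` T) = emeasure lborel T" if "T \<in> sets borel" for T
  proof -
    have "emeasure lborel (P ` T) = emeasure (distr lborel borel P) (P ` T)"
      unfolding P_def distr_reindex_lborel[OF \<phi>] ..
    also have "\<dots> = emeasure lborel (P -` P ` T)"
      by (subst emeasure_distr) (auto simp: P_sets that)
    also have "P -` P ` T = T"
      by (auto simp: imP)
    finally show ?thesis .
  qed
  define \<sigma>2 where "\<sigma>2 = P \<circ> \<sigma> \<circ> Q"
  define \<sigma>2' where "\<sigma>2' y = P \<circ> \<sigma>' (Q y) \<circ> Q" for y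
  have det2: "det (matrix (\<sigma>2' y)) = det (matrix (\<sigma>' (Q y)))" for y
  proof -
    have "matrix (\<sigma>2' y) = (\<chi> i j. matrix (\<sigma>' (Q y)) $ \<phi> i $ \<phi> j)"
    proof -
      have "Q (axis j 1) = axis (\<phi> j) 1" for j
        using \<phi> by (auto simp: vec_eq_iff Q_def axis_def bij_is_surj bij_is_inj surj_f_inv_f inv_f_f)
      then have "matrix (\<sigma>2' y) $ i $ j = matrix (\<sigma>' (Q y)) $ \<phi> i $ \<phi> j" for i j
        by (simp only: matrix_def \<sigma>2'_def P_def vec_lambda_beta o_apply reindex_nth)
      then show ?thesis
        by (simp add: vec_eq_iff)
    qed
    then show ?thesis
      using det_reindex[OF \<phi>] by simp
  qed
  have img: "\<sigma>2 ` (P ` S) = P ` (\<sigma> ` S)"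
    by (force simp: \<sigma>2_def image_comp)
  have mm: "(\<lambda>y. indicator (P ` S) y * \<bar>det (matrix (\<sigma>2' y))\<bar>)
      = (\<lambda>x. indicator S x * \<bar>det (matrix (\<sigma>' x))\<bar>) \<circ> Q"
    by (auto simp: fun_eq_iff imP det2 indicator_def)
  have "emeasure lborel (\<sigma> ` S) = emeasure lborel (\<sigma>2 ` (P ` S))"
    unfolding img by (rule emP[OF S(2), symmetric])
  also have "\<dots> = (\<integral>\<^sup>+y. ennreal (indicator (P ` S) y * \<bar>det (matrix (\<sigma>2' y))\<bar>) \<partial>lborel)"
  proof (rule emeasure_differentiable_image_wellorder)
    show "P ` S \<in> sets borel" "\<sigma>2 ` (P ` S) \<in> sets borel"
      unfolding img using P_sets S by auto
    show "inj_on \<sigma>2 (P ` S)"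
      using inj by (auto simp: inj_on_def \<sigma>2_def) (metis QP)
    show "(\<lambda>y. indicator (P ` S) y * \<bar>det (matrix (\<sigma>2' y))\<bar>) \<in> borel_measurable borel"
      unfolding mm by measurable
    show "(\<sigma>2 has_derivative \<sigma>2' y) (at y)" if "y \<in> P ` S" for y
    proof -
      have "Q y \<in> S" using that by auto
      then show ?thesis
        unfolding \<sigma>2_def \<sigma>2'_def comp_assoc
        by (intro diff_chain_at bounded_linear_imp_has_derivative blP blQ) (auto intro: der)
    qed
  qed
  also have "\<dots> = (\<integral>\<^sup>+y. ennreal (((\<lambda>x. indicator S x * \<bar>det (matrix (\<sigma>' x))\<bar>) \<circ> Q) y) \<partial>lborel)"
    by (simp add: mm[symmetric])
  also have "\<dots> = (\<integral>\<^sup>+y. ennreal (((\<lambda>x. indicator S x * \<bar>det (matrix (\<sigma>' x))\<bar>) \<circ> Q) y) \<partial>(distr lborel borel P))"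
    unfolding P_def distr_reindex_lborel[OF \<phi>] ..
  also have "\<dots> = (\<integral>\<^sup>+x. ennreal (indicator S x * \<bar>det (matrix (\<sigma>' x))\<bar>) \<partial>lborel)"
  proof -
    have "(\<integral>\<^sup>+y. ennreal ((?D \<circ> Q) y) \<partial>(distr lborel borel P)) = (\<integral>\<^sup>+x. ennreal ((?D \<circ> Q) (P x)) \<partial>lborel)"
    proof (rule nn_integral_distr)
      have "(\<lambda>y. ennreal ((?D \<circ> Q) y)) \<in> borel_measurable borel"
        unfolding o_def by (intro measurable_compose[OF _ measurable_ennreal] measurable_compose[OF _ meas])
          (simp add: Q_def)
      then show "(\<lambda>y. ennreal ((?D \<circ> Q) y)) \<in> borel_measurable (distr lborel borel P)"
        by simp
    qed (simp add: P_def)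
    then show ?thesis by simp
  qed
  finally show ?thesis .
qed

text \<open>Applying the formula for sets to the preimages under \<open>\<sigma>\<close> identifies the image of the measure with
  density \<open>\<bar>det \<sigma>'\<bar>\<close> on \<open>S\<close> as Lebesgue measure on \<open>T\<close>. The continuous inverse \<open>\<tau>\<close> serves to keep images
  of Borel sets Borel.\<close>

theorem nn_integral_change_of_variables:
  fixes \<sigma> \<tau> :: "real^'n::finite \<Rightarrow> real^'n"
  assumes S [measurable]: "S \<in> sets borel" and T [measurable]: "T \<in> sets borel"
    and im: "\<sigma> ` S = T"
    and inv: "\<And>x. x \<in> S \<Longrightarrow> \<tau> (\<sigma> x) = x"
    and \<tau>: "continuous_on T \<tau>"
    and der: "\<And>x. x \<in> S \<Longrightarrow> (\<sigma> has_derivative \<sigma>' x) (at x)"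
    and meas [measurable]: "(\<lambda>x. indicator S x * \<bar>det (matrix (\<sigma>' x))\<bar>) \<in> borel_measurable borel"
    and h [measurable]: "h \<in> borel_measurable borel"
  shows "(\<integral>\<^sup>+y. h y * indicator T y \<partial>lborel)
    = (\<integral>\<^sup>+x. ennreal \<bar>det (matrix (\<sigma>' x))\<bar> * h (\<sigma> x) * indicator S x \<partial>lborel)"
proof -
  let ?D = "\<lambda>x. indicator S x * \<bar>det (matrix (\<sigma>' x))\<bar>"
  define \<sigma>0 where "\<sigma>0 x = indicator S x *\<^sub>R \<sigma> x" for x
  define \<tau>0 where "\<tau>0 y = indicator T y *\<^sub>R \<tau> y" for y
  have cont: "continuous_on S \<sigma>"
    using der by (meson continuous_at_imp_continuous_on has_derivative_continuous)
  have [measurable]: "\<sigma>0 \<in> borel_measurable borel" "\<tau>0 \<in> borel_measurable borel"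
    unfolding \<sigma>0_def \<tau>0_def by (auto intro!: borel_measurable_continuous_on_indicator cont \<tau>)
  have inj: "inj_on \<sigma> S"
    by (metis inj_on_inverseI inv)
  have eq: "distr (density lborel ?D) borel \<sigma>0 = density lborel (indicator T)"
  proof (rule measure_eqI)
    fix B :: "(real^'n) set" assume "B \<in> sets (distr (density lborel ?D) borel \<sigma>0)"
    then have B [measurable]: "B \<in> sets borel" by simp
    have SB: "S \<inter> \<sigma>0 -` B \<in> sets borel"
      using measurable_sets[of \<sigma>0 borel borel B] by auto
    have im': "\<sigma> ` (S \<inter> \<sigma>0 -` B) = T \<inter> B"
      using im by (auto simp: \<sigma>0_def)
    have "emeasure (distr (density lborel ?D) borel \<sigma>0) B = emeasure (density lborel ?D) (\<sigma>0 -` B)"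
      by (subst emeasure_distr) auto
    also have "\<dots> = (\<integral>\<^sup>+x. ennreal (?D x) * indicator (\<sigma>0 -` B) x \<partial>lborel)"
      using measurable_sets[of \<sigma>0 borel borel B] by (subst emeasure_density) auto
    also have "\<dots> = (\<integral>\<^sup>+x. ennreal (indicator (S \<inter> \<sigma>0 -` B) x * \<bar>det (matrix (\<sigma>' x))\<bar>) \<partial>lborel)"
      by (intro nn_integral_cong) (auto simp: indicator_def)
    also have "\<dots> = emeasure lborel (\<sigma> ` (S \<inter> \<sigma>0 -` B))"
    proof (rule emeasure_differentiable_image[symmetric])
      show "S \<inter> \<sigma>0 -` B \<in> sets borel" "\<sigma> ` (S \<inter> \<sigma>0 -` B) \<in> sets borel"
        unfolding im' using SB by auto
      have "(\<lambda>x. indicator (S \<inter> \<sigma>0 -` B) x * \<bar>det (matrix (\<sigma>' x))\<bar>)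
          = (\<lambda>x. indicator (S \<inter> \<sigma>0 -` B) x * ?D x)"
        by (auto simp: indicator_def)
      then show "(\<lambda>x. indicator (S \<inter> \<sigma>0 -` B) x * \<bar>det (matrix (\<sigma>' x))\<bar>) \<in> borel_measurable borel"
        using SB by simp
    qed (use der inj in \<open>auto intro: inj_on_subset\<close>)
    also have "\<dots> = emeasure (density lborel (indicator T)) B"
    proof -
      have "emeasure (density lborel (indicator T)) B = (\<integral>\<^sup>+x. indicator T x * indicator B x \<partial>lborel)"
        by (rule emeasure_density) auto
      also have "\<dots> = (\<integral>\<^sup>+x. indicator (T \<inter> B) x \<partial>lborel)"
        by (simp add: indicator_inter_arith)
      finally show ?thesis
        unfolding im' by simp
    qed
    finally show "emeasure (distr (density lborel ?D) borel \<sigma>0) B = emeasure (density lborel (indicator T)) B" .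
  qed simp
  have "(\<integral>\<^sup>+y. h y * indicator T y \<partial>lborel) = (\<integral>\<^sup>+y. h y \<partial>(density lborel (indicator T)))"
    by (subst nn_integral_density) (auto simp: mult.commute)
  also have "\<dots> = (\<integral>\<^sup>+x. ennreal (?D x) * h (\<sigma>0 x) \<partial>lborel)"
    unfolding eq[symmetric] by (subst nn_integral_distr) (auto simp: nn_integral_density)
  also have "\<dots> = (\<integral>\<^sup>+x. ennreal \<bar>det (matrix (\<sigma>' x))\<bar> * h (\<sigma> x) * indicator S x \<partial>lborel)"
    by (intro nn_integral_cong) (auto simp: indicator_def \<sigma>0_def)
  finally show ?thesis .
qed

section \<open>Linear algebra of metrics\<close>

text \<open>The segment from the identity matrix to \<open>G\<close> consists of positive definite, hence regular matrices, so
  the determinant cannot change its sign along it.\<close>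

lemma det_pos_of_pos_definite:
  fixes G :: "real^'n^'n::finite"
  assumes pos: "\<And>v. v \<noteq> 0 \<Longrightarrow> 0 < v \<bullet> (G *v v)"
  shows "0 < det G"
proof (rule ccontr)
  assume neg: "\<not> 0 < det G"
  define H where "H t = (1 - t) *\<^sub>R mat 1 + t *\<^sub>R G" for t :: real
  have "continuous_on {0..1} (\<lambda>t. det (H t))"
    unfolding H_def det_def by (intro continuous_intros)
  moreover have "det (H 0) = 1" "det (H 1) = det G"
    by (simp_all add: H_def)
  ultimately obtain t where t: "0 \<le> t" "t \<le> 1" "det (H t) = 0"
    using IVT2'[of "\<lambda>t. det (H t)" 1 0 0] neg by auto
  then obtain v where v: "v \<noteq> 0" "H t *v v = 0"
    using matrix_left_invertible_ker[of "H t"] invertible_det_nz[of "H t"] invertible_left_inverse[of "H t"]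
    by auto
  have *: "v \<bullet> (H t *v v) = (1 - t) * (v \<bullet> v) + t * (v \<bullet> (G *v v))"
    by (simp add: H_def matrix_vector_mult_add_rdistrib inner_add_right flip: scaleR_matrix_vector_assoc)
  have "v \<bullet> v > 0" using v by simp
  then have "(1 - t) * (v \<bullet> v) + t * (v \<bullet> (G *v v)) > 0"
    using pos[OF v(1)] t by (cases "t = 0") (auto intro!: add_nonneg_pos)
  then show False
    using v * by simp
qed

text \<open>The form is nonnegative at \<open>B a - r b\<close>, where \<open>B\<close> is its value at \<open>b\<close> and \<open>r\<close> its value at the pair \<open>a\<close>,
  \<open>b\<close>; this vector is \<open>B\<close> times the component of \<open>a\<close> orthogonal to \<open>b\<close>.\<close>

lemma form_Cauchy_Schwarz:
  fixes G :: "real^'n^'n::finite"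
  assumes pos: "\<And>v. v \<noteq> 0 \<Longrightarrow> 0 < v \<bullet> (G *v v)"
    and sym: "\<And>i j. G $ i $ j = G $ j $ i"
  shows "\<bar>a \<bullet> (G *v b)\<bar> \<le> sqrt (a \<bullet> (G *v a)) * sqrt (b \<bullet> (G *v b))"
proof (cases "b = 0")
  case False
  have tG: "transpose G = G"
    by (simp add: transpose_def vec_eq_iff sym)
  have symm: "x \<bullet> (G *v y) = y \<bullet> (G *v x)" for x y
    by (metis tG dot_lmul_matrix inner_commute transpose_matrix_vector)
  have nonneg: "0 \<le> x \<bullet> (G *v x)" for x
    using pos[of x] by (cases "x = 0") auto
  define B where "B = b \<bullet> (G *v b)"
  define r where "r = a \<bullet> (G *v b)"
  have B: "B > 0" unfolding B_def by (rule pos[OF False])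
  have "0 \<le> (B *\<^sub>R a - r *\<^sub>R b) \<bullet> (G *v (B *\<^sub>R a - r *\<^sub>R b))"
    by (rule nonneg)
  also have "\<dots> = B * (B * (a \<bullet> (G *v a)) - r^2)"
    by (simp add: matrix_vector_mult_diff_distrib matrix_vector_mult_scaleR inner_diff_left
        inner_diff_right symm[of b a] flip: r_def B_def) (simp add: algebra_simps power2_eq_square)
  finally have "r^2 \<le> (a \<bullet> (G *v a)) * B"
    using B by (simp add: zero_le_mult_iff mult.commute)
  then have "sqrt (r^2) \<le> sqrt ((a \<bullet> (G *v a)) * B)"
    by (rule real_sqrt_le_mono)
  then show ?thesis
    by (simp add: real_sqrt_mult r_def B_def)
qed simp

text \<open>Since \<open>G\<close> maps the gradient \<open>G\<^sup>-\<^sup>1 d\<close> to the differential \<open>d\<close>, this is Cauchy--Schwarz for \<open>w\<close> and the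
  gradient.\<close>

lemma gradient_inner_bound:
  fixes G :: "real^'n^'n::finite"
  assumes pos: "\<And>v. v \<noteq> 0 \<Longrightarrow> 0 < v \<bullet> (G *v v)"
    and sym: "\<And>i j. G $ i $ j = G $ j $ i"
  shows "\<bar>w \<bullet> d\<bar> \<le> sqrt (w \<bullet> (G *v w)) * sqrt ((matrix_inv G *v d) \<bullet> (G *v (matrix_inv G *v d)))"
proof -
  have "invertible G"
    using det_pos_of_pos_definite[OF pos] by (simp add: invertible_det_nz)
  then have "G *v (matrix_inv G *v d) = d"
    unfolding matrix_inv_def invertible_def matrix_vector_mul_assoc
    by (rule someI2_ex) simp
  then show ?thesis
    using form_Cauchy_Schwarz[OF pos sym, of w "matrix_inv G *v d"] by simp
qed

section \<open>Functions of class \<open>C\<^sup>1\<close>\<close>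

text \<open>Continuity of the derivative is required for each direction separately, which in finite dimension is
  the same as continuity in operator norm.\<close>

definition C1_on ::
  "(real^'n::finite) set \<Rightarrow> (real^'n \<Rightarrow> 'b::real_normed_vector) \<Rightarrow> (real^'n \<Rightarrow> real^'n \<Rightarrow> 'b) \<Rightarrow> bool" where
  "C1_on S f f' \<longleftrightarrow>
     (\<forall>x\<in>S. (f has_derivative f' x) (at x)) \<and> (\<forall>v. continuous_on S (\<lambda>x. f' x v))"

lemma C1_on_subset: "C1_on S f f' \<Longrightarrow> T \<subseteq> S \<Longrightarrow> C1_on T f f'"
  unfolding C1_on_def by (meson continuous_on_subset subsetD)

lemma C1_on_cong:
  assumes "C1_on S f f'" "open S" "\<And>x. x \<in> S \<Longrightarrow> f x = g x"
  shows "C1_on S g f'"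
  using assms unfolding C1_on_def by (metis has_derivative_transform_within_open)

lemma partial_eq:
  assumes "(f has_derivative f') (at x)"
  shows "partial j f x = f' (axis j 1)"
proof -
  have "((\<lambda>t. x + t *\<^sub>R axis j 1) has_derivative (\<lambda>t. t *\<^sub>R axis j 1)) (at 0)"
    by (auto intro!: derivative_eq_intros)
  moreover have "(f has_derivative f') (at (x + 0 *\<^sub>R axis j 1))"
    using assms by simp
  ultimately have "(f \<circ> (\<lambda>t. x + t *\<^sub>R axis j 1) has_derivative f' \<circ> (\<lambda>t. t *\<^sub>R axis j 1)) (at 0)"
    by (rule diff_chain_at)
  moreover have "f' \<circ> (\<lambda>t. t *\<^sub>R axis j 1) = (\<lambda>t. t *\<^sub>R f' (axis j 1))"
    using has_derivative_linear[OF assms] by (auto simp: linear_cmul fun_eq_iff)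
  ultimately have "((\<lambda>t. f (x + t *\<^sub>R axis j 1)) has_vector_derivative f' (axis j 1)) (at 0)"
    by (simp add: has_vector_derivative_def o_def)
  then show ?thesis
    unfolding partial_def by (rule vector_derivative_at)
qed

lemma linear_sum_axis:
  fixes L :: "real^'n::finite \<Rightarrow> 'b::real_normed_vector"
  assumes "linear L"
  shows "L v = (\<Sum>i\<in>UNIV. v $ i *\<^sub>R L (axis i 1))"
proof -
  have "v = (\<Sum>i\<in>UNIV. v $ i *\<^sub>R axis i 1)"
    by (simp add: vec_eq_iff axis_def if_distrib cong: if_cong)
  then have "L v = L (\<Sum>i\<in>UNIV. v $ i *\<^sub>R axis i 1)"
    by (rule arg_cong)
  then show ?thesis
    by (simp add: linear_sum[OF assms] linear_cmul[OF assms])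
qed

lemma smooth_in_C1_on:
  fixes f :: "real^'n::finite \<Rightarrow> 'b::real_normed_vector"
  assumes "smooth_in UNIV S f" "open S"
  shows "C1_on S f (\<lambda>x. frechet_derivative f (at x))"
proof -
  have "Ck (Suc 0) UNIV S f"
    using assms by (simp only: smooth_in_def)
  then have diff: "\<And>x. x \<in> S \<Longrightarrow> f differentiable (at x)"
    and cont: "\<And>j. continuous_on S (partial j f)"
    using at_within_open[OF _ assms(2)] by auto
  have der: "(f has_derivative frechet_derivative f (at x)) (at x)" if "x \<in> S" for x
    using diff[OF that] by (simp add: frechet_derivative_works)
  have "continuous_on S (\<lambda>x. frechet_derivative f (at x) v)" for v
  proof (rule continuous_on_eq)
    show "continuous_on S (\<lambda>x. \<Sum>i\<in>UNIV. v $ i *\<^sub>R partial i f x)"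
      by (intro continuous_intros cont)
    show "(\<Sum>i\<in>UNIV. v $ i *\<^sub>R partial i f x) = frechet_derivative f (at x) v" if "x \<in> S" for x
      using linear_sum_axis[OF has_derivative_linear[OF der[OF that]], of v]
      by (simp add: partial_eq[OF der[OF that]])
  qed
  with der show ?thesis
    by (simp add: C1_on_def)
qed

lemma C1_on_continuous: "C1_on S f f' \<Longrightarrow> continuous_on S f"
  unfolding C1_on_def by (meson continuous_at_imp_continuous_on has_derivative_continuous)

lemma C1_on_compose:
  fixes \<sigma> :: "real^'n::finite \<Rightarrow> real^'m::finite"
  assumes \<sigma>: "C1_on S \<sigma> \<sigma>'" and f: "C1_on T f f'" and sub: "\<sigma> ` S \<subseteq> T"
  shows "C1_on S (f \<circ> \<sigma>) (\<lambda>x. f' (\<sigma> x) \<circ> \<sigma>' x)"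
proof -
  have "(f \<circ> \<sigma> has_derivative f' (\<sigma> x) \<circ> \<sigma>' x) (at x)" if "x \<in> S" for x
    using \<sigma> f sub that by (intro diff_chain_at) (auto simp: C1_on_def)
  moreover have "continuous_on S (\<lambda>x. (f' (\<sigma> x) \<circ> \<sigma>' x) v)" for v
  proof (rule continuous_on_eq)
    have "continuous_on S (\<lambda>x. f' (\<sigma> x) (axis i 1))" for i
    proof -
      have "continuous_on (\<sigma> ` S) (\<lambda>y. f' y (axis i 1))"
        using f sub by (auto simp: C1_on_def intro: continuous_on_subset)
      then show ?thesis
        by (rule continuous_on_compose2[OF _ C1_on_continuous[OF \<sigma>]]) auto
    qed
    moreover have "continuous_on S (\<lambda>x. \<sigma>' x v)"
      using \<sigma> by (simp add: C1_on_def)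
    ultimately show "continuous_on S (\<lambda>x. \<Sum>i\<in>UNIV. \<sigma>' x v $ i *\<^sub>R f' (\<sigma> x) (axis i 1))"
      by (intro continuous_intros)
    show "(\<Sum>i\<in>UNIV. \<sigma>' x v $ i *\<^sub>R f' (\<sigma> x) (axis i 1)) = (f' (\<sigma> x) \<circ> \<sigma>' x) v" if "x \<in> S" for x
    proof -
      have "linear (f' (\<sigma> x))"
        using f sub that by (auto simp: C1_on_def intro: has_derivative_linear)
      from linear_sum_axis[OF this, of "\<sigma>' x v"] show ?thesis by simp
    qed
  qed
  ultimately show ?thesis
    by (simp add: C1_on_def)
qed

text \<open>Derivatives are unique, so local ones fit together to the Frechet derivative.\<close>

lemma C1_on_local:
  assumes "\<And>x. x \<in> \<Omega> \<Longrightarrow> \<exists>S f'. open S \<and> x \<in> S \<and> C1_on S f f'"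
  shows "C1_on \<Omega> f (\<lambda>x. frechet_derivative f (at x))"
  unfolding C1_on_def
proof (intro conjI ballI allI)
  fix x assume "x \<in> \<Omega>"
  with assms obtain S f' where "open S" "x \<in> S" "C1_on S f f'" by blast
  then show "(f has_derivative frechet_derivative f (at x)) (at x)"
    by (auto simp: C1_on_def frechet_derivative_works[symmetric] differentiable_def)
next
  fix v
  have "isCont (\<lambda>x. frechet_derivative f (at x) v) x" if "x \<in> \<Omega>" for x
  proof -
    obtain S f' where S: "open S" "x \<in> S" "C1_on S f f'"
      using assms \<open>x \<in> \<Omega>\<close> by blast
    have "continuous_on S (\<lambda>x. frechet_derivative f (at x) v)"
    proof (rule continuous_on_eq)
      show "continuous_on S (\<lambda>x. f' x v)"
        using S by (simp add: C1_on_def)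
      show "f' y v = frechet_derivative f (at y) v" if "y \<in> S" for y
        using S that frechet_derivative_at by (metis C1_on_def)
    qed
    then show ?thesis
      using S continuous_on_eq_continuous_at by blast
  qed
  then show "continuous_on \<Omega> (\<lambda>x. frechet_derivative f (at x) v)"
    by (simp add: continuous_at_imp_continuous_on)
qed

lemma continuous_on_det:
  fixes A :: "'a::topological_space \<Rightarrow> real^'n^'n::finite"
  assumes "\<And>i j. continuous_on S (\<lambda>x. A x $ i $ j)"
  shows "continuous_on S (\<lambda>x. det (A x))"
  unfolding det_def
  by (intro continuous_on_sum continuous_on_mult continuous_on_const continuous_on_prod assms)

lemma C1_on_matrix_continuous:
  assumes "C1_on S \<sigma> \<sigma>'"
  shows "continuous_on S (\<lambda>x. det (matrix (\<sigma>' x)))"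
proof -
  have "continuous_on S (\<lambda>x. \<sigma>' x (axis j 1) $ i)" for i j
    using assms by (intro continuous_on_component) (simp add: C1_on_def)
  then have "continuous_on S (\<lambda>x. matrix (\<sigma>' x) $ i $ j)" for i j
    by (simp add: matrix_def)
  then show ?thesis
    by (rule continuous_on_det)
qed

text \<open>The defining equations of a pullback, which concern coordinate vectors, in bilinear and in matrix
  form.\<close>

lemma pulls_back_UNIV:
  fixes \<tau> :: "real^'n::finite \<Rightarrow> real^'n"
  assumes der: "(\<tau> has_derivative \<tau>') (at x)" and pb: "pulls_back UNIV \<tau> x g h"
  shows "v \<bullet> (g *v w) = \<tau>' v \<bullet> (h *v \<tau>' w)"
    and "g = transpose (matrix \<tau>') ** h ** matrix \<tau>'"
proof -
  have lin: "linear \<tau>'"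
    using der by (rule has_derivative_linear)
  have col: "\<tau>' (axis i 1) = column i (matrix \<tau>')" for i
    by (simp add: matrix_def column_def vec_eq_iff)
  have ent: "g $ i $ j = column i (matrix \<tau>') \<bullet> (h *v column j (matrix \<tau>'))" for i j
    using pb by (simp add: pulls_back_def partial_eq[OF der] col)
  have mc: "h *v column j (matrix \<tau>') = column j (h ** matrix \<tau>')" for j
    by (simp add: matrix_vector_mult_def matrix_matrix_mult_def column_def vec_eq_iff)
  show eq: "g = transpose (matrix \<tau>') ** h ** matrix \<tau>'"
    unfolding vec_eq_iff ent mc matrix_mul_assoc[symmetric]
    by (simp add: matrix_matrix_mult_def transpose_def column_def inner_vec_def)
  have "\<tau>' u = matrix \<tau>' *v u" for u
    using lin by (simp add: matrix_works)
  moreover have "u \<bullet> (transpose J *v z) = (J *v u) \<bullet> z" for u z and J :: "real^'n^'n"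
    by (metis dot_lmul_matrix vector_transpose_matrix)
  ultimately show "v \<bullet> (g *v w) = \<tau>' v \<bullet> (h *v \<tau>' w)"
    unfolding eq by (metis matrix_vector_mul_assoc)
qed

section \<open>Charts\<close>

lemma coords_UNIV [simp]: "coords UNIV = UNIV"
  by (simp add: coords_def)

abbreviation chart_img :: "('a, 'n::finite) chart \<Rightarrow> (real^'n) set" where
  "chart_img c \<equiv> chart_map c ` chart_dom c"

context
  fixes A :: "'n::finite set" and X :: "'a topology" and c :: "('a, 'n) chart"
  assumes tc: "topological_chart A X c"
begin

lemma chart_dom_open: "openin X (chart_dom c)"
  using tc by (simp add: topological_chart_def)

lemma chart_dom_subset: "chart_dom c \<subseteq> topspace X"
  using chart_dom_open by (rule openin_subset)

lemma topspace_chart_dom: "topspace (subtopology X (chart_dom c)) = chart_dom c"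
  using chart_dom_subset by (rule topspace_subtopology_subset)

lemma chart_homeo: "homeomorphic_map (subtopology X (chart_dom c)) (top_of_set (chart_img c)) (chart_map c)"
  using tc by (simp add: topological_chart_def)

lemma chart_inj: "inj_on (chart_map c) (chart_dom c)"
  using homeomorphic_imp_injective_map[OF chart_homeo] unfolding topspace_chart_dom .

lemma chart_inv_map: "p \<in> chart_dom c \<Longrightarrow> chart_inv c (chart_map c p) = p"
  unfolding chart_inv_def by (rule inv_into_f_f[OF chart_inj])

lemma chart_map_inv: "x \<in> chart_img c \<Longrightarrow> chart_map c (chart_inv c x) = x"
  unfolding chart_inv_def by (rule f_inv_into_f)

lemma chart_inv_dom: "x \<in> chart_img c \<Longrightarrow> chart_inv c x \<in> chart_dom c"
  unfolding chart_inv_def by (rule inv_into_into)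

lemma chart_inv_image: "W \<subseteq> chart_img c \<Longrightarrow> chart_inv c ` W = {p \<in> chart_dom c. chart_map c p \<in> W}"
  using chart_inv_dom chart_map_inv chart_inv_map by (safe; metis imageI subsetD)

lemma chart_map_continuous: "continuous_map (subtopology X (chart_dom c)) euclidean (chart_map c)"
  using homeomorphic_imp_continuous_map[OF chart_homeo] continuous_map_in_subtopology by blast

lemma chart_homeo_inv: "homeomorphic_map (top_of_set (chart_img c)) (subtopology X (chart_dom c)) (chart_inv c)"
proof -
  obtain g where g: "homeomorphic_maps (subtopology X (chart_dom c)) (top_of_set (chart_img c)) (chart_map c) g"
    using chart_homeo homeomorphic_map_maps by blast
  then have "homeomorphic_map (top_of_set (chart_img c)) (subtopology X (chart_dom c)) g"
    using homeomorphic_maps_map by blast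
  moreover have "g x = chart_inv c x" if "x \<in> chart_img c" for x
    using g that chart_dom_subset by (auto simp: homeomorphic_maps_def chart_inv_map)
  ultimately show ?thesis
    by (rule homeomorphic_map_eq) simp
qed

lemma chart_inv_continuous: "continuous_map (top_of_set (chart_img c)) X (chart_inv c)"
  using homeomorphic_imp_continuous_map[OF chart_homeo_inv] continuous_map_in_subtopology by blast

lemma chart_compactin_inv:
  assumes "compact W" "W \<subseteq> chart_img c"
  shows "compactin X (chart_inv c ` W)"
  using assms by (intro image_compactin[OF _ chart_inv_continuous]) (simp add: compactin_subtopology)

end

lemma chart_img_open: "topological_chart UNIV X c \<Longrightarrow> open (chart_img c)"
  by (simp add: topological_chart_def)

lemma chart_open_image:
  assumes tc: "topological_chart UNIV X c" and V: "openin X V" "V \<subseteq> chart_dom c"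
  shows "open (chart_map c ` V)"
proof -
  have "openin (subtopology X (chart_dom c)) V"
    unfolding openin_subtopology using V by (intro exI[of _ V]) auto
  then have "openin (top_of_set (chart_img c)) (chart_map c ` V)"
    using homeomorphic_imp_open_map[OF chart_homeo[OF tc]] by (simp add: open_map_def)
  then show ?thesis
    using chart_img_open[OF tc] openin_open_trans by blast
qed

lemma chart_openin_inv:
  assumes tc: "topological_chart UNIV X c" and W: "open W" "W \<subseteq> chart_img c"
  shows "openin X (chart_inv c ` W)"
proof -
  have "openin (top_of_set (chart_img c)) W"
    unfolding openin_open using W by (intro exI[of _ W]) auto
  then have "openin (subtopology X (chart_dom c)) (chart_inv c ` W)"
    using homeomorphic_imp_open_map[OF chart_homeo_inv[OF tc]] by (simp add: open_map_def)
  then show ?thesis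
    using chart_dom_open[OF tc] openin_trans_full by blast
qed

lemma riemannian_manifold_chart:
  assumes "riemannian_manifold UNIV M" "c \<in> atlas M"
  shows "topological_chart UNIV (mtop M) c" "smooth_metric UNIV c"
  using assms by (auto simp: riemannian_manifold_def)

lemma gram_pos: "smooth_metric UNIV c \<Longrightarrow> p \<in> chart_dom c \<Longrightarrow> v \<noteq> 0 \<Longrightarrow> 0 < v \<bullet> (chart_gram c p *v v)"
  by (simp add: smooth_metric_def)

lemma gram_nonneg: "smooth_metric UNIV c \<Longrightarrow> p \<in> chart_dom c \<Longrightarrow> 0 \<le> v \<bullet> (chart_gram c p *v v)"
  using gram_pos[of c p v] by (cases "v = 0") auto

lemma gram_sym: "smooth_metric UNIV c \<Longrightarrow> p \<in> chart_dom c \<Longrightarrow> chart_gram c p $ i $ j = chart_gram c p $ j $ i"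
  by (simp add: smooth_metric_def)

lemma gram_continuous:
  assumes "smooth_metric UNIV c"
  shows "continuous_on (chart_img c) (\<lambda>x. chart_gram c (chart_inv c x) $ i $ j)"
proof -
  have "Ck 0 UNIV (chart_img c) (\<lambda>x. chart_gram c (chart_inv c x) $ i $ j)"
    using assms unfolding smooth_metric_def smooth_in_def by blast
  then show ?thesis by simp
qed

text \<open>A chart that could be added to the atlas of a Riemannian manifold. Formulating the calculus
  for such charts makes it available in the product coordinates of an end, which do not belong to
  the given atlas.\<close>

definition adapted_chart :: "('a, 'n::finite) manifold \<Rightarrow> ('a, 'n) chart \<Rightarrow> bool" where
  "adapted_chart M c \<longleftrightarrow>
     topological_chart UNIV (mtop M) c \<and>
     (\<forall>i j. continuous_on (chart_img c) (\<lambda>x. chart_gram c (chart_inv c x) $ i $ j)) \<and>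
     (\<forall>d\<in>atlas M. compatible_charts UNIV c d)"

lemma adapted_chart_atlas:
  assumes "riemannian_manifold UNIV M" "c \<in> atlas M"
  shows "adapted_chart M c"
  using assms riemannian_manifold_chart[OF assms] gram_continuous
  by (auto simp: adapted_chart_def riemannian_manifold_def)

lemma adapted_chart_topological: "adapted_chart M c \<Longrightarrow> topological_chart UNIV (mtop M) c"
  by (simp add: adapted_chart_def)

lemma transition_C1:
  assumes tc: "topological_chart UNIV X c" and td: "topological_chart UNIV X d"
    and cd: "compatible_charts UNIV c d"
  shows "open (chart_map c ` (chart_dom c \<inter> chart_dom d))"
    and "C1_on (chart_map c ` (chart_dom c \<inter> chart_dom d)) (chart_map d \<circ> chart_inv c)
      (\<lambda>x. frechet_derivative (chart_map d \<circ> chart_inv c) (at x))"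
proof -
  show o: "open (chart_map c ` (chart_dom c \<inter> chart_dom d))"
    by (rule chart_open_image[OF tc]) (auto intro: chart_dom_open[OF tc] chart_dom_open[OF td])
  show "C1_on (chart_map c ` (chart_dom c \<inter> chart_dom d)) (chart_map d \<circ> chart_inv c)
      (\<lambda>x. frechet_derivative (chart_map d \<circ> chart_inv c) (at x))"
    using cd by (intro smooth_in_C1_on o) (simp add: compatible_charts_def)
qed

lemma test_function_C1_on:
  assumes M: "riemannian_manifold UNIV M" and c: "adapted_chart M c"
    and u: "smooth_on_mfd M (points M) u"
  shows "C1_on (chart_img c) (u \<circ> chart_inv c) (\<lambda>x. frechet_derivative (u \<circ> chart_inv c) (at x))"
proof (rule C1_on_local)
  fix x assume x: "x \<in> chart_img c"
  have tc: "topological_chart UNIV (mtop M) c"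
    using c by (rule adapted_chart_topological)
  let ?p = "chart_inv c x"
  have p: "?p \<in> chart_dom c"
    by (rule chart_inv_dom[OF tc x])
  then have "?p \<in> points M"
    using chart_dom_subset[OF tc] by blast
  then have "?p \<in> (\<Union>d\<in>atlas M. chart_dom d)"
    using M by (simp add: riemannian_manifold_def)
  then obtain d where d: "d \<in> atlas M" "?p \<in> chart_dom d"
    by blast
  have td: "topological_chart UNIV (mtop M) d"
    by (rule riemannian_manifold_chart[OF M d(1)])
  have cd: "compatible_charts UNIV c d"
    using c d by (simp add: adapted_chart_def)
  let ?S = "chart_map c ` (chart_dom c \<inter> chart_dom d)"
  let ?\<sigma> = "chart_map d \<circ> chart_inv c"
  note tr = transition_C1[OF tc td cd]
  have "smooth_in UNIV (chart_img d) (u \<circ> chart_inv d)"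
    using u d Int_absorb2[OF chart_dom_subset[OF td]] unfolding smooth_on_mfd_def by metis
  then have ud: "C1_on (chart_img d) (u \<circ> chart_inv d) (\<lambda>x. frechet_derivative (u \<circ> chart_inv d) (at x))"
    by (rule smooth_in_C1_on) (rule chart_img_open[OF td])
  have "?\<sigma> ` ?S \<subseteq> chart_img d"
    by (auto simp: chart_inv_map[OF tc])
  from C1_on_compose[OF tr(2) ud this]
  have "C1_on ?S (u \<circ> chart_inv d \<circ> ?\<sigma>)
    (\<lambda>x. frechet_derivative (u \<circ> chart_inv d) (at (?\<sigma> x)) \<circ> frechet_derivative ?\<sigma> (at x))" .
  then have "C1_on ?S (u \<circ> chart_inv c)
    (\<lambda>x. frechet_derivative (u \<circ> chart_inv d) (at (?\<sigma> x)) \<circ> frechet_derivative ?\<sigma> (at x))"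
    by (rule C1_on_cong) (use tr in \<open>auto simp: chart_inv_map[OF tc] chart_inv_map[OF td]\<close>)
  moreover have "x \<in> ?S"
    using d p x chart_map_inv[OF tc x] by (intro image_eqI[of _ _ ?p]) auto
  ultimately show "\<exists>S f'. open S \<and> x \<in> S \<and> C1_on S (u \<circ> chart_inv c) f'"
    using tr(1) by blast
qed

lemma chart_at_in:
  assumes "riemannian_manifold UNIV M" "p \<in> points M"
  shows "chart_at M p \<in> atlas M" "p \<in> chart_dom (chart_at M p)"
proof -
  have "\<exists>c. c \<in> atlas M \<and> p \<in> chart_dom c"
  proof -
    have "p \<in> (\<Union>d\<in>atlas M. chart_dom d)"
      using assms by (simp add: riemannian_manifold_def)
    then show ?thesis by blast
  qed
  then show "chart_at M p \<in> atlas M" "p \<in> chart_dom (chart_at M p)"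
    unfolding chart_at_def by (metis (mono_tags, lifting) someI_ex)+
qed

lemma transition_derivative:
  assumes M: "riemannian_manifold UNIV M" and c: "adapted_chart M c" and d: "d \<in> atlas M"
    and p: "p \<in> chart_dom c" "p \<in> chart_dom d"
  obtains J where "(chart_map d \<circ> chart_inv c has_derivative J) (at (chart_map c p))"
    "\<And>v. tangent_norm c p v = tangent_norm d p (J v)"
proof -
  have tc: "topological_chart UNIV (mtop M) c"
    using c by (rule adapted_chart_topological)
  have td: "topological_chart UNIV (mtop M) d"
    by (rule riemannian_manifold_chart[OF M d(1)])
  have cd: "compatible_charts UNIV c d"
    using c d by (simp add: adapted_chart_def)
  let ?\<sigma> = "chart_map d \<circ> chart_inv c"
  let ?J = "frechet_derivative ?\<sigma> (at (chart_map c p))"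
  have der: "(?\<sigma> has_derivative ?J) (at (chart_map c p))"
    using transition_C1(2)[OF tc td cd] p by (auto simp: C1_on_def)
  have pb: "pulls_back UNIV ?\<sigma> (chart_map c p) (chart_gram c p) (chart_gram d p)"
    using cd p by (simp add: compatible_charts_def)
  show ?thesis
    using that[OF der] pulls_back_UNIV(1)[OF der pb] by (simp add: tangent_norm_def chart_inv_map[OF tc p(1)])
qed

text \<open>Cauchy--Schwarz for the metric. The chart in which the derivative is taken is arbitrary, while the
  gradient is computed in whatever chart of the atlas has been picked at the point; lengths of tangent
  vectors agree in the two charts.\<close>

lemma directional_derivative_le_grad_norm:
  fixes M :: "('a, 'n::finite) manifold"
  assumes M: "riemannian_manifold UNIV M" and c: "adapted_chart M c"
    and u: "smooth_on_mfd M (points M) u" and x: "x \<in> chart_img c"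
  shows "\<bar>frechet_derivative (u \<circ> chart_inv c) (at x) v\<bar>
    \<le> tangent_norm c (chart_inv c x) v * grad_norm M u (chart_inv c x)"
proof -
  have tc: "topological_chart UNIV (mtop M) c"
    using c by (rule adapted_chart_topological)
  define p where "p = chart_inv c x"
  have p: "p \<in> chart_dom c" and px: "chart_map c p = x"
    unfolding p_def using chart_inv_dom[OF tc x] chart_map_inv[OF tc x] by auto
  define d where "d = chart_at M p"
  have d: "d \<in> atlas M" "p \<in> chart_dom d"
    unfolding d_def using p chart_dom_subset[OF tc] chart_at_in[OF M] by blast+
  have td: "topological_chart UNIV (mtop M) d" and sd: "smooth_metric UNIV d"
    using riemannian_manifold_chart[OF M d(1)] by auto
  obtain J where J: "(chart_map d \<circ> chart_inv c has_derivative J) (at (chart_map c p))"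
    and n: "\<And>v. tangent_norm c p v = tangent_norm d p (J v)"
    using transition_derivative[OF M c d(1) p d(2)] by blast
  let ?U = "frechet_derivative (u \<circ> chart_inv d) (at (chart_map d p))"
  have Ud: "(u \<circ> chart_inv d has_derivative ?U) (at (chart_map d p))"
    using test_function_C1_on[OF M adapted_chart_atlas[OF M d(1)] u] d by (auto simp: C1_on_def)
  then have "((u \<circ> chart_inv d) \<circ> (chart_map d \<circ> chart_inv c) has_derivative ?U \<circ> J) (at (chart_map c p))"
    by (intro diff_chain_at J) (simp add: chart_inv_map[OF tc p])
  moreover have "open (chart_map c ` (chart_dom c \<inter> chart_dom d))"
    using c d tc td by (intro transition_C1(1)) (auto simp: adapted_chart_def)
  ultimately have "(u \<circ> chart_inv c has_derivative ?U \<circ> J) (at (chart_map c p))"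
    by (rule has_derivative_transform_within_open)
      (use p d in \<open>auto simp: chart_inv_map[OF tc] chart_inv_map[OF td]\<close>)
  then have eq: "frechet_derivative (u \<circ> chart_inv c) (at x) = ?U \<circ> J"
    unfolding px by (rule frechet_derivative_at[symmetric])
  define du :: "real^'n" where "du = (\<chi> j. partial j (u \<circ> chart_inv d) (chart_map d p))"
  have "?U w = w \<bullet> du" for w
    using linear_sum_axis[OF has_derivative_linear[OF Ud], of w]
    by (simp add: du_def inner_vec_def partial_eq[OF Ud])
  then have "\<bar>(?U \<circ> J) v\<bar> = \<bar>J v \<bullet> du\<bar>" by simp
  also have "\<dots> \<le> tangent_norm d p (J v) * tangent_norm d p (gradient d u p)"
    unfolding tangent_norm_def gradient_def du_def
    by (rule gradient_inner_bound) (use gram_pos[OF sd d(2)] gram_sym[OF sd d(2)] in auto)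
  finally show ?thesis
    unfolding eq p_def[symmetric] n grad_norm_def d_def .
qed

section \<open>The Riemannian measure in charts\<close>

text \<open>Outside the chart image the inverse takes an arbitrary point of the space as its value, so that it
  becomes measurable as a total map.\<close>

lemma chart_inv_measurable:
  fixes vol :: "'a measure"
  assumes tc: "topological_chart UNIV X c"
    and vol: "space vol = topspace X" "sets vol = sigma_sets (topspace X) {U. openin X U}"
    and p0: "p0 \<in> topspace X"
  shows "(\<lambda>x. if x \<in> chart_img c then chart_inv c x else p0) \<in> borel \<rightarrow>\<^sub>M vol"
proof (rule measurable_sigma_sets[OF vol(2)])
  show "{U. openin X U} \<subseteq> Pow (topspace X)"
    by (auto dest: openin_subset)
  show "(\<lambda>x. if x \<in> chart_img c then chart_inv c x else p0) \<in> space borel \<rightarrow> topspace X"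
    using subsetD[OF chart_dom_subset[OF tc]] p0 by (auto simp: chart_inv_map[OF tc])
  fix U assume "U \<in> {U. openin X U}"
  then have U: "openin X U" by simp
  have "open (chart_map c ` (U \<inter> chart_dom c))"
    by (rule chart_open_image[OF tc]) (auto intro: U chart_dom_open[OF tc])
  moreover have "(\<lambda>x. if x \<in> chart_img c then chart_inv c x else p0) -` U \<inter> space borel
      = chart_map c ` (U \<inter> chart_dom c) \<union> (if p0 \<in> U then - chart_img c else {})"
    using chart_inv_dom[OF tc] chart_map_inv[OF tc]
    by (auto simp: chart_inv_map[OF tc] split: if_splits)
  ultimately show "(\<lambda>x. if x \<in> chart_img c then chart_inv c x else p0) -` U \<inter> space borel \<in> sets borel"
    using chart_img_open[OF tc] by auto
qed

lemma chart_dom_sets: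
  assumes tc: "topological_chart UNIV X c"
    and vol: "sets vol = sigma_sets (topspace X) {U. openin X U}"
  shows "chart_dom c \<in> sets vol"
  unfolding vol using chart_dom_open[OF tc] by (intro sigma_sets.Basic) simp

lemma chart_image_borel:
  assumes tc: "topological_chart UNIV X c"
    and vol: "space vol = topspace X" "sets vol = sigma_sets (topspace X) {U. openin X U}"
    and B: "B \<in> sets vol" "B \<subseteq> chart_dom c"
  shows "chart_map c ` B \<in> sets borel"
proof (cases "B = {}")
  case False
  then obtain p0 where p0: "p0 \<in> B" by blast
  \<comment> \<open>the image of \<open>B\<close> is the preimage of \<open>B\<close> under the inverse of the chart\<close>
  let ?f = "\<lambda>x. if x \<in> chart_img c then chart_inv c x else p0"
  have "?f \<in> borel \<rightarrow>\<^sub>M vol"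
    using p0 B chart_dom_subset[OF tc] by (intro chart_inv_measurable[OF tc vol]) auto
  from measurable_sets[OF this B(1)] have "?f -` B \<in> sets borel" by simp
  moreover have "chart_map c ` B = ?f -` B \<inter> chart_img c"
    using B chart_map_inv[OF tc] by (auto simp: chart_inv_map[OF tc] subset_iff)
  ultimately show ?thesis
    using chart_img_open[OF tc] by auto
qed simp

text \<open>The density formula for sets says that the inverse of the chart transports the weighted Lebesgue
  measure to the given one.\<close>

lemma nn_integral_chart:
  fixes vol :: "'a measure" and c :: "('a, 'n::finite) chart"
  assumes tc: "topological_chart UNIV X c"
    and vol: "space vol = topspace X" "sets vol = sigma_sets (topspace X) {U. openin X U}"
    and w [measurable]: "(\<lambda>x. w x * indicator (chart_img c) x) \<in> borel_measurable borel"
    and em: "\<And>B. B \<in> sets vol \<Longrightarrow> B \<subseteq> chart_dom c \<Longrightarrow> emeasure vol B = (\<integral>\<^sup>+x\<in>chart_map c ` B. w x \<partial>lborel)"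
    and g [measurable]: "g \<in> borel_measurable vol"
  shows "(\<integral>\<^sup>+p\<in>chart_dom c. g p \<partial>vol) = (\<integral>\<^sup>+x\<in>chart_img c. w x * g (chart_inv c x) \<partial>lborel)"
proof (cases "chart_dom c = {}")
  case False
  then obtain p0 where p0: "p0 \<in> chart_dom c" by blast
  define f where "f x = (if x \<in> chart_img c then chart_inv c x else p0)" for x
  have f [measurable]: "f \<in> borel \<rightarrow>\<^sub>M vol"
    unfolding f_def using p0 chart_dom_subset[OF tc] by (intro chart_inv_measurable[OF tc vol]) auto
  note [measurable] = chart_dom_sets[OF tc vol(2)]
  have eq: "distr (density lborel (\<lambda>x. w x * indicator (chart_img c) x)) vol f
      = density vol (indicator (chart_dom c))"
  proof (rule measure_eqI)
    fix B assume "B \<in> sets (distr (density lborel (\<lambda>x. w x * indicator (chart_img c) x)) vol f)"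
    then have B [measurable]: "B \<in> sets vol" by simp
    have fB: "f -` B \<in> sets borel"
      using measurable_sets[OF f B] by simp
    have ind: "indicator (chart_img c) x * indicator (f -` B) x
        = (indicator (chart_map c ` (chart_dom c \<inter> B)) x :: ennreal)" for x
    proof (cases "x \<in> chart_img c")
      case True
      have "chart_inv c x \<in> B \<longleftrightarrow> x \<in> chart_map c ` (chart_dom c \<inter> B)"
        using chart_inv_dom[OF tc True] chart_map_inv[OF tc True]
        by (auto simp: chart_inv_map[OF tc] image_iff) (metis IntI)
      then show ?thesis
        using True by (simp add: f_def indicator_def)
    next
      case False
      then show ?thesis by (auto simp: indicator_def)
    qed
    have "emeasure (distr (density lborel (\<lambda>x. w x * indicator (chart_img c) x)) vol f) B
        = emeasure (density lborel (\<lambda>x. w x * indicator (chart_img c) x)) (f -` B)"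
      by (subst emeasure_distr) auto
    also have "\<dots> = (\<integral>\<^sup>+x. w x * indicator (chart_img c) x * indicator (f -` B) x \<partial>lborel)"
      using fB by (subst emeasure_density) auto
    also have "\<dots> = (\<integral>\<^sup>+x\<in>chart_map c ` (chart_dom c \<inter> B). w x \<partial>lborel)"
      by (simp add: mult.assoc ind)
    also have "\<dots> = emeasure vol (chart_dom c \<inter> B)"
      by (rule em[symmetric]) auto
    also have "\<dots> = (\<integral>\<^sup>+p. indicator (chart_dom c \<inter> B) p \<partial>vol)"
      by simp
    also have "\<dots> = (\<integral>\<^sup>+p. indicator (chart_dom c) p * indicator B p \<partial>vol)"
      by (simp add: indicator_inter_arith)
    also have "\<dots> = emeasure (density vol (indicator (chart_dom c))) B"
      by (rule emeasure_density[symmetric]) auto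
    finally show "emeasure (distr (density lborel (\<lambda>x. w x * indicator (chart_img c) x)) vol f) B
        = emeasure (density vol (indicator (chart_dom c))) B" .
  qed simp
  have "(\<integral>\<^sup>+p\<in>chart_dom c. g p \<partial>vol) = (\<integral>\<^sup>+p. g p \<partial>(density vol (indicator (chart_dom c))))"
    by (subst nn_integral_density) (auto simp: mult.commute)
  also have "\<dots> = (\<integral>\<^sup>+x. g (f x) \<partial>(density lborel (\<lambda>x. w x * indicator (chart_img c) x)))"
    unfolding eq[symmetric] by (rule nn_integral_distr) auto
  also have "\<dots> = (\<integral>\<^sup>+x. w x * indicator (chart_img c) x * g (f x) \<partial>lborel)"
    by (rule nn_integral_density) auto
  also have "\<dots> = (\<integral>\<^sup>+x\<in>chart_img c. w x * g (chart_inv c x) \<partial>lborel)"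
    by (rule nn_integral_cong) (auto simp: f_def indicator_def)
  finally show ?thesis .
qed simp

abbreviation vol_density :: "('a, 'n::finite) chart \<Rightarrow> real^'n \<Rightarrow> ennreal" where
  "vol_density c x \<equiv> ennreal (sqrt (det (chart_gram c (chart_inv c x))))"

lemma vol_density_measurable:
  assumes "adapted_chart M c"
  shows "(\<lambda>x. vol_density c x * indicator (chart_img c) x) \<in> borel_measurable borel"
proof -
  have "continuous_on (chart_img c) (\<lambda>x. det (chart_gram c (chart_inv c x)))"
    using assms by (intro continuous_on_det) (auto simp: adapted_chart_def)
  then have "continuous_on (chart_img c) (\<lambda>x. sqrt (det (chart_gram c (chart_inv c x))))"
    by (intro continuous_intros)
  then have "(\<lambda>x. indicator (chart_img c) x *\<^sub>R sqrt (det (chart_gram c (chart_inv c x)))) \<in> borel_measurable borel"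
    using chart_img_open[OF adapted_chart_topological[OF assms]]
    by (intro borel_measurable_continuous_on_indicator) auto
  then have "(\<lambda>x. ennreal (indicator (chart_img c) x *\<^sub>R sqrt (det (chart_gram c (chart_inv c x))))) \<in> borel_measurable borel"
    by measurable
  moreover have "ennreal (indicator (chart_img c) x *\<^sub>R sqrt (det (chart_gram c (chart_inv c x))))
      = vol_density c x * indicator (chart_img c) x" for x
    by (auto simp: indicator_def)
  ultimately show ?thesis by simp
qed

text \<open>The basic open sets lying in some chart domain cover the space; picking one chart for each of them
  leaves countably many.\<close>

lemma countable_subatlas:
  assumes M: "riemannian_manifold UNIV M"
  obtains d :: "nat \<Rightarrow> ('a, 'n::finite) chart"
    where "\<And>i. d i \<in> atlas (M :: ('a, 'n) manifold)" "(\<Union>i. chart_dom (d i)) = points M"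
proof -
  have "second_countable_space (mtop M)"
    using M by (simp add: riemannian_manifold_def)
  then obtain \<B> where B: "countable \<B>" "\<And>V. V \<in> \<B> \<Longrightarrow> openin (mtop M) V"
    and base: "\<And>U p. openin (mtop M) U \<Longrightarrow> p \<in> U \<Longrightarrow> \<exists>V\<in>\<B>. p \<in> V \<and> V \<subseteq> U"
    unfolding second_countable_space_def by (elim exE conjE) (metis that)
  define \<C> where "\<C> = {V\<in>\<B>. \<exists>d\<in>atlas M. V \<subseteq> chart_dom d}"
  define ch where "ch V = (SOME d. d \<in> atlas M \<and> V \<subseteq> chart_dom d)" for V
  have ch: "ch V \<in> atlas M" "V \<subseteq> chart_dom (ch V)" if "V \<in> \<C>" for V
  proof -
    have "\<exists>d. d \<in> atlas M \<and> V \<subseteq> chart_dom d"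
      using that by (auto simp: \<C>_def)
    then show "ch V \<in> atlas M" "V \<subseteq> chart_dom (ch V)"
      unfolding ch_def by (metis (mono_tags, lifting) someI_ex)+
  qed
  have cov: "\<exists>V\<in>\<C>. p \<in> V" if "p \<in> points M" for p
  proof -
    have d: "chart_at M p \<in> atlas M" "p \<in> chart_dom (chart_at M p)"
      using chart_at_in[OF M that] by auto
    have "openin (mtop M) (chart_dom (chart_at M p))"
      by (rule chart_dom_open[OF riemannian_manifold_chart(1)[OF M d(1)]])
    from base[OF this d(2)] obtain V where "V \<in> \<B>" "p \<in> V" "V \<subseteq> chart_dom (chart_at M p)"
      by blast
    with d show ?thesis
      unfolding \<C>_def by blast
  qed
  have ne: "\<C> \<noteq> {}"
  proof -
    have "points M \<noteq> {}"
      using M unfolding riemannian_manifold_def by blast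
    then show ?thesis using cov by blast
  qed
  have cnt: "countable \<C>"
    using B(1) by (simp add: \<C>_def)
  define d where "d i = ch (from_nat_into \<C> i)" for i
  have fn: "from_nat_into \<C> i \<in> \<C>" for i
    by (rule from_nat_into[OF ne])
  have "d i \<in> atlas M" for i
    unfolding d_def by (rule ch(1)[OF fn])
  moreover have "(\<Union>i. chart_dom (d i)) = points M"
  proof
    show "(\<Union>i. chart_dom (d i)) \<subseteq> points M"
      using \<open>\<And>i. d i \<in> atlas M\<close> chart_dom_subset[OF riemannian_manifold_chart(1)[OF M]] by blast
    show "points M \<subseteq> (\<Union>i. chart_dom (d i))"
    proof
      fix p assume "p \<in> points M"
      then obtain V where V: "V \<in> \<C>" "p \<in> V" using cov by blast
      obtain i where "from_nat_into \<C> i = V"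
        using from_nat_into_surj[OF cnt V(1)] by blast
      then have "p \<in> chart_dom (d i)"
        unfolding d_def using ch(2)[OF V(1)] V(2) by auto
      then show "p \<in> (\<Union>i. chart_dom (d i))" by blast
    qed
  qed
  ultimately show ?thesis using that by blast
qed

text \<open>On the overlap with a chart of the atlas this is the change of variables formula: the Gram
  determinants of the two charts differ by the square of the Jacobian.\<close>

lemma emeasure_adapted_chart_overlap:
  fixes M :: "('a, 'n::finite) manifold" and vol :: "'a measure"
  assumes M: "riemannian_manifold UNIV M" and vol: "riemannian_measure M vol"
    and c: "adapted_chart M c" and d: "d \<in> atlas M"
    and B: "B \<in> sets vol" "B \<subseteq> chart_dom c \<inter> chart_dom d"
  shows "emeasure vol B = (\<integral>\<^sup>+x\<in>chart_map c ` B. vol_density c x \<partial>lborel)"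
proof -
  have sp: "space vol = points M" and st: "sets vol = sigma_sets (points M) {U. openin (mtop M) U}"
    using vol by (auto simp: riemannian_measure_def)
  have tc: "topological_chart UNIV (mtop M) c"
    using c by (rule adapted_chart_topological)
  have td: "topological_chart UNIV (mtop M) d"
    by (rule riemannian_manifold_chart[OF M d])
  have cd: "compatible_charts UNIV c d"
    using c d by (simp add: adapted_chart_def)
  let ?\<sigma> = "chart_map d \<circ> chart_inv c"
  let ?J = "\<lambda>x. frechet_derivative ?\<sigma> (at x)"
  let ?O = "chart_map c ` (chart_dom c \<inter> chart_dom d)"
  note tr = transition_C1[OF tc td cd]
  have sub: "chart_map c ` B \<subseteq> ?O"
    using B by blast
  have S: "chart_map c ` B \<in> sets borel" and T: "chart_map d ` B \<in> sets borel"
    using chart_image_borel[OF tc sp st] chart_image_borel[OF td sp st] B by auto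
  define h where "h y = vol_density d y * indicator (chart_img d) y" for y
  have h: "h \<in> borel_measurable borel"
    unfolding h_def by (rule vol_density_measurable[OF adapted_chart_atlas[OF M d]])
  have "emeasure vol B = (\<integral>\<^sup>+y\<in>chart_map d ` B. vol_density d y \<partial>lborel)"
    using vol d B by (auto simp: riemannian_measure_def)
  also have "\<dots> = (\<integral>\<^sup>+y. h y * indicator (chart_map d ` B) y \<partial>lborel)"
    using B by (intro nn_integral_cong) (auto simp: h_def indicator_def)
  also have "\<dots> = (\<integral>\<^sup>+x. ennreal \<bar>det (matrix (?J x))\<bar> * h (?\<sigma> x) * indicator (chart_map c ` B) x \<partial>lborel)"
  proof (rule nn_integral_change_of_variables[where \<tau> = "chart_map c \<circ> chart_inv d"])
    show "?\<sigma> ` (chart_map c ` B) = chart_map d ` B"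
      using B(2) by (force simp: image_comp chart_inv_map[OF tc] intro!: image_cong)
    show "(chart_map c \<circ> chart_inv d) (?\<sigma> x) = x" if x: "x \<in> chart_map c ` B" for x
    proof -
      obtain p where p: "p \<in> B" "x = chart_map c p" using x by blast
      then show ?thesis
        using B(2) by (simp add: subset_iff chart_inv_map[OF tc] chart_inv_map[OF td])
    qed
    show "continuous_on (chart_map d ` B) (chart_map c \<circ> chart_inv d)"
    proof -
      have "continuous_map (top_of_set (chart_map d ` B)) (mtop M) (chart_inv d)"
        using B(2) continuous_map_from_subtopology_mono[OF chart_inv_continuous[OF td]] by blast
      then have "continuous_map (top_of_set (chart_map d ` B)) (subtopology (mtop M) (chart_dom c)) (chart_inv d)"
        using B(2) by (auto simp: continuous_map_in_subtopology subset_iff chart_inv_map[OF td])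
      from continuous_map_compose[OF this chart_map_continuous[OF tc]]
      show ?thesis by simp
    qed
    show "(?\<sigma> has_derivative ?J x) (at x)" if "x \<in> chart_map c ` B" for x
      using tr(2) sub that unfolding C1_on_def by blast
    have "continuous_on (chart_map c ` B) (\<lambda>x. \<bar>det (matrix (?J x))\<bar>)"
      using C1_on_matrix_continuous[OF C1_on_subset[OF tr(2) sub]] by (intro continuous_intros)
    then show "(\<lambda>x. indicator (chart_map c ` B) x * \<bar>det (matrix (?J x))\<bar>) \<in> borel_measurable borel"
      using borel_measurable_continuous_on_indicator[OF S, of "\<lambda>x. \<bar>det (matrix (?J x))\<bar>"] by simp
  qed (use S T h in auto)
  also have "\<dots> = (\<integral>\<^sup>+x\<in>chart_map c ` B. vol_density c x \<partial>lborel)"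
  proof (rule nn_integral_cong)
    fix x
    show "ennreal \<bar>det (matrix (?J x))\<bar> * h (?\<sigma> x) * indicator (chart_map c ` B) x
        = vol_density c x * indicator (chart_map c ` B) x"
    proof (cases "x \<in> chart_map c ` B")
      case True
      then obtain p where p: "p \<in> B" "x = chart_map c p" by blast
      with B(2) have pc: "p \<in> chart_dom c" "p \<in> chart_dom d" by auto
      have "(?\<sigma> has_derivative ?J x) (at x)"
        using tr(2) sub True unfolding C1_on_def by blast
      moreover have "pulls_back UNIV ?\<sigma> x (chart_gram c p) (chart_gram d p)"
        using cd pc p by (simp add: compatible_charts_def)
      ultimately have "chart_gram c p = transpose (matrix (?J x)) ** chart_gram d p ** matrix (?J x)"
        by (rule pulls_back_UNIV(2))
      then have "det (chart_gram c p) = (det (matrix (?J x)))\<^sup>2 * det (chart_gram d p)"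
        by (simp add: det_mul det_transpose power2_eq_square mult_ac)
      then have "sqrt (det (chart_gram c p)) = \<bar>det (matrix (?J x))\<bar> * sqrt (det (chart_gram d p))"
        by (simp add: real_sqrt_mult)
      then have "ennreal (sqrt (det (chart_gram c p)))
          = ennreal \<bar>det (matrix (?J x))\<bar> * ennreal (sqrt (det (chart_gram d p)))"
        by (simp add: ennreal_mult')
      then show ?thesis
        using p pc True by (simp add: h_def chart_inv_map[OF tc] chart_inv_map[OF td])
    qed simp
  qed
  finally show ?thesis .
qed

text \<open>A countable subatlas cuts \<open>B\<close> into disjoint pieces, each of which lies in a chart of the atlas.\<close>

lemma emeasure_adapted_chart:
  fixes M :: "('a, 'n::finite) manifold" and vol :: "'a measure"
  assumes M: "riemannian_manifold UNIV M" and vol: "riemannian_measure M vol"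
    and c: "adapted_chart M c"
    and B: "B \<in> sets vol" "B \<subseteq> chart_dom c"
  shows "emeasure vol B = (\<integral>\<^sup>+x\<in>chart_map c ` B. vol_density c x \<partial>lborel)"
proof -
  have sp: "space vol = points M" and st: "sets vol = sigma_sets (points M) {U. openin (mtop M) U}"
    using vol by (auto simp: riemannian_measure_def)
  have tc: "topological_chart UNIV (mtop M) c"
    using c by (rule adapted_chart_topological)
  obtain d :: "nat \<Rightarrow> ('a, 'n) chart" where d: "\<And>i. d i \<in> atlas M" "(\<Union>i. chart_dom (d i)) = points M"
    using countable_subatlas[OF M] by blast
  define A where "A = disjointed (\<lambda>i. B \<inter> chart_dom (d i))"
  have dom: "B \<inter> chart_dom (d i) \<in> sets vol" for i
    using chart_dom_sets[OF riemannian_manifold_chart(1)[OF M d(1)] st] B by blast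
  have A_sets: "A i \<in> sets vol" for i
    using dom sets.range_disjointed_sets[of "\<lambda>i. B \<inter> chart_dom (d i)" vol] unfolding A_def by blast
  have disj: "disjoint_family A"
    unfolding A_def by (rule disjoint_family_disjointed)
  have A_sub: "A i \<subseteq> B \<inter> chart_dom (d i)" for i
    unfolding A_def by (rule disjointed_subset)
  have UA: "(\<Union>i. A i) = B"
  proof -
    have "(\<Union>i. B \<inter> chart_dom (d i)) = B"
      using d(2) B chart_dom_subset[OF tc] by blast
    then show ?thesis
      unfolding A_def by (simp add: UN_disjointed_eq)
  qed
  have inj: "inj_on (chart_map c) B"
    using chart_inj[OF tc] B(2) inj_on_subset by blast
  have disj': "disjoint_family (\<lambda>i. chart_map c ` A i)"
    unfolding disjoint_family_on_def
  proof (intro ballI impI)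
    fix i j :: nat assume "i \<noteq> j"
    then have "A i \<inter> A j = {}"
      using disj by (auto simp: disjoint_family_on_def)
    moreover have "chart_map c ` A i \<inter> chart_map c ` A j = chart_map c ` (A i \<inter> A j)"
      using A_sub inj by (intro inj_on_image_Int[symmetric, of _ B]) auto
    ultimately show "chart_map c ` A i \<inter> chart_map c ` A j = {}" by simp
  qed
  have wm: "(\<lambda>x. vol_density c x * indicator (chart_map c ` A i) x) \<in> borel_measurable borel" for i
  proof -
    have "chart_map c ` A i \<in> sets borel"
      using A_sub[of i] B by (intro chart_image_borel[OF tc sp st] A_sets) auto
    then have "(\<lambda>x. vol_density c x * indicator (chart_img c) x * indicator (chart_map c ` A i) x) \<in> borel_measurable borel"
      using vol_density_measurable[OF c] by measurable
    moreover have "vol_density c x * indicator (chart_img c) x * indicator (chart_map c ` A i) x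
        = vol_density c x * indicator (chart_map c ` A i) x" for x
      using A_sub[of i] B by (auto simp: indicator_def)
    ultimately show ?thesis by simp
  qed
  have "emeasure vol B = (\<Sum>i. emeasure vol (A i))"
    using suminf_emeasure[of A vol, OF _ disj] A_sets by (simp add: UA image_subset_iff)
  also have "\<dots> = (\<Sum>i. \<integral>\<^sup>+x\<in>chart_map c ` A i. vol_density c x \<partial>lborel)"
    using A_sub B by (intro suminf_cong emeasure_adapted_chart_overlap[OF M vol c d(1) A_sets]) blast
  also have "\<dots> = (\<integral>\<^sup>+x. (\<Sum>i. vol_density c x * indicator (chart_map c ` A i) x) \<partial>lborel)"
    using wm by (intro nn_integral_suminf[symmetric]) simp
  also have "\<dots> = (\<integral>\<^sup>+x\<in>chart_map c ` B. vol_density c x \<partial>lborel)"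
  proof (rule nn_integral_cong)
    fix x
    have "(\<Sum>i. indicator (chart_map c ` A i) x :: ennreal) = indicator (\<Union>i. chart_map c ` A i) x"
      by (rule suminf_indicator[OF disj'])
    then show "(\<Sum>i. vol_density c x * indicator (chart_map c ` A i) x)
        = vol_density c x * indicator (chart_map c ` B) x"
      by (simp add: ennreal_suminf_cmult UA flip: image_UN)
  qed
  finally show ?thesis .
qed

theorem nn_integral_adapted_chart:
  fixes M :: "('a, 'n::finite) manifold" and vol :: "'a measure"
  assumes M: "riemannian_manifold UNIV M" and vol: "riemannian_measure M vol"
    and c: "adapted_chart M c" and g: "g \<in> borel_measurable vol"
  shows "(\<integral>\<^sup>+p\<in>chart_dom c. g p \<partial>vol) = (\<integral>\<^sup>+x\<in>chart_img c. vol_density c x * g (chart_inv c x) \<partial>lborel)"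
proof (rule nn_integral_chart[OF adapted_chart_topological[OF c] _ _ vol_density_measurable[OF c] _ g])
  show "space vol = points M" "sets vol = sigma_sets (points M) {U. openin (mtop M) U}"
    using vol by (auto simp: riemannian_measure_def)
  show "emeasure vol B = (\<integral>\<^sup>+x\<in>chart_map c ` B. vol_density c x \<partial>lborel)"
    if "B \<in> sets vol" "B \<subseteq> chart_dom c" for B
    by (rule emeasure_adapted_chart[OF M vol c that])
qed

section \<open>Piecewise \<open>C\<^sup>1\<close> curves and their length\<close>

definition speed :: "('a, 'n::finite) manifold \<Rightarrow> (real \<Rightarrow> 'a) \<Rightarrow> real \<Rightarrow> real" where
  "speed M \<gamma> t = tangent_norm (chart_at M (\<gamma> t)) (\<gamma> t)
     (vector_derivative (chart_map (chart_at M (\<gamma> t)) \<circ> \<gamma>) (at t))"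

lemma curve_length_speed: "curve_length M \<gamma> = integral {0..1} (speed M \<gamma>)"
  by (simp add: curve_length_def speed_def[abs_def])

text \<open>The condition of \<^const>\<open>piecewise_C1_curve\<close> on an arbitrary interval, so that curves can be cut and glued
  without reparametrisation.\<close>

definition pw_C1 :: "('a, 'n::finite) manifold \<Rightarrow> (real \<Rightarrow> 'a) \<Rightarrow> real \<Rightarrow> real \<Rightarrow> bool" where
  "pw_C1 M \<gamma> a b \<longleftrightarrow> (\<exists>S. finite S \<and>
     (\<forall>a' b'. a \<le> a' \<and> a' < b' \<and> b' \<le> b \<and> {a'<..<b'} \<inter> S = {} \<longrightarrow> C1_curve M \<gamma> a' b'))"

lemma piecewise_C1_curve_pw_C1: "piecewise_C1_curve M \<gamma> \<longleftrightarrow> pw_C1 M \<gamma> 0 1"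
  by (simp add: piecewise_C1_curve_def pw_C1_def)

lemma C1_curve_cong:
  assumes C: "C1_curve M \<gamma> a b" and eq: "\<And>t. t \<in> {a..b} \<Longrightarrow> \<gamma>' t = \<gamma> t"
  shows "C1_curve M \<gamma>' a b"
proof -
  have "continuous_map (top_of_set {a..b}) (mtop M) \<gamma>'"
    by (rule continuous_map_eq[of _ _ \<gamma>]) (use C eq in \<open>auto simp: C1_curve_def\<close>)
  moreover have "\<exists>D. continuous_on {t \<in> {a..b}. \<gamma>' t \<in> chart_dom c} D \<and>
        (\<forall>t\<in>{a..b}. \<gamma>' t \<in> chart_dom c \<longrightarrow>
           ((chart_map c \<circ> \<gamma>') has_vector_derivative D t) (at t within {a..b}))" if cM: "c \<in> atlas M" for c
  proof -
    obtain D where D: "continuous_on {t \<in> {a..b}. \<gamma> t \<in> chart_dom c} D"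
        "\<And>t. t\<in>{a..b} \<Longrightarrow> \<gamma> t \<in> chart_dom c \<Longrightarrow>
           ((chart_map c \<circ> \<gamma>) has_vector_derivative D t) (at t within {a..b})"
      using C cM unfolding C1_curve_def by meson
    have "{t \<in> {a..b}. \<gamma>' t \<in> chart_dom c} = {t \<in> {a..b}. \<gamma> t \<in> chart_dom c}"
      using eq by auto
    moreover have "((chart_map c \<circ> \<gamma>') has_vector_derivative D t) (at t within {a..b})"
      if "t \<in> {a..b}" "\<gamma>' t \<in> chart_dom c" for t
      by (rule has_vector_derivative_transform[OF that(1) _ D(2)]) (use that eq in auto)
    ultimately show ?thesis using D(1) by auto
  qed
  ultimately show ?thesis
    by (simp add: C1_curve_def)
qed

text \<open>A negative factor \<open>m\<close> reverses the curve.\<close>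

lemma C1_curve_affine:
  assumes C: "C1_curve M \<gamma> a b" and im: "(\<lambda>t. m * t + k) ` {a'..b'} \<subseteq> {a..b}"
  shows "C1_curve M (\<gamma> \<circ> (\<lambda>t. m * t + k)) a' b'"
proof -
  let ?h = "\<lambda>t. m * t + k"
  have im': "a \<le> ?h t" "?h t \<le> b" if "a' \<le> t" "t \<le> b'" for t
    using subsetD[OF im imageI[of t "{a'..b'}" ?h]] that by auto
  have hc: "continuous_on T ?h" for T
    by (intro continuous_intros)
  have "continuous_map (top_of_set {a'..b'}) (top_of_set {a..b}) ?h"
    using im hc by auto
  then have "continuous_map (top_of_set {a'..b'}) (mtop M) (\<gamma> \<circ> ?h)"
    by (rule continuous_map_compose) (use C in \<open>simp add: C1_curve_def\<close>)
  moreover have "\<exists>D. continuous_on {t \<in> {a'..b'}. (\<gamma> \<circ> ?h) t \<in> chart_dom c} D \<and>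
        (\<forall>t\<in>{a'..b'}. (\<gamma> \<circ> ?h) t \<in> chart_dom c \<longrightarrow>
           ((chart_map c \<circ> (\<gamma> \<circ> ?h)) has_vector_derivative D t) (at t within {a'..b'}))" if cM: "c \<in> atlas M" for c
  proof -
    obtain D where D: "continuous_on {t \<in> {a..b}. \<gamma> t \<in> chart_dom c} D"
        "\<And>t. t\<in>{a..b} \<Longrightarrow> \<gamma> t \<in> chart_dom c \<Longrightarrow>
           ((chart_map c \<circ> \<gamma>) has_vector_derivative D t) (at t within {a..b})"
      using C cM unfolding C1_curve_def by meson
    have "continuous_on {t \<in> {a'..b'}. (\<gamma> \<circ> ?h) t \<in> chart_dom c} (\<lambda>t. m *\<^sub>R D (?h t))"
      by (intro continuous_on_scaleR continuous_on_const continuous_on_compose2[OF D(1) hc])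
         (use im' in auto)
    moreover have "((chart_map c \<circ> (\<gamma> \<circ> ?h)) has_vector_derivative m *\<^sub>R D (?h t)) (at t within {a'..b'})"
      if t: "t \<in> {a'..b'}" "(\<gamma> \<circ> ?h) t \<in> chart_dom c" for t
    proof -
      have "(?h has_vector_derivative m) (at t within {a'..b'})"
        by (auto intro!: derivative_eq_intros simp: has_vector_derivative_def)
      moreover have "((chart_map c \<circ> \<gamma>) has_vector_derivative D (?h t)) (at (?h t) within ?h ` {a'..b'})"
        by (rule has_vector_derivative_within_subset[OF D(2) im]) (use t im' in auto)
      ultimately have "((chart_map c \<circ> \<gamma>) \<circ> ?h has_vector_derivative m *\<^sub>R D (?h t)) (at t within {a'..b'})"
        by (rule vector_diff_chain_within)
      then show ?thesis by (simp add: comp_assoc)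
    qed
    ultimately show ?thesis by blast
  qed
  ultimately show ?thesis
    by (simp add: C1_curve_def)
qed

lemma C1_curve_subinterval:
  assumes "C1_curve M \<gamma> a b" "a \<le> a'" "b' \<le> b"
  shows "C1_curve M \<gamma> a' b'"
  using C1_curve_affine[OF assms(1), of 1 0 a' b'] assms(2,3) by (simp add: o_def)

lemma pw_C1_cong:
  assumes "pw_C1 M \<gamma> a b" "\<And>t. t \<in> {a..b} \<Longrightarrow> \<gamma>' t = \<gamma> t"
  shows "pw_C1 M \<gamma>' a b"
proof -
  obtain S where S: "finite S"
    "\<And>a' b'. a \<le> a' \<Longrightarrow> a' < b' \<Longrightarrow> b' \<le> b \<Longrightarrow> {a'<..<b'} \<inter> S = {} \<Longrightarrow> C1_curve M \<gamma> a' b'"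
    using assms(1) unfolding pw_C1_def by blast
  have "C1_curve M \<gamma>' a' b'" if "a \<le> a'" "a' < b'" "b' \<le> b" "{a'<..<b'} \<inter> S = {}" for a' b'
    by (rule C1_curve_cong[OF S(2)[OF that]]) (use assms(2) that in auto)
  with S(1) show ?thesis
    unfolding pw_C1_def by blast
qed

lemma pw_C1_subinterval: "pw_C1 M \<gamma> a b \<Longrightarrow> a \<le> a' \<Longrightarrow> b' \<le> b \<Longrightarrow> pw_C1 M \<gamma> a' b'"
  unfolding pw_C1_def by (elim exE conjE, rule exI, rule conjI, assumption) auto

lemma C1_curve_pw_C1: "C1_curve M \<gamma> a b \<Longrightarrow> pw_C1 M \<gamma> a b"
  unfolding pw_C1_def by (intro exI[of _ "{}"]) (auto intro: C1_curve_subinterval)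

lemma pw_C1_join:
  assumes "pw_C1 M \<gamma> a m" "pw_C1 M \<gamma> m b"
  shows "pw_C1 M \<gamma> a b"
proof -
  obtain S where S: "finite S"
    "\<And>a' b'. a \<le> a' \<Longrightarrow> a' < b' \<Longrightarrow> b' \<le> m \<Longrightarrow> {a'<..<b'} \<inter> S = {} \<Longrightarrow> C1_curve M \<gamma> a' b'"
    using assms(1) unfolding pw_C1_def by blast
  obtain T where T: "finite T"
    "\<And>a' b'. m \<le> a' \<Longrightarrow> a' < b' \<Longrightarrow> b' \<le> b \<Longrightarrow> {a'<..<b'} \<inter> T = {} \<Longrightarrow> C1_curve M \<gamma> a' b'"
    using assms(2) unfolding pw_C1_def by blast
  have "C1_curve M \<gamma> a' b'"
    if "a \<le> a'" "a' < b'" "b' \<le> b" "{a'<..<b'} \<inter> (S \<union> T \<union> {m}) = {}" for a' b'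
  proof -
    have "b' \<le> m \<or> m \<le> a'"
      using that by auto
    then show ?thesis
      using that S(2)[of a' b'] T(2)[of a' b'] by blast
  qed
  with S(1) T(1) show ?thesis
    unfolding pw_C1_def by (intro exI[of _ "S \<union> T \<union> {m}"]) auto
qed

lemma pw_C1_affine:
  assumes C: "pw_C1 M \<gamma> a b" and m: "m \<noteq> 0" and im: "(\<lambda>t. m * t + k) ` {a'..b'} \<subseteq> {a..b}"
  shows "pw_C1 M (\<gamma> \<circ> (\<lambda>t. m * t + k)) a' b'"
proof -
  let ?h = "\<lambda>t. m * t + k"
  obtain S where S: "finite S"
    "\<And>a' b'. a \<le> a' \<Longrightarrow> a' < b' \<Longrightarrow> b' \<le> b \<Longrightarrow> {a'<..<b'} \<inter> S = {} \<Longrightarrow> C1_curve M \<gamma> a' b'"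
    using C unfolding pw_C1_def by blast
  have "C1_curve M (\<gamma> \<circ> ?h) x y"
    if xy: "a' \<le> x" "x < y" "y \<le> b'" "{x<..<y} \<inter> (\<lambda>s. (s - k) / m) ` S = {}" for x y
  proof (rule C1_curve_affine)
    have hx: "?h x \<in> {a..b}" and hy: "?h y \<in> {a..b}"
      using im xy(1-3) by (intro subsetD[OF im] imageI, simp)+
    show "C1_curve M \<gamma> (min (?h x) (?h y)) (max (?h x) (?h y))"
    proof (rule S(2))
      show "min (?h x) (?h y) < max (?h x) (?h y)"
        using xy m by (auto simp: min_def max_def)
      show "{min (?h x) (?h y)<..<max (?h x) (?h y)} \<inter> S = {}"
      proof (rule ccontr)
        assume "\<not> ?thesis"
        then obtain s where s: "s \<in> S" "min (?h x) (?h y) < s" "s < max (?h x) (?h y)" by auto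
        have "x < (s - k) / m \<and> (s - k) / m < y"
        proof (cases "m > 0")
          case True
          then have "?h x < ?h y" using xy by simp
          then show ?thesis using s True by (simp add: field_simps)
        next
          case False
          then have "?h y < ?h x" using xy m by simp
          then show ?thesis using s False m by (simp add: field_simps)
        qed
        then show False using xy(4) s(1) by auto
      qed
    qed (use hx hy in auto)
    show "?h ` {x..y} \<subseteq> {min (?h x) (?h y)..max (?h x) (?h y)}"
    proof (cases "m > 0")
      case True
      then show ?thesis by (auto simp: min_def max_def mult_left_mono)
    next
      case False
      then show ?thesis by (auto simp: min_le_iff_disj le_max_iff_disj mult_left_mono_neg)
    qed
  qed
  then show ?thesis
    unfolding pw_C1_def using S(1) by (intro exI[of _ "(\<lambda>s. (s - k) / m) ` S"]) auto
qed

text \<open>Additive statements about piecewise \<open>C\<^sup>1\<close> curves reduce to \<open>C\<^sup>1\<close> curves: an interval that contains a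
  break point is split there, which lowers the number of interior break points.\<close>

lemma pw_C1_induct [consumes 2, case_names piece join]:
  assumes C: "pw_C1 M \<gamma> a b" and ab: "a < b"
    and piece: "\<And>x y. a \<le> x \<Longrightarrow> x < y \<Longrightarrow> y \<le> b \<Longrightarrow> C1_curve M \<gamma> x y \<Longrightarrow> P x y"
    and join: "\<And>x m y. a \<le> x \<Longrightarrow> x < m \<Longrightarrow> m < y \<Longrightarrow> y \<le> b \<Longrightarrow> P x m \<Longrightarrow> P m y \<Longrightarrow> P x y"
  shows "P a b"
proof -
  obtain S where S: "finite S"
    "\<And>x y. a \<le> x \<Longrightarrow> x < y \<Longrightarrow> y \<le> b \<Longrightarrow> {x<..<y} \<inter> S = {} \<Longrightarrow> C1_curve M \<gamma> x y"
    using C unfolding pw_C1_def by blast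
  have "P x y" if "a \<le> x" "x < y" "y \<le> b" "card ({x<..<y} \<inter> S) = n" for x y n
    using that
  proof (induction n arbitrary: x y rule: less_induct)
    case (less n)
    show ?case
    proof (cases "{x<..<y} \<inter> S = {}")
      case True
      then show ?thesis using less.prems S(2) piece by blast
    next
      case False
      then obtain m where m: "m \<in> S" "x < m" "m < y" by auto
      have "{x<..<m} \<inter> S \<subset> {x<..<y} \<inter> S" "{m<..<y} \<inter> S \<subset> {x<..<y} \<inter> S"
        using m by auto
      then have c: "card ({x<..<m} \<inter> S) < n" "card ({m<..<y} \<inter> S) < n"
        using S(1) less.prems by (auto intro: psubset_card_mono)
      have "P x m" "P m y"
        using less.IH[OF c(1)] less.IH[OF c(2)] less.prems m by auto
      then show ?thesis
        using join less.prems m by blast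
    qed
  qed
  then show ?thesis using ab by blast
qed

lemma pw_C1_continuous:
  assumes "pw_C1 M \<gamma> a b" "a < b"
  shows "continuous_map (top_of_set {a..b}) (mtop M) \<gamma>"
  using assms
proof (induction rule: pw_C1_induct)
  case (piece x y)
  then show ?case by (simp add: C1_curve_def)
next
  case (join x m y)
  have left: "{x..y} \<inter> {t. x \<le> t \<and> t \<le> y \<and> t \<le> m} = {x..m}"
    and right: "{x..y} \<inter> {t. x \<le> t \<and> t \<le> y \<and> m \<le> t} = {m..y}"
    using join.hyps by auto
  have "continuous_map (top_of_set {x..y}) (mtop M) (\<lambda>t. if t \<le> m then \<gamma> t else \<gamma> t)"
  proof (rule continuous_map_cases_le)
    show "continuous_map (subtopology (top_of_set {x..y}) {t \<in> topspace (top_of_set {x..y}). t \<le> m}) (mtop M) \<gamma>"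
      using join.IH(1) left by (simp add: subtopology_subtopology)
    show "continuous_map (subtopology (top_of_set {x..y}) {t \<in> topspace (top_of_set {x..y}). m \<le> t}) (mtop M) \<gamma>"
      using join.IH(2) right by (simp add: subtopology_subtopology)
  qed auto
  then show ?case by simp
qed

lemma C1_curve_chart_open:
  assumes tc: "topological_chart UNIV (mtop M) c" and g: "continuous_map (top_of_set {a..b}) (mtop M) \<gamma>"
  obtains U where "open U" "{t \<in> {a..b}. \<gamma> t \<in> chart_dom c} = {a..b} \<inter> U"
proof -
  have "openin (top_of_set {a..b}) {t \<in> topspace (top_of_set {a..b}). \<gamma> t \<in> chart_dom c}"
    by (rule openin_continuous_map_preimage[OF g chart_dom_open[OF tc]])
  then show ?thesis
    using that by (auto simp: openin_open)
qed

text \<open>On a \<open>C\<^sup>1\<close> piece the speed with one-sided derivatives at the end points is continuous. It differs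
  from the speed at most at these end points, which makes the latter integrable.\<close>

definition speed_on :: "('a, 'n::finite) manifold \<Rightarrow> (real \<Rightarrow> 'a) \<Rightarrow> real \<Rightarrow> real \<Rightarrow> real \<Rightarrow> real" where
  "speed_on M \<gamma> a b t = tangent_norm (chart_at M (\<gamma> t)) (\<gamma> t)
     (vector_derivative (chart_map (chart_at M (\<gamma> t)) \<circ> \<gamma>) (at t within {a..b}))"

lemma speed_on_interior: "t \<in> {a<..<b} \<Longrightarrow> speed_on M \<gamma> a b t = speed M \<gamma> t"
  by (simp add: speed_on_def speed_def at_within_Icc_at)

lemma curve_in_points:
  assumes "continuous_map (top_of_set {a..b}) (mtop M) \<gamma>" "t \<in> {a..b}"
  shows "\<gamma> t \<in> points M"
  using continuous_map_image_subset_topspace[OF assms(1)] assms(2) by auto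

text \<open>Changing the chart multiplies the velocity by the Jacobian of the chart change, which preserves
  lengths.\<close>

lemma speed_on_chart:
  assumes M: "riemannian_manifold UNIV M" and g: "continuous_map (top_of_set {a..b}) (mtop M) \<gamma>"
    and ab: "a < b" and t: "t \<in> {a..b}"
    and c: "c \<in> atlas M" "\<gamma> t \<in> chart_dom c"
    and v: "((chart_map c \<circ> \<gamma>) has_vector_derivative v) (at t within {a..b})"
  shows "speed_on M \<gamma> a b t = tangent_norm c (\<gamma> t) v"
proof -
  define d where "d = chart_at M (\<gamma> t)"
  have d: "d \<in> atlas M" "\<gamma> t \<in> chart_dom d"
    unfolding d_def using chart_at_in[OF M curve_in_points[OF g t]] by auto
  have tc: "topological_chart UNIV (mtop M) c"
    by (rule riemannian_manifold_chart[OF M c(1)])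
  obtain J where J: "(chart_map d \<circ> chart_inv c has_derivative J) (at (chart_map c (\<gamma> t)))"
    and n: "\<And>v. tangent_norm c (\<gamma> t) v = tangent_norm d (\<gamma> t) (J v)"
    by (rule transition_derivative[OF M adapted_chart_atlas[OF M c(1)] d(1) c(2) d(2)]) blast
  obtain U where U: "open U" "{t \<in> {a..b}. \<gamma> t \<in> chart_dom c} = {a..b} \<inter> U"
    by (rule C1_curve_chart_open[OF tc g]) blast
  have "t \<in> U" using U(2) t c by blast
  then obtain e where e: "e > 0" "ball t e \<subseteq> U"
    by (rule openE[OF U(1)])
  have "((chart_map d \<circ> chart_inv c) \<circ> (chart_map c \<circ> \<gamma>) has_derivative J \<circ> (\<lambda>s. s *\<^sub>R v)) (at t within {a..b})"
  proof (rule diff_chain_within)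
    show "(chart_map c \<circ> \<gamma> has_derivative (\<lambda>s. s *\<^sub>R v)) (at t within {a..b})"
      using v by (simp only: has_vector_derivative_def)
    show "(chart_map d \<circ> chart_inv c has_derivative J) (at ((chart_map c \<circ> \<gamma>) t) within (chart_map c \<circ> \<gamma>) ` {a..b})"
      by (rule has_derivative_at_withinI) (use J in \<open>simp only: o_apply\<close>)
  qed
  then have "(chart_map d \<circ> \<gamma> has_derivative J \<circ> (\<lambda>s. s *\<^sub>R v)) (at t within {a..b})"
  proof (rule has_derivative_transform_within[OF _ e(1) t])
    fix s assume "s \<in> {a..b}" "dist s t < e"
    then have "s \<in> {a..b} \<inter> U"
      using e by (auto simp: dist_commute)
    then have "\<gamma> s \<in> chart_dom c" using U(2) by blast
    then show "((chart_map d \<circ> chart_inv c) \<circ> (chart_map c \<circ> \<gamma>)) s = (chart_map d \<circ> \<gamma>) s"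
      by (simp add: chart_inv_map[OF tc])
  qed
  moreover have "J \<circ> (\<lambda>s. s *\<^sub>R v) = (\<lambda>s. s *\<^sub>R J v)"
    using has_derivative_linear[OF J] by (auto simp: linear_cmul fun_eq_iff)
  ultimately have "(chart_map d \<circ> \<gamma> has_vector_derivative J v) (at t within {a..b})"
    by (simp add: has_vector_derivative_def)
  then have "vector_derivative (chart_map d \<circ> \<gamma>) (at t within {a..b}) = J v"
    using ab t by (intro vector_derivative_within_closed_interval) auto
  then show ?thesis
    by (simp add: speed_on_def n flip: d_def)
qed

lemma tangent_norm_continuous_on:
  assumes G: "\<And>i j. continuous_on T (\<lambda>t. G t $ i $ j)" and v: "continuous_on T v"
  shows "continuous_on T (\<lambda>t. sqrt (v t \<bullet> ((G t :: real^'n^'n::finite) *v v t)))"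
  unfolding inner_vec_def matrix_vector_mult_def
  by (simp, intro continuous_intros G continuous_on_component v)

lemma speed_on_continuous:
  assumes M: "riemannian_manifold UNIV M" and C: "C1_curve M \<gamma> a b" and ab: "a < b"
  shows "continuous_on {a..b} (speed_on M \<gamma> a b)"
  unfolding continuous_on_eq_continuous_within
proof
  fix t assume t: "t \<in> {a..b}"
  have g: "continuous_map (top_of_set {a..b}) (mtop M) \<gamma>"
    using C by (simp add: C1_curve_def)
  obtain c where c: "c \<in> atlas M" "\<gamma> t \<in> chart_dom c"
    using chart_at_in[OF M curve_in_points[OF g t]] by blast
  have tc: "topological_chart UNIV (mtop M) c" and sc: "smooth_metric UNIV c"
    using riemannian_manifold_chart[OF M c(1)] by auto
  let ?T = "{t \<in> {a..b}. \<gamma> t \<in> chart_dom c}"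
  obtain D where D: "continuous_on ?T D"
      "\<And>t. t\<in>{a..b} \<Longrightarrow> \<gamma> t \<in> chart_dom c \<Longrightarrow>
         ((chart_map c \<circ> \<gamma>) has_vector_derivative D t) (at t within {a..b})"
    using C c unfolding C1_curve_def by meson
  obtain U where U: "open U" "?T = {a..b} \<inter> U"
    by (rule C1_curve_chart_open[OF tc g]) blast
  have cg: "continuous_on ?T (chart_map c \<circ> \<gamma>)"
  proof -
    have "continuous_map (top_of_set ?T) (subtopology (mtop M) (chart_dom c)) \<gamma>"
    proof -
      have "continuous_map (top_of_set ?T) (mtop M) \<gamma>"
        by (rule continuous_map_from_subtopology_mono[OF g]) auto
      then show ?thesis
        by (simp add: continuous_map_in_subtopology image_subset_iff)
    qed
    from continuous_map_compose[OF this chart_map_continuous[OF tc]] show ?thesis by simp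
  qed
  have "continuous_on ?T (\<lambda>t. chart_gram c (chart_inv c ((chart_map c \<circ> \<gamma>) t)) $ i $ j)" for i j
    by (rule continuous_on_compose2[OF gram_continuous[OF sc] cg]) auto
  then have "continuous_on ?T (\<lambda>t. sqrt (D t \<bullet> (chart_gram c (chart_inv c ((chart_map c \<circ> \<gamma>) t)) *v D t)))"
    by (rule tangent_norm_continuous_on[OF _ D(1)])
  then have "continuous_on ?T (speed_on M \<gamma> a b)"
    by (rule continuous_on_eq)
       (auto simp: speed_on_chart[OF M g ab _ c(1) _ D(2)] tangent_norm_def chart_inv_map[OF tc])
  then have "continuous (at t within ?T) (speed_on M \<gamma> a b)"
    using t c by (auto simp: continuous_on_eq_continuous_within)
  moreover have "at t within ?T = at t within {a..b}"
    unfolding U(2) by (rule at_within_nhd[OF _ U(1)]) (use U t c in auto)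
  ultimately show "continuous (at t within {a..b}) (speed_on M \<gamma> a b)" by simp
qed

lemma C1_curve_speed:
  assumes M: "riemannian_manifold UNIV M" and C: "C1_curve M \<gamma> a b" and ab: "a < b"
  shows "(speed M \<gamma> has_integral integral {a..b} (speed_on M \<gamma> a b)) {a..b}"
proof -
  have "(speed_on M \<gamma> a b has_integral integral {a..b} (speed_on M \<gamma> a b)) {a..b}"
    by (intro integrable_integral integrable_continuous_interval speed_on_continuous[OF M C ab])
  then show ?thesis
    by (rule has_integral_spike_finite[of "{a, b}", rotated 2]) (auto simp: speed_on_interior)
qed

lemma speed_integrable:
  assumes M: "riemannian_manifold UNIV M" and C: "pw_C1 M \<gamma> a b" and ab: "a < b"
  shows "speed M \<gamma> integrable_on {a..b}"
  using C ab
proof (induction rule: pw_C1_induct)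
  case (piece x y)
  then show ?case using C1_curve_speed[OF M] by (meson has_integral_integrable)
next
  case (join x m y)
  then show ?case by (intro Henstock_Kurzweil_Integration.integrable_combine[of x m y]) auto
qed

lemma speed_integral_combine:
  assumes M: "riemannian_manifold UNIV M" and C: "pw_C1 M \<gamma> a b" and "a \<le> m" "m \<le> b" "a < b"
  shows "integral {a..m} (speed M \<gamma>) + integral {m..b} (speed M \<gamma>) = integral {a..b} (speed M \<gamma>)"
  using assms by (intro Henstock_Kurzweil_Integration.integral_combine speed_integrable[OF M C]) auto

lemma tangent_norm_nonneg: "smooth_metric UNIV c \<Longrightarrow> p \<in> chart_dom c \<Longrightarrow> 0 \<le> tangent_norm c p v"
  by (simp add: tangent_norm_def gram_nonneg)

lemma speed_nonneg:
  assumes M: "riemannian_manifold UNIV M" and "\<gamma> t \<in> points M"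
  shows "0 \<le> speed M \<gamma> t"
  unfolding speed_def using chart_at_in[OF assms] riemannian_manifold_chart[OF M]
  by (intro tangent_norm_nonneg) auto

lemma speed_integral_nonneg:
  assumes M: "riemannian_manifold UNIV M" and C: "pw_C1 M \<gamma> a b" and ab: "a < b"
  shows "0 \<le> integral {a..b} (speed M \<gamma>)"
  by (intro Henstock_Kurzweil_Integration.integral_nonneg speed_integrable[OF M C ab])
     (use speed_nonneg[OF M] curve_in_points[OF pw_C1_continuous[OF C ab]] in auto)

text \<open>In a chart where the metric is at least \<open>l\<^sup>2\<close> times the Euclidean one, the speed is at least \<open>l\<close> times
  the Euclidean speed of the coordinates, whose integral bounds the displacement.\<close>

lemma chart_displacement_le_length:
  assumes M: "riemannian_manifold UNIV M" and C: "pw_C1 M \<gamma> a b" and ab: "a < b"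
    and c: "c \<in> atlas M" and dom: "\<gamma> ` {a..b} \<subseteq> chart_dom c" and l: "0 < l"
    and low: "\<And>t v. t \<in> {a..b} \<Longrightarrow> l * norm v \<le> tangent_norm c (\<gamma> t) v"
  shows "l * norm (chart_map c (\<gamma> b) - chart_map c (\<gamma> a)) \<le> integral {a..b} (speed M \<gamma>)"
  using C ab
proof (induction rule: pw_C1_induct)
  case (piece x y)
  have g: "continuous_map (top_of_set {x..y}) (mtop M) \<gamma>"
    using piece by (simp add: C1_curve_def)
  obtain D where D: "\<And>t. t\<in>{x..y} \<Longrightarrow> \<gamma> t \<in> chart_dom c \<Longrightarrow>
         ((chart_map c \<circ> \<gamma>) has_vector_derivative D t) (at t within {x..y})"
    using piece c unfolding C1_curve_def by meson
  have in_dom: "\<gamma> t \<in> chart_dom c" if "t \<in> {x..y}" for t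
    using dom that piece by auto
  have "(D has_integral ((chart_map c \<circ> \<gamma>) y - (chart_map c \<circ> \<gamma>) x)) {x..y}"
    using piece(2) by (intro fundamental_theorem_of_calculus D in_dom) simp_all
  then have I: "D integrable_on {x..y}" "integral {x..y} D = chart_map c (\<gamma> y) - chart_map c (\<gamma> x)"
    by (auto simp: has_integral_iff)
  have "norm (integral {x..y} D) \<le> integral {x..y} (\<lambda>t. speed_on M \<gamma> x y t / l)"
  proof (rule integral_norm_bound_integral[OF I(1)])
    show "(\<lambda>t. speed_on M \<gamma> x y t / l) integrable_on {x..y}"
      using speed_on_continuous[OF M piece(4,2)] l
      by (intro integrable_continuous_interval continuous_intros) auto
    fix t assume t: "t \<in> {x..y}"
    then have "l * norm (D t) \<le> tangent_norm c (\<gamma> t) (D t)"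
      using piece by (intro low) auto
    also have "\<dots> = speed_on M \<gamma> x y t"
      using speed_on_chart[OF M g piece(2) t c in_dom[OF t] D[OF t in_dom[OF t]]] by simp
    finally show "norm (D t) \<le> speed_on M \<gamma> x y t / l"
      using l by (simp add: field_simps)
  qed
  also have "\<dots> = integral {x..y} (speed_on M \<gamma> x y) / l"
    by simp
  also have "integral {x..y} (speed_on M \<gamma> x y) = integral {x..y} (speed M \<gamma>)"
    using C1_curve_speed[OF M piece(4,2)] by (simp add: has_integral_iff)
  finally show ?case
    using l I(2) by (simp add: field_simps)
next
  case (join x m y)
  have "l * norm (chart_map c (\<gamma> y) - chart_map c (\<gamma> x))
      \<le> l * (norm (chart_map c (\<gamma> y) - chart_map c (\<gamma> m)) + norm (chart_map c (\<gamma> m) - chart_map c (\<gamma> x)))"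
    using l by (intro mult_left_mono norm_diff_triangle_le[OF order_refl order_refl]) auto
  also have "\<dots> \<le> integral {x..m} (speed M \<gamma>) + integral {m..y} (speed M \<gamma>)"
    using join.IH by (simp add: distrib_left)
  also have "\<dots> = integral {x..y} (speed M \<gamma>)"
    using join by (intro speed_integral_combine[OF M pw_C1_subinterval[OF C]]) auto
  finally show ?case .
qed

section \<open>Joining points by curves\<close>

lemma tangent_norm_scaleR: "tangent_norm c p (k *\<^sub>R v) = \<bar>k\<bar> * tangent_norm c p v"
proof -
  have "(k *\<^sub>R v) \<bullet> (chart_gram c p *v (k *\<^sub>R v)) = k\<^sup>2 * (v \<bullet> (chart_gram c p *v v))"
    by (simp add: matrix_vector_mult_scaleR power2_eq_square)
  then show ?thesis
    by (simp add: tangent_norm_def real_sqrt_mult)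
qed

lemma pw_C1_differentiable:
  assumes C: "pw_C1 M \<gamma> a b"
  obtains S where "finite S" "\<And>t c. t \<in> {a<..<b} - S \<Longrightarrow> c \<in> atlas M \<Longrightarrow> \<gamma> t \<in> chart_dom c \<Longrightarrow>
    \<exists>v. ((chart_map c \<circ> \<gamma>) has_vector_derivative v) (at t)"
proof -
  obtain S where S: "finite S"
    "\<And>a' b'. a \<le> a' \<Longrightarrow> a' < b' \<Longrightarrow> b' \<le> b \<Longrightarrow> {a'<..<b'} \<inter> S = {} \<Longrightarrow> C1_curve M \<gamma> a' b'"
    using C unfolding pw_C1_def by blast
  have "\<exists>v. ((chart_map c \<circ> \<gamma>) has_vector_derivative v) (at t)"
    if t: "t \<in> {a<..<b} - S" and c: "c \<in> atlas M" "\<gamma> t \<in> chart_dom c" for t c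
  proof -
    have "open ({a<..<b} - S)"
      using S(1) by (intro open_Diff finite_imp_closed) auto
    then obtain e where e: "e > 0" "cball t e \<subseteq> {a<..<b} - S"
      using t open_contains_cball by blast
    have sub: "{t - e..t + e} \<subseteq> {a<..<b} - S"
      using e(2) by (auto simp: cball_def dist_real_def subset_iff abs_le_iff)
    have "t - e \<in> {a<..<b} - S" "t + e \<in> {a<..<b} - S"
      using sub e(1) by (auto simp: subset_iff)
    moreover have "{t - e<..<t + e} \<inter> S = {}"
      using sub by (auto simp: subset_iff)
    ultimately have "C1_curve M \<gamma> (t - e) (t + e)"
      using e(1) by (intro S(2)) auto
    then obtain D where D: "\<And>s. s \<in> {t - e..t + e} \<Longrightarrow> \<gamma> s \<in> chart_dom c \<Longrightarrow>
        ((chart_map c \<circ> \<gamma>) has_vector_derivative D s) (at s within {t - e..t + e})"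
      using c(1) unfolding C1_curve_def by meson
    have "((chart_map c \<circ> \<gamma>) has_vector_derivative D t) (at t within {t - e..t + e})"
      using e(1) c(2) by (intro D) auto
    then have "((chart_map c \<circ> \<gamma>) has_vector_derivative D t) (at t)"
      using e(1) by (subst (asm) at_within_Icc_at) auto
    then show ?thesis by blast
  qed
  with S(1) show ?thesis using that by blast
qed

lemma speed_affine:
  assumes v: "((chart_map (chart_at M (\<gamma> (m * t + k))) \<circ> \<gamma>) has_vector_derivative v) (at (m * t + k))"
  shows "speed M (\<gamma> \<circ> (\<lambda>t. m * t + k)) t = \<bar>m\<bar> * speed M \<gamma> (m * t + k)"
proof -
  let ?h = "\<lambda>t. m * t + k"
  let ?d = "chart_at M (\<gamma> (m * t + k))"
  have "(?h has_vector_derivative m) (at t)"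
    by (auto intro!: derivative_eq_intros simp: has_vector_derivative_def)
  from vector_diff_chain_at[OF this v]
  have "vector_derivative (chart_map ?d \<circ> (\<gamma> \<circ> ?h)) (at t) = m *\<^sub>R v"
    unfolding comp_assoc by (rule vector_derivative_at)
  moreover have "vector_derivative (chart_map ?d \<circ> \<gamma>) (at (m * t + k)) = v"
    using v by (rule vector_derivative_at)
  ultimately show ?thesis
    by (simp add: speed_def tangent_norm_scaleR)
qed

text \<open>The speeds correspond where the curve is differentiable, that is up to finitely many parameters;
  there the factor \<open>\<bar>m\<bar>\<close> of the speed cancels the one from the substitution.\<close>

lemma length_affine:
  assumes M: "riemannian_manifold UNIV M" and C: "pw_C1 M \<gamma> a b" and ab: "a < b" and m: "m \<noteq> 0"
    and im: "(\<lambda>t. m * t + k) ` {a'..b'} = {a..b}"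
  shows "integral {a'..b'} (speed M (\<gamma> \<circ> (\<lambda>t. m * t + k))) = integral {a..b} (speed M \<gamma>)"
proof -
  let ?h = "\<lambda>t. m * t + k"
  let ?I = "integral {a..b} (speed M \<gamma>)"
  obtain S where S: "finite S" "\<And>t c. t \<in> {a<..<b} - S \<Longrightarrow> c \<in> atlas M \<Longrightarrow> \<gamma> t \<in> chart_dom c \<Longrightarrow>
      \<exists>v. ((chart_map c \<circ> \<gamma>) has_vector_derivative v) (at t)"
    by (rule pw_C1_differentiable[OF C]) blast
  have "(speed M \<gamma> has_integral ?I) (cbox a b)"
    using speed_integrable[OF M C ab] by (simp add: integrable_integral)
  from has_integral_affinity[OF this m, of k]
  have "((\<lambda>x. speed M \<gamma> (m * x + k)) has_integral (1 / \<bar>m\<bar>) * ?I) ((\<lambda>x. (1 / m) * x + - ((1 / m) * k)) ` {a..b})"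
    by simp
  also have "(\<lambda>x. (1 / m) * x + - ((1 / m) * k)) ` {a..b} = {a'..b'}"
    unfolding im[symmetric] image_comp using m by (simp add: o_def field_simps)
  finally have "((\<lambda>x. \<bar>m\<bar> * speed M \<gamma> (m * x + k)) has_integral \<bar>m\<bar> * ((1 / \<bar>m\<bar>) * ?I)) {a'..b'}"
    by (rule has_integral_mult_right)
  then have "((\<lambda>x. \<bar>m\<bar> * speed M \<gamma> (m * x + k)) has_integral ?I) {a'..b'}"
    using m by simp
  then have "(speed M (\<gamma> \<circ> ?h) has_integral ?I) {a'..b'}"
  proof (rule has_integral_spike_finite[of "(\<lambda>s. (s - k) / m) ` (S \<union> {a, b})", rotated 2])
    show "finite ((\<lambda>s. (s - k) / m) ` (S \<union> {a, b}))"
      using S(1) by simp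
    fix t assume t: "t \<in> {a'..b'} - (\<lambda>s. (s - k) / m) ` (S \<union> {a, b})"
    have ht: "?h t \<in> {a..b}" using t im by blast
    have "?h t \<notin> S \<union> {a, b}"
    proof
      assume "?h t \<in> S \<union> {a, b}"
      then have "(?h t - k) / m \<in> (\<lambda>s. (s - k) / m) ` (S \<union> {a, b})" by (rule imageI)
      then show False using t m by simp
    qed
    with ht have ht': "?h t \<in> {a<..<b} - S" by auto
    have "\<gamma> (?h t) \<in> points M"
      by (rule curve_in_points[OF pw_C1_continuous[OF C ab] ht])
    from chart_at_in[OF M this] S(2)[OF ht']
    obtain v where "((chart_map (chart_at M (\<gamma> (?h t))) \<circ> \<gamma>) has_vector_derivative v) (at (?h t))"
      by blast
    then show "speed M (\<gamma> \<circ> ?h) t = \<bar>m\<bar> * speed M \<gamma> (m * t + k)"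
      by (rule speed_affine)
  qed
  then show ?thesis by (rule integral_unique)
qed

text \<open>The lengths of curves from one point to another. Symmetry, triangle inequality and the existence of
  intermediate points of the Riemannian distance are facts about this relation.\<close>

definition joins :: "('a, 'n::finite) manifold \<Rightarrow> real \<Rightarrow> 'a \<Rightarrow> 'a \<Rightarrow> bool" where
  "joins M L p q \<longleftrightarrow> (\<exists>\<gamma>. pw_C1 M \<gamma> 0 1 \<and> \<gamma> 0 = p \<and> \<gamma> 1 = q \<and> L = integral {0..1} (speed M \<gamma>))"

lemma riemannian_dist_joins: "riemannian_dist M p q = Inf {L. joins M L p q}"
  unfolding riemannian_dist_def joins_def piecewise_C1_curve_pw_C1 curve_length_speed
  by (rule arg_cong[of _ _ Inf]) auto

lemma joinsI:
  assumes M: "riemannian_manifold UNIV M" and C: "pw_C1 M \<gamma> a b" and ab: "a < b"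
  shows "joins M (integral {a..b} (speed M \<gamma>)) (\<gamma> a) (\<gamma> b)"
proof -
  let ?h = "\<lambda>t. (b - a) * t + a"
  have im: "?h ` {0..1} = {a..b}"
    using ab image_affinity_atLeastAtMost[of "b - a" a 0 1] by simp
  have "pw_C1 M (\<gamma> \<circ> ?h) 0 1"
    by (rule pw_C1_affine[OF C]) (use ab im in auto)
  moreover have "integral {0..1} (speed M (\<gamma> \<circ> ?h)) = integral {a..b} (speed M \<gamma>)"
    by (rule length_affine[OF M C ab _ im]) (use ab in simp)
  ultimately show ?thesis
    unfolding joins_def by (intro exI[of _ "\<gamma> \<circ> ?h"]) simp
qed

lemma joins_nonneg: "riemannian_manifold UNIV M \<Longrightarrow> joins M L p q \<Longrightarrow> 0 \<le> L"
  unfolding joins_def using speed_integral_nonneg[of M _ 0 1] by auto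

lemma joins_in_points:
  assumes "joins M L p q"
  shows "p \<in> points M" "q \<in> points M"
proof -
  obtain \<gamma> where g: "pw_C1 M \<gamma> 0 1" "\<gamma> 0 = p" "\<gamma> 1 = q"
    using assms by (auto simp: joins_def)
  then show "p \<in> points M" "q \<in> points M"
    using curve_in_points[OF pw_C1_continuous[OF g(1)], of 0] curve_in_points[OF pw_C1_continuous[OF g(1)], of 1]
    by auto
qed

lemma joins_refl:
  assumes "p \<in> points M"
  shows "joins M 0 p p"
proof -
  have "C1_curve M (\<lambda>_. p) 0 1"
    unfolding C1_curve_def using assms by (auto simp: o_def intro!: exI[of _ "\<lambda>_. 0"])
  then have "pw_C1 M (\<lambda>_. p) 0 1"
    by (rule C1_curve_pw_C1)
  moreover have "speed M (\<lambda>_. p) = (\<lambda>_. 0)"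
    by (simp add: speed_def o_def tangent_norm_def fun_eq_iff)
  ultimately show ?thesis
    unfolding joins_def by (intro exI[of _ "\<lambda>_. p"]) simp
qed

lemma joins_sym:
  assumes M: "riemannian_manifold UNIV M" and "joins M L p q"
  shows "joins M L q p"
proof -
  obtain \<gamma> where g: "pw_C1 M \<gamma> 0 1" "\<gamma> 0 = p" "\<gamma> 1 = q" "L = integral {0..1} (speed M \<gamma>)"
    using assms(2) by (auto simp: joins_def)
  let ?h = "\<lambda>t::real. (-1) * t + 1"
  have im: "?h ` {0..1} = {0..1}"
    using image_affinity_atLeastAtMost[of "-1" 1 0 "1::real"] by simp
  have "pw_C1 M (\<gamma> \<circ> ?h) 0 1"
    by (rule pw_C1_affine[OF g(1)]) (use im in auto)
  moreover have "integral {0..1} (speed M (\<gamma> \<circ> ?h)) = L"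
    unfolding g(4) by (rule length_affine[OF M g(1) _ _ im]) auto
  ultimately show ?thesis
    unfolding joins_def using g by (intro exI[of _ "\<gamma> \<circ> ?h"]) simp
qed

lemma speed_cong:
  fixes M :: "('a, 'n::finite) manifold"
  assumes "open U" "t \<in> U" "\<And>s. s \<in> U \<Longrightarrow> \<gamma>' s = \<gamma> s"
  shows "speed M \<gamma>' t = speed M \<gamma> t"
proof -
  have "vector_derivative (chart_map d \<circ> \<gamma>') (at t) = vector_derivative (chart_map d \<circ> \<gamma>) (at t)"
    for d :: "('a, 'n) chart"
    using eventually_nhds_in_open[OF assms(1,2)] assms
    by (intro vector_derivative_cong_eq) (auto elim!: eventually_mono)
  moreover have "\<gamma>' t = \<gamma> t" using assms by blast
  ultimately show ?thesis
    by (simp only: speed_def)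
qed

text \<open>The second curve is shifted to \<open>{1..2}\<close> and glued to the first.\<close>

lemma joins_trans:
  assumes M: "riemannian_manifold UNIV M" and "joins M L p q" "joins M L' q r"
  shows "joins M (L + L') p r"
proof -
  obtain \<gamma>1 where g1: "pw_C1 M \<gamma>1 0 1" "\<gamma>1 0 = p" "\<gamma>1 1 = q" "L = integral {0..1} (speed M \<gamma>1)"
    using assms(2) by (auto simp: joins_def)
  obtain \<gamma>2 where g2: "pw_C1 M \<gamma>2 0 1" "\<gamma>2 0 = q" "\<gamma>2 1 = r" "L' = integral {0..1} (speed M \<gamma>2)"
    using assms(3) by (auto simp: joins_def)
  let ?h = "\<lambda>t::real. 1 * t + (- 1)"
  have im: "?h ` {1..2} = {0..1}"
    using image_affinity_atLeastAtMost[of 1 "-1" 1 "2::real"] by simp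
  have C2: "pw_C1 M (\<gamma>2 \<circ> ?h) 1 2"
    by (rule pw_C1_affine[OF g2(1)]) (use im in auto)
  have L2: "integral {1..2} (speed M (\<gamma>2 \<circ> ?h)) = L'"
    unfolding g2(4) by (rule length_affine[OF M g2(1) _ _ im]) auto
  define \<gamma> where "\<gamma> t = (if t \<le> 1 then \<gamma>1 t else \<gamma>2 (?h t))" for t
  have "pw_C1 M \<gamma> 0 1"
    by (rule pw_C1_cong[OF g1(1)]) (simp add: \<gamma>_def)
  moreover have "pw_C1 M \<gamma> 1 2"
    by (rule pw_C1_cong[OF C2]) (use g1 g2 in \<open>auto simp: \<gamma>_def\<close>)
  ultimately have C: "pw_C1 M \<gamma> 0 2"
    by (rule pw_C1_join)
  have "integral {0..1} (speed M \<gamma>) = L"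
    unfolding g1(4)
    by (rule integral_spike[of "{0, 1}"])
       (auto intro!: speed_cong[of "{0<..<1}", symmetric] simp: \<gamma>_def)
  moreover have "integral {1..2} (speed M \<gamma>) = L'"
    unfolding L2[symmetric]
    by (rule integral_spike[of "{1, 2}"])
       (auto intro!: speed_cong[of "{1<..<2}", symmetric] simp: \<gamma>_def)
  ultimately have "integral {0..2} (speed M \<gamma>) = L + L'"
    using speed_integral_combine[OF M C, of 1] by simp
  then show ?thesis
    using joinsI[OF M C] g1 g2 by (simp add: \<gamma>_def)
qed

text \<open>The length travelled so far depends continuously on the parameter, so it takes the value \<open>s\<close>.\<close>

lemma joins_split:
  assumes M: "riemannian_manifold UNIV M" and J: "joins M L p q" and s: "0 \<le> s" "s \<le> L"
  shows "\<exists>m. joins M s p m \<and> joins M (L - s) m q"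
proof -
  obtain \<gamma> where g: "pw_C1 M \<gamma> 0 1" "\<gamma> 0 = p" "\<gamma> 1 = q" "L = integral {0..1} (speed M \<gamma>)"
    using J by (auto simp: joins_def)
  let ?F = "\<lambda>t. integral {0..t} (speed M \<gamma>)"
  have "continuous_on {0..1} ?F"
    by (rule indefinite_integral_continuous_1[OF speed_integrable[OF M g(1)]]) simp
  then obtain t where t: "0 \<le> t" "t \<le> 1" "?F t = s"
    using IVT'[of ?F 0 s 1] s g(4) by auto
  consider "t = 0" | "t = 1" | "0 < t" "t < 1" using t by linarith
  then show ?thesis
  proof cases
    case 1
    then show ?thesis
      using t J joins_refl[OF joins_in_points(1)[OF J]] by auto
  next
    case 2
    then show ?thesis
      using t g(4) J joins_refl[OF joins_in_points(2)[OF J]] by auto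
  next
    case 3
    have "joins M s p (\<gamma> t)"
      using joinsI[OF M pw_C1_subinterval[OF g(1), of 0 t] 3(1)] 3 t(3) g(2) by simp
    moreover have "integral {t..1} (speed M \<gamma>) = L - s"
      using speed_integral_combine[OF M g(1), of t] t g(4) by simp
    then have "joins M (L - s) (\<gamma> t) q"
      using joinsI[OF M pw_C1_subinterval[OF g(1), of t 1] 3(2)] 3 g(3) by simp
    ultimately show ?thesis by blast
  qed
qed

lemma joins_chart_segment:
  assumes M: "riemannian_manifold UNIV M" and c: "c \<in> atlas M"
    and seg: "closed_segment x y \<subseteq> chart_img c"
    and up: "\<And>z v. z \<in> closed_segment x y \<Longrightarrow> tangent_norm c (chart_inv c z) v \<le> B * norm v"
  shows "\<exists>L. joins M L (chart_inv c x) (chart_inv c y) \<and> L \<le> B * norm (y - x)"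
proof -
  have tc: "topological_chart UNIV (mtop M) c"
    by (rule riemannian_manifold_chart[OF M c])
  define h where "h t = x + t *\<^sub>R (y - x)" for t :: real
  have hs: "h t \<in> closed_segment x y" if "t \<in> {0..1}" for t
  proof -
    have "h t = (1 - t) *\<^sub>R x + t *\<^sub>R y"
      by (simp add: h_def algebra_simps)
    then show ?thesis using that by (auto simp: in_segment)
  qed
  have hi: "h t \<in> chart_img c" if "t \<in> {0..1}" for t
    using hs[OF that] seg by blast
  have hc: "continuous_on T h" for T
    unfolding h_def by (intro continuous_intros)
  have hd: "(h has_vector_derivative (y - x)) (at t within T)" for t T
    unfolding h_def has_vector_derivative_def by (auto intro!: derivative_eq_intros)
  define \<gamma> where "\<gamma> = chart_inv c \<circ> h"
  have g: "continuous_map (top_of_set {0..1}) (mtop M) \<gamma>"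
    unfolding \<gamma>_def
    by (rule continuous_map_compose[OF _ chart_inv_continuous[OF tc]]) (use hc hi in auto)
  have "\<exists>D. continuous_on {t \<in> {0..1}. \<gamma> t \<in> chart_dom e} D \<and>
        (\<forall>t\<in>{0..1}. \<gamma> t \<in> chart_dom e \<longrightarrow>
           ((chart_map e \<circ> \<gamma>) has_vector_derivative D t) (at t within {0..1}))" if e: "e \<in> atlas M" for e
  proof -
    have te: "topological_chart UNIV (mtop M) e"
      by (rule riemannian_manifold_chart[OF M e])
    have ce: "compatible_charts UNIV c e"
      using M c e by (simp add: riemannian_manifold_def)
    let ?\<sigma> = "chart_map e \<circ> chart_inv c"
    let ?O = "chart_map c ` (chart_dom c \<inter> chart_dom e)"
    note tr = transition_C1(2)[OF tc te ce]
    have hO: "h t \<in> ?O" if "t \<in> {0..1}" "\<gamma> t \<in> chart_dom e" for t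
      using that hi[OF that(1)] chart_inv_dom[OF tc] chart_map_inv[OF tc hi[OF that(1)]]
      by (intro image_eqI[of _ _ "chart_inv c (h t)"]) (auto simp: \<gamma>_def)
    let ?D = "\<lambda>t. frechet_derivative ?\<sigma> (at (h t)) (y - x)"
    have "continuous_on ?O (\<lambda>z. frechet_derivative ?\<sigma> (at z) (y - x))"
      using tr by (simp add: C1_on_def)
    then have "continuous_on {t \<in> {0..1}. \<gamma> t \<in> chart_dom e} ?D"
      by (rule continuous_on_compose2[OF _ hc]) (use hO in blast)
    moreover have "((chart_map e \<circ> \<gamma>) has_vector_derivative ?D t) (at t within {0..1})"
      if t: "t \<in> {0..1}" "\<gamma> t \<in> chart_dom e" for t
    proof -
      have s: "(?\<sigma> has_derivative frechet_derivative ?\<sigma> (at (h t))) (at (h t))"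
        using tr hO[OF t] unfolding C1_on_def by blast
      have "(?\<sigma> \<circ> h has_derivative frechet_derivative ?\<sigma> (at (h t)) \<circ> (\<lambda>s. s *\<^sub>R (y - x))) (at t within {0..1})"
      proof (rule diff_chain_within)
        show "(h has_derivative (\<lambda>s. s *\<^sub>R (y - x))) (at t within {0..1})"
          using hd unfolding has_vector_derivative_def .
        show "(?\<sigma> has_derivative frechet_derivative ?\<sigma> (at (h t))) (at (h t) within h ` {0..1})"
          using s by (rule has_derivative_at_withinI)
      qed
      moreover have "frechet_derivative ?\<sigma> (at (h t)) \<circ> (\<lambda>s. s *\<^sub>R (y - x)) = (\<lambda>s. s *\<^sub>R ?D t)"
        using has_derivative_linear[OF s] by (auto simp: linear_cmul fun_eq_iff)
      ultimately show ?thesis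
        by (simp add: has_vector_derivative_def \<gamma>_def comp_assoc)
    qed
    ultimately show ?thesis by blast
  qed
  with g have C1: "C1_curve M \<gamma> 0 1"
    unfolding C1_curve_def by blast
  have sp: "speed_on M \<gamma> 0 1 t \<le> B * norm (y - x)" if t: "t \<in> {0..1}" for t
  proof -
    have dom: "\<gamma> t \<in> chart_dom c"
      unfolding \<gamma>_def using chart_inv_dom[OF tc hi[OF t]] by simp
    have "((chart_map c \<circ> \<gamma>) has_vector_derivative (y - x)) (at t within {0..1})"
      by (rule has_vector_derivative_transform[OF t _ hd]) (use chart_map_inv[OF tc] hi in \<open>auto simp: \<gamma>_def\<close>)
    from speed_on_chart[OF M g _ t c dom this]
    have "speed_on M \<gamma> 0 1 t = tangent_norm c (\<gamma> t) (y - x)" by simp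
    also have "\<dots> \<le> B * norm (y - x)"
      using up[OF hs[OF t]] by (simp add: \<gamma>_def)
    finally show ?thesis .
  qed
  have "integral {0..1} (speed M \<gamma>) = integral {0..1} (speed_on M \<gamma> 0 1)"
    using C1_curve_speed[OF M C1] by (simp add: has_integral_iff)
  also have "\<dots> \<le> integral {0..1} (\<lambda>_::real. B * norm (y - x))"
    by (intro integral_le integrable_continuous_interval speed_on_continuous[OF M C1] sp) auto
  finally have "integral {0..1} (speed M \<gamma>) \<le> B * norm (y - x)"
    by simp
  moreover have "joins M (integral {0..1} (speed M \<gamma>)) (chart_inv c x) (chart_inv c y)"
    using joinsI[OF M C1_curve_pw_C1[OF C1]] by (simp add: \<gamma>_def h_def)
  ultimately show ?thesis by blast
qed

text \<open>A curve has to be long in order to leave a chart ball. If it were shorter than \<open>l r\<close>, its displacement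
  before the first exit time \<open>T\<close> would be at most \<open>L / l < r\<close>. It would thus stay in the compact set
  of points at coordinate distance at most \<open>L / l\<close>, and so would the exit point, which yet lies
  outside the open ball.\<close>

lemma joins_exit:
  assumes M: "riemannian_manifold UNIV M" and J: "joins M L p q"
    and c: "c \<in> atlas M" "p \<in> chart_dom c" and r: "0 < r" "cball (chart_map c p) r \<subseteq> chart_img c"
    and l: "0 < l" and low: "\<And>z v. z \<in> cball (chart_map c p) r \<Longrightarrow> l * norm v \<le> tangent_norm c (chart_inv c z) v"
    and q: "q \<notin> chart_inv c ` ball (chart_map c p) r"
  shows "l * r \<le> L"
proof (rule ccontr)
  assume "\<not> l * r \<le> L"
  then have Lr: "L / l < r"
    using l by (simp add: field_simps)
  have L0: "0 \<le> L" by (rule joins_nonneg[OF M J])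
  have tc: "topological_chart UNIV (mtop M) c"
    by (rule riemannian_manifold_chart[OF M c(1)])
  obtain \<gamma> where g: "pw_C1 M \<gamma> 0 1" "\<gamma> 0 = p" "\<gamma> 1 = q" "L = integral {0..1} (speed M \<gamma>)"
    using J by (auto simp: joins_def)
  have cont: "continuous_map (top_of_set {0..1}) (mtop M) \<gamma>"
    by (rule pw_C1_continuous[OF g(1)]) simp
  define x0 where "x0 = chart_map c p"
  define W where "W = chart_inv c ` ball x0 r"
  define Q where "Q = chart_inv c ` cball x0 (L / l)"
  have br: "ball x0 r \<subseteq> chart_img c"
    using r(2) ball_subset_cball by (fastforce simp: x0_def)
  have "cball x0 (L / l) \<subseteq> ball x0 r"
    using Lr by auto
  then have QW: "Q \<subseteq> W" and QL: "cball x0 (L / l) \<subseteq> chart_img c"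
    using br unfolding Q_def W_def by blast+
  have Wo: "openin (mtop M) W"
    unfolding W_def by (rule chart_openin_inv[OF tc _ br]) simp
  have "compactin (mtop M) Q"
    unfolding Q_def by (rule chart_compactin_inv[OF tc _ QL]) simp
  then have Qc: "closedin (mtop M) Q"
    using M by (intro compactin_imp_closedin) (simp_all add: riemannian_manifold_def)
  define A where "A = {t \<in> {0..1}. \<gamma> t \<notin> W}"
  have "closedin (top_of_set {0..1}) {t \<in> topspace (top_of_set {0..1}). \<gamma> t \<in> points M - W}"
    by (rule closedin_continuous_map_preimage[OF cont]) (use Wo in auto)
  moreover have "{t \<in> topspace (top_of_set {0..1}). \<gamma> t \<in> points M - W} = A"
    unfolding A_def using curve_in_points[OF cont] by auto
  ultimately have Acl: "closed A"
    using closedin_closed_trans[of "{0..1}" A] by simp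
  have A1: "1 \<in> A"
    using q g(3) by (simp add: A_def W_def x0_def)
  have bA: "bdd_below A"
    by (rule bdd_belowI[of _ 0]) (simp add: A_def)
  define T where "T = Inf A"
  have TA: "T \<in> A"
    unfolding T_def by (rule closed_contains_Inf[OF _ bA Acl]) (use A1 in blast)
  have before: "\<gamma> t \<in> W" if "0 \<le> t" "t < T" for t
  proof (rule ccontr)
    assume "\<gamma> t \<notin> W"
    moreover have "t \<le> 1" using TA that by (simp add: A_def)
    ultimately have "t \<in> A" using that by (simp add: A_def)
    then have "T \<le> t" unfolding T_def by (rule cInf_lower[OF _ bA])
    with that show False by simp
  qed
  have "p \<in> W"
    unfolding W_def x0_def using r(1) chart_inv_map[OF tc c(2)] by (metis centre_in_ball imageI)
  then have "T \<noteq> 0" using TA g(2) by (auto simp: A_def)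
  then have T: "0 < T" "T \<le> 1" using TA by (auto simp: A_def)
  have Wc: "chart_map c z \<in> ball x0 r" "z \<in> chart_dom c" if "z \<in> W" for z
    using that chart_inv_image[OF tc br] unfolding W_def by auto
  have inQ: "\<gamma> t \<in> Q" if t: "0 \<le> t" "t < T" for t
  proof -
    have "norm (chart_map c (\<gamma> t) - x0) \<le> L / l"
    proof (cases "t = 0")
      case True
      then show ?thesis using L0 l g(2) by (simp add: x0_def)
    next
      case False
      then have t0: "0 < t" using t by simp
      have C': "pw_C1 M \<gamma> 0 t" by (rule pw_C1_subinterval[OF g(1)]) (use t T in auto)
      have "l * norm (chart_map c (\<gamma> t) - chart_map c (\<gamma> 0)) \<le> integral {0..t} (speed M \<gamma>)"
      proof (rule chart_displacement_le_length[OF M C' t0 c(1) _ l])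
        show "\<gamma> ` {0..t} \<subseteq> chart_dom c"
          using before Wc(2) t by auto
        fix s v assume "s \<in> {0..t}"
        then have "\<gamma> s \<in> W" using before t by auto
        then have "chart_map c (\<gamma> s) \<in> cball (chart_map c p) r" "chart_inv c (chart_map c (\<gamma> s)) = \<gamma> s"
          using Wc[of "\<gamma> s"] chart_inv_map[OF tc] by (auto simp: x0_def less_imp_le)
        then show "l * norm v \<le> tangent_norm c (\<gamma> s) v"
          using low by metis
      qed
      also have "\<dots> \<le> integral {0..t} (speed M \<gamma>) + integral {t..1} (speed M \<gamma>)"
        using speed_integral_nonneg[OF M pw_C1_subinterval[OF g(1)], of t 1] t T by simp
      also have "\<dots> = L"
        unfolding g(4) using t T by (intro speed_integral_combine[OF M g(1)]) auto
      finally show ?thesis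
        using l g(2) by (simp add: x0_def field_simps)
    qed
    then have "chart_map c (\<gamma> t) \<in> cball x0 (L / l)"
      by (simp add: dist_norm norm_minus_commute)
    then show ?thesis
      unfolding Q_def chart_inv_image[OF tc QL] using Wc(2)[OF before[OF t]] by simp
  qed
  have "closedin (top_of_set {0..1}) {t \<in> topspace (top_of_set {0..1}). \<gamma> t \<in> Q}"
    by (rule closedin_continuous_map_preimage[OF cont Qc])
  then have "closed {t \<in> {0..1}. \<gamma> t \<in> Q}"
    using closedin_closed_trans[of "{0..1}" "{t \<in> {0..1}. \<gamma> t \<in> Q}"] by simp
  moreover have "{0..<T} \<subseteq> {t \<in> {0..1}. \<gamma> t \<in> Q}"
    using inQ T by auto
  ultimately have "closure {0..<T} \<subseteq> {t \<in> {0..1}. \<gamma> t \<in> Q}"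
    by (intro closure_minimal)
  moreover have "T \<in> closure {0..<T}" using T by simp
  ultimately have "\<gamma> T \<in> Q" by blast
  then show False using QW TA by (auto simp: A_def)
qed

section \<open>The Riemannian distance and the Hopf--Rinow theorem\<close>

text \<open>The lengths of Euclidean unit vectors based in a compact coordinate ball attain a positive minimum
  and a maximum.\<close>

lemma chart_ball_bounds:
  fixes M :: "('a, 'n::finite) manifold"
  assumes M: "riemannian_manifold UNIV M" and p: "p \<in> points M"
  obtains c r l B where "c \<in> atlas M" "p \<in> chart_dom c" "0 < r" "cball (chart_map c p) r \<subseteq> chart_img c"
    "0 < l" "0 < B"
    "\<And>z v. z \<in> cball (chart_map c p) r \<Longrightarrow> l * norm v \<le> tangent_norm c (chart_inv c z) v"
    "\<And>z v. z \<in> cball (chart_map c p) r \<Longrightarrow> tangent_norm c (chart_inv c z) v \<le> B * norm v"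
proof -
  obtain c where c: "c \<in> atlas M" "p \<in> chart_dom c"
    using chart_at_in[OF M p] by blast
  have tc: "topological_chart UNIV (mtop M) c" and sc: "smooth_metric UNIV c"
    using riemannian_manifold_chart[OF M c(1)] by auto
  let ?x = "chart_map c p"
  obtain r where r: "0 < r" "cball ?x r \<subseteq> chart_img c"
    using chart_img_open[OF tc] c(2) open_contains_cball by blast
  let ?S = "cball ?x r \<times> sphere (0::real^'n) 1"
  define f where "f zv = tangent_norm c (chart_inv c (fst zv)) (snd zv)" for zv :: "(real^'n) \<times> (real^'n)"
  have cf: "continuous_on ?S f"
    unfolding f_def tangent_norm_def
  proof (rule tangent_norm_continuous_on)
    show "continuous_on ?S (\<lambda>zv. chart_gram c (chart_inv c (fst zv)) $ i $ j)" for i j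
      by (rule continuous_on_compose2[OF gram_continuous[OF sc] continuous_on_fst[OF continuous_on_id]])
         (use r(2) in auto)
  qed (intro continuous_intros)
  have cS: "compact ?S" by (intro compact_Times) auto
  have "axis undefined 1 \<in> sphere (0::real^'n) 1" by simp
  then have ne: "?S \<noteq> {}" using r(1) by fastforce
  obtain m where m: "m \<in> ?S" "\<And>s. s \<in> ?S \<Longrightarrow> f m \<le> f s"
    using continuous_attains_inf[OF cS ne cf] by blast
  obtain n where n: "n \<in> ?S" "\<And>s. s \<in> ?S \<Longrightarrow> f s \<le> f n"
    using continuous_attains_sup[OF cS ne cf] by blast
  have fpos: "0 < f s" if "s \<in> ?S" for s
  proof -
    have "snd s \<noteq> 0" "chart_inv c (fst s) \<in> chart_dom c"
      using that r(2) chart_inv_dom[OF tc] by auto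
    then show ?thesis
      using gram_pos[OF sc] by (simp add: f_def tangent_norm_def)
  qed
  have scale: "tangent_norm c (chart_inv c z) v = norm v * f (z, v /\<^sub>R norm v)" if "v \<noteq> 0" for z v
    using tangent_norm_scaleR[of c "chart_inv c z" "norm v" "v /\<^sub>R norm v"] that by (simp add: f_def)
  have S: "(z, v /\<^sub>R norm v) \<in> ?S" if "z \<in> cball ?x r" "v \<noteq> 0" for z v
    using that by simp
  show ?thesis
  proof (rule that[OF c r fpos[OF m(1)] fpos[OF n(1)]])
    show "f m * norm v \<le> tangent_norm c (chart_inv c z) v" if "z \<in> cball ?x r" for z v
      using m(2)[OF S[OF that]] scale
      by (cases "v = 0") (simp_all add: tangent_norm_def mult.commute mult_left_mono)
    show "tangent_norm c (chart_inv c z) v \<le> f n * norm v" if "z \<in> cball ?x r" for z v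
      using n(2)[OF S[OF that]] scale
      by (cases "v = 0") (simp_all add: tangent_norm_def mult.commute mult_left_mono)
  qed
qed

lemma chart_nhd_joins:
  assumes M: "riemannian_manifold UNIV M" and p: "p \<in> points M" and e: "0 < e"
  shows "\<exists>W. openin (mtop M) W \<and> p \<in> W \<and> (\<forall>q\<in>W. \<exists>L<e. joins M L p q)"
proof -
  obtain c r l B where c: "c \<in> atlas M" "p \<in> chart_dom c" and r: "0 < r" "cball (chart_map c p) r \<subseteq> chart_img c"
    and B: "0 < B" and up: "\<And>z v. z \<in> cball (chart_map c p) r \<Longrightarrow> tangent_norm c (chart_inv c z) v \<le> B * norm v"
    by (rule chart_ball_bounds[OF M p]) blast
  have tc: "topological_chart UNIV (mtop M) c"
    by (rule riemannian_manifold_chart[OF M c(1)])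
  let ?x = "chart_map c p"
  define s where "s = min r (e / B)"
  have s: "0 < s" "s \<le> r" "B * s \<le> e"
    using r(1) e B by (auto simp: s_def min_def field_simps)
  have sub: "ball ?x s \<subseteq> cball ?x r" using s by auto
  have "\<exists>L<e. joins M L p q" if q: "q \<in> chart_inv c ` ball ?x s" for q
  proof -
    obtain y where y: "y \<in> ball ?x s" "q = chart_inv c y" using q by blast
    have seg: "closed_segment ?x y \<subseteq> ball ?x s"
      using y s by (intro closed_segment_subset) auto
    have "\<exists>L. joins M L (chart_inv c ?x) (chart_inv c y) \<and> L \<le> B * norm (y - ?x)"
      using seg sub r(2) up by (intro joins_chart_segment[OF M c(1)]) blast+
    then obtain L where L: "joins M L p q" "L \<le> B * norm (y - ?x)"
      using y chart_inv_map[OF tc c(2)] by auto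
    have "B * norm (y - ?x) < B * s"
      using y(1) B by (simp add: dist_norm norm_minus_commute)
    then show ?thesis using L s(3) by force
  qed
  moreover have "openin (mtop M) (chart_inv c ` ball ?x s)"
    using sub r(2) by (intro chart_openin_inv[OF tc]) auto
  moreover have "p \<in> chart_inv c ` ball ?x s"
    using s(1) chart_inv_map[OF tc c(2)] by (metis centre_in_ball imageI)
  ultimately show ?thesis by blast
qed

text \<open>The points that can be reached from \<open>p\<close> form an open and closed set.\<close>

lemma joins_exist:
  assumes M: "riemannian_manifold UNIV M" and conn: "connected_space (mtop M)"
    and p: "p \<in> points M" and q: "q \<in> points M"
  shows "\<exists>L. joins M L p q"
proof -
  define Z where "Z = {q \<in> points M. \<exists>L. joins M L p q}"
  have nhd: "\<exists>W. openin (mtop M) W \<and> z \<in> W \<and> (\<forall>q\<in>W. \<exists>L. joins M L z q)" if "z \<in> points M" for z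
    using chart_nhd_joins[OF M that zero_less_one] by blast
  have "openin (mtop M) Z"
  proof (subst openin_subopen, rule ballI)
    fix z assume z: "z \<in> Z"
    then obtain W where W: "openin (mtop M) W" "z \<in> W" "\<forall>q\<in>W. \<exists>L. joins M L z q"
      using nhd[of z] by (auto simp: Z_def)
    have "W \<subseteq> Z"
    proof
      fix w assume w: "w \<in> W"
      then obtain L L' where "joins M L p z" "joins M L' z w"
        using W(3) z by (auto simp: Z_def)
      then have "joins M (L + L') p w" by (rule joins_trans[OF M])
      then show "w \<in> Z"
        using w openin_subset[OF W(1)] by (auto simp: Z_def)
    qed
    then show "\<exists>T. openin (mtop M) T \<and> z \<in> T \<and> T \<subseteq> Z" using W by blast
  qed
  moreover have "openin (mtop M) (points M - Z)"
  proof (subst openin_subopen, rule ballI)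
    fix z assume z: "z \<in> points M - Z"
    then obtain W where W: "openin (mtop M) W" "z \<in> W" "\<forall>q\<in>W. \<exists>L. joins M L z q"
      using nhd[of z] by auto
    have "w \<notin> Z" if w: "w \<in> W" for w
    proof
      assume "w \<in> Z"
      then obtain L where "joins M L p w" by (auto simp: Z_def)
      moreover obtain L' where "joins M L' z w" using W(3) w by blast
      ultimately have "joins M (L + L') p z" using joins_trans[OF M] joins_sym[OF M] by blast
      then have "z \<in> Z" using z by (auto simp: Z_def)
      with z show False by simp
    qed
    then show "\<exists>T. openin (mtop M) T \<and> z \<in> T \<and> T \<subseteq> points M - Z"
      using W openin_subset[OF W(1)] by blast
  qed
  moreover have "Z \<subseteq> points M"
    by (auto simp: Z_def)
  ultimately have "Z = {} \<or> Z = points M"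
    using conn unfolding connected_space_clopen_in closedin_def by blast
  moreover have "p \<in> Z"
    using p joins_refl[OF p] by (auto simp: Z_def)
  ultimately show ?thesis
    using q by (auto simp: Z_def)
qed

lemma riemannian_dist_le:
  assumes M: "riemannian_manifold UNIV M" and J: "joins M L p q"
  shows "riemannian_dist M p q \<le> L"
  unfolding riemannian_dist_joins
  by (rule cInf_lower) (use J joins_nonneg[OF M] in \<open>auto intro!: bdd_belowI[of _ 0]\<close>)

text \<open>Connectedness guarantees that the infimum is taken over a nonempty set; the infimum of the empty
  set would be an arbitrary number.\<close>

lemma riemannian_dist_less:
  assumes M: "riemannian_manifold UNIV M" and conn: "connected_space (mtop M)"
    and p: "p \<in> points M" and q: "q \<in> points M" and R: "riemannian_dist M p q < R"
  shows "\<exists>L<R. joins M L p q"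
proof -
  have "{L. joins M L p q} \<noteq> {}"
    using joins_exist[OF M conn p q] by blast
  then show ?thesis
    using cInf_lessD[of "{L. joins M L p q}" R] R unfolding riemannian_dist_joins by blast
qed

text \<open>Metric spaces with a carrier demand nonnegativity and symmetry on the whole type, hence the default
  value outside the manifold.\<close>

definition mfd_dist :: "('a, 'n::finite) manifold \<Rightarrow> 'a \<Rightarrow> 'a \<Rightarrow> real" where
  "mfd_dist M p q = (if p \<in> points M \<and> q \<in> points M then riemannian_dist M p q else 0)"

text \<open>A point at small distance is joined to \<open>p\<close> by a curve too short to leave a chart ball inside \<open>U\<close>.\<close>

lemma small_dist_in_open:
  assumes M: "riemannian_manifold UNIV M" and conn: "connected_space (mtop M)"
    and U: "openin (mtop M) U" "p \<in> U"
  shows "\<exists>e>0. \<forall>q\<in>points M. riemannian_dist M p q < e \<longrightarrow> q \<in> U"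
proof -
  have p: "p \<in> points M" using U openin_subset by blast
  obtain c r l B where c: "c \<in> atlas M" "p \<in> chart_dom c" and r: "0 < r" "cball (chart_map c p) r \<subseteq> chart_img c"
    and l: "0 < l" and low: "\<And>z v. z \<in> cball (chart_map c p) r \<Longrightarrow> l * norm v \<le> tangent_norm c (chart_inv c z) v"
    by (rule chart_ball_bounds[OF M p]) blast
  have tc: "topological_chart UNIV (mtop M) c"
    by (rule riemannian_manifold_chart[OF M c(1)])
  let ?x = "chart_map c p"
  have "open (chart_map c ` (U \<inter> chart_dom c))"
    by (rule chart_open_image[OF tc]) (auto intro: U chart_dom_open[OF tc])
  moreover have "?x \<in> chart_map c ` (U \<inter> chart_dom c)"
    using U c by blast
  ultimately obtain r' where r': "0 < r'" "ball ?x r' \<subseteq> chart_map c ` (U \<inter> chart_dom c)"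
    by (rule openE)
  define s where "s = min r r'"
  have s: "0 < s" "s \<le> r" "s \<le> r'" using r r' by (auto simp: s_def)
  have cs: "cball ?x s \<subseteq> chart_img c" using r(2) s(2) by (meson cball_subset_cball_iff dual_order.trans subset_cball)
  have bU: "chart_inv c ` ball ?x s \<subseteq> U"
  proof
    fix q assume "q \<in> chart_inv c ` ball ?x s"
    then obtain y where y: "y \<in> ball ?x s" "q = chart_inv c y" by blast
    then have "y \<in> chart_map c ` (U \<inter> chart_dom c)"
      using r'(2) s(3) by auto
    then show "q \<in> U" using y chart_inv_map[OF tc] by auto
  qed
  have "q \<in> U" if q: "q \<in> points M" "riemannian_dist M p q < l * s" for q
  proof -
    obtain L where L: "L < l * s" "joins M L p q"
      using riemannian_dist_less[OF M conn p q] by blast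
    have "q \<in> chart_inv c ` ball ?x s"
    proof (rule ccontr)
      assume "q \<notin> chart_inv c ` ball ?x s"
      then have "l * s \<le> L"
        by (rule joins_exit[OF M L(2) c s(1) cs l, rotated]) (use low s(2) in auto)
      with L(1) show False by simp
    qed
    then show ?thesis using bU by blast
  qed
  then show ?thesis
    using l s(1) by (intro exI[of _ "l * s"]) simp
qed

lemma Metric_space_mfd_dist:
  assumes M: "riemannian_manifold UNIV M" and conn: "connected_space (mtop M)"
  shows "Metric_space (points M) (mfd_dist M)"
proof
  have nonneg: "0 \<le> riemannian_dist M p q" if "p \<in> points M" "q \<in> points M" for p q
    unfolding riemannian_dist_joins using joins_exist[OF M conn that] joins_nonneg[OF M]
    by (intro cInf_greatest) auto
  show "0 \<le> mfd_dist M p q" for p q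
    using nonneg by (simp add: mfd_dist_def)
  have "{L. joins M L p q} = {L. joins M L q p}" for p q
    using joins_sym[OF M] by blast
  then show "mfd_dist M p q = mfd_dist M q p" for p q
    by (simp add: mfd_dist_def riemannian_dist_joins)
  show "mfd_dist M p q = 0 \<longleftrightarrow> p = q" if pq: "p \<in> points M" "q \<in> points M" for p q
  proof
    assume "p = q"
    then have "riemannian_dist M p q \<le> 0"
      using riemannian_dist_le[OF M joins_refl[OF pq(1)]] by simp
    then show "mfd_dist M p q = 0"
      using nonneg[OF pq] pq by (simp add: mfd_dist_def)
  next
    assume d: "mfd_dist M p q = 0"
    show "p = q"
    proof (rule ccontr)
      assume "p \<noteq> q"
      then obtain U where U: "openin (mtop M) U" "p \<in> U" "q \<notin> U"
        using M pq unfolding riemannian_manifold_def Hausdorff_space_def disjnt_iff by metis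
      show False
        using small_dist_in_open[OF M conn U(1,2)] U(3) pq d by (auto simp: mfd_dist_def)
    qed
  qed
  show "mfd_dist M p r \<le> mfd_dist M p q + mfd_dist M q r"
    if pts: "p \<in> points M" "q \<in> points M" "r \<in> points M" for p q r
  proof (rule field_le_epsilon)
    fix e :: real assume e: "0 < e"
    obtain L where L: "L < riemannian_dist M p q + e / 2" "joins M L p q"
      using riemannian_dist_less[OF M conn pts(1,2), of "riemannian_dist M p q + e / 2"] e by auto
    obtain L' where L': "L' < riemannian_dist M q r + e / 2" "joins M L' q r"
      using riemannian_dist_less[OF M conn pts(2,3), of "riemannian_dist M q r + e / 2"] e by auto
    have "riemannian_dist M p r \<le> L + L'"
      by (rule riemannian_dist_le[OF M joins_trans[OF M L(2) L'(2)]])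
    then show "mfd_dist M p r \<le> mfd_dist M p q + mfd_dist M q r + e"
      using L L' pts by (simp add: mfd_dist_def)
  qed
qed

text \<open>Chart balls contain metric balls by the exit estimate, and metric balls contain chart balls because
  segments in a chart are short.\<close>

lemma mtopology_mfd_dist:
  assumes M: "riemannian_manifold UNIV M" and conn: "connected_space (mtop M)"
  shows "Metric_space.mtopology (points M) (mfd_dist M) = mtop M"
proof -
  interpret D: Metric_space "points M" "mfd_dist M"
    by (rule Metric_space_mfd_dist[OF M conn])
  show ?thesis
    unfolding topology_eq
  proof (intro allI iffI)
    fix U assume U: "openin (mtop M) U"
    have "\<exists>r>0. D.mball p r \<subseteq> U" if p: "p \<in> U" for p
    proof -
      obtain e where "e > 0" "\<forall>q\<in>points M. riemannian_dist M p q < e \<longrightarrow> q \<in> U"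
        using small_dist_in_open[OF M conn U p] by blast
      then show ?thesis
        by (intro exI[of _ e]) (auto simp: mfd_dist_def)
    qed
    then show "openin D.mtopology U"
      unfolding D.openin_mtopology using openin_subset[OF U] by blast
  next
    fix U assume U: "openin D.mtopology U"
    show "openin (mtop M) U"
    proof (subst openin_subopen, rule ballI)
      fix p assume p: "p \<in> U"
      then obtain e where e: "e > 0" "D.mball p e \<subseteq> U"
        using U unfolding D.openin_mtopology by blast
      have pM: "p \<in> points M" using U p unfolding D.openin_mtopology by blast
      obtain W where W: "openin (mtop M) W" "p \<in> W" "\<forall>q\<in>W. \<exists>L<e. joins M L p q"
        using chart_nhd_joins[OF M pM e(1)] by blast
      have "W \<subseteq> D.mball p e"
      proof
        fix q assume q: "q \<in> W"
        then obtain L where "L < e" "joins M L p q" using W(3) by blast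
        then have "riemannian_dist M p q < e" using riemannian_dist_le[OF M] by force
        then show "q \<in> D.mball p e"
          using q pM openin_subset[OF W(1)] by (auto simp: mfd_dist_def)
      qed
      then show "\<exists>T. openin (mtop M) T \<and> p \<in> T \<and> T \<subseteq> U"
        using W e by blast
    qed
  qed
qed

text \<open>The Hopf--Rinow theorem for length spaces. Let \<open>s\<close> be the supremum of the radii of compact
  balls around \<open>p\<close>. A point at distance at most \<open>s\<close> is near to some point of a slightly smaller, compact
  ball; so the ball of radius \<open>s\<close> is totally bounded, and compact by completeness. Local compactness
  then gives a slightly larger compact ball, which contradicts the choice of \<open>s\<close>.\<close>

theorem (in Metric_space) Hopf_Rinow:
  assumes complete: mcomplete
    and loc: "\<And>x. x \<in> M \<Longrightarrow> \<exists>r>0. compactin mtopology (mcball x r)"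
    and between: "\<And>x y a b. x \<in> M \<Longrightarrow> y \<in> M \<Longrightarrow> 0 < a \<Longrightarrow> 0 < b \<Longrightarrow> d x y < a + b \<Longrightarrow> \<exists>z\<in>M. d x z < a \<and> d z y < b"
    and p: "p \<in> M"
  shows "compactin mtopology (mcball p R)"
proof (rule ccontr)
  assume R: "\<not> compactin mtopology (mcball p R)"
  define S where "S = {s. compactin mtopology (mcball p s)}"
  have down: "s' \<in> S" if "s \<in> S" "s' \<le> s" for s s'
    using that closed_compactin[OF _ mcball_subset_concentric[OF that(2)] closedin_mcball]
    by (simp add: S_def)
  have up: "s \<le> R" if "s \<in> S" for s
    using R down[OF that, of R] by (force simp: S_def)
  then have bS: "bdd_above S" by (rule bdd_aboveI)
  obtain r0 where r0: "r0 > 0" "r0 \<in> S"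
    using loc[OF p] by (auto simp: S_def)
  define s where "s = Sup S"
  have s0: "0 < s"
    using cSup_upper[OF r0(2) bS] r0(1) by (simp add: s_def)
  have below: "a \<in> S" if "a < s" for a
    using less_cSupD[of S a] that r0 down unfolding s_def by (metis empty_iff less_imp_le)
  have "mtotally_bounded (mcball p s)"
    unfolding mtotally_bounded_def
  proof (intro allI impI)
    fix e :: real assume e: "0 < e"
    \<comment> \<open>a positive radius below \<open>s\<close> by less than \<open>e / 2\<close>\<close>
    define a where "a = max (s - e / 4) (s / 2)"
    have a: "0 < a" "a < s" "s < a + e / 2"
      using s0 e by (auto simp: a_def max_def)
    have "mtotally_bounded (mcball p a)"
      using below[OF a(2)] by (intro compactin_imp_mtotally_bounded) (simp add: S_def)
    then obtain K where K: "finite K" "K \<subseteq> mcball p a" "mcball p a \<subseteq> (\<Union>x\<in>K. mball x (e / 2))"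
      using e unfolding mtotally_bounded_def by (metis half_gt_zero)
    have "q \<in> (\<Union>x\<in>K. mball x e)" if q: "q \<in> mcball p s" for q
    proof -
      have "d p q < a + e / 2" "q \<in> M" using q a(3) by auto
      then obtain z where z: "z \<in> M" "d p z < a" "d z q < e / 2"
        using between[OF p, of q a "e / 2"] a e by auto
      then have "z \<in> mcball p a" using p by simp
      then obtain x where x: "x \<in> K" "x \<in> M" "d x z < e / 2" using K(3) by auto
      have "d x q < e" using triangle[OF x(2) z(1) \<open>q \<in> M\<close>] x z by simp
      then show ?thesis using x \<open>q \<in> M\<close> by auto
    qed
    moreover have "K \<subseteq> mcball p s" using K(2) a by fastforce
    ultimately show "\<exists>K. finite K \<and> K \<subseteq> mcball p s \<and> mcball p s \<subseteq> (\<Union>x\<in>K. mball x e)"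
      using K(1) by blast
  qed
  then have "compactin mtopology (mtopology closure_of (mcball p s))"
    using mtotally_bounded_eq_compact_closure_of[OF complete] by blast
  then have comp: "compactin mtopology (mcball p s)"
    by (simp add: closure_of_closedin)
  obtain \<rho> where \<rho>: "\<And>x. x \<in> M \<Longrightarrow> \<rho> x > 0" "\<And>x. x \<in> M \<Longrightarrow> compactin mtopology (mcball x (\<rho> x))"
    using loc by metis
  have "\<exists>\<F>. finite \<F> \<and> \<F> \<subseteq> (\<lambda>x. mball x (\<rho> x / 2)) ` (mcball p s) \<and> mcball p s \<subseteq> \<Union>\<F>"
  proof (rule compactinD[OF comp])
    show "mcball p s \<subseteq> \<Union> ((\<lambda>x. mball x (\<rho> x / 2)) ` mcball p s)"
    proof
      fix q assume q: "q \<in> mcball p s"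
      then have "q \<in> mball q (\<rho> q / 2)" using \<rho>(1)[of q] by simp
      with q show "q \<in> \<Union> ((\<lambda>x. mball x (\<rho> x / 2)) ` mcball p s)" by blast
    qed
  qed (use openin_mball in blast)
  then obtain \<F> where \<F>: "finite \<F>" "\<F> \<subseteq> (\<lambda>x. mball x (\<rho> x / 2)) ` (mcball p s)" "mcball p s \<subseteq> \<Union>\<F>"
    by blast
  obtain F where F: "finite F" "F \<subseteq> mcball p s" "\<F> = (\<lambda>x. mball x (\<rho> x / 2)) ` F"
    using finite_subset_image[OF \<F>(1,2)] by blast
  then have cov: "mcball p s \<subseteq> (\<Union>x\<in>F. mball x (\<rho> x / 2))"
    using \<F>(3) by simp
  have FM: "F \<subseteq> M" using F(2) by auto
  have Fne: "F \<noteq> {}" using cov p s0 by force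
  define \<delta> where "\<delta> = Min ((\<lambda>x. \<rho> x / 2) ` F)"
  have \<delta>: "0 < \<delta>"
    using F(1) Fne FM \<rho>(1) by (auto simp: \<delta>_def subset_iff)
  have \<delta>_le: "\<delta> \<le> \<rho> x / 2" if "x \<in> F" for x
    unfolding \<delta>_def using F(1) that by (intro Min_le) auto
  have "mcball p (s + \<delta> / 2) \<subseteq> (\<Union>x\<in>F. mcball x (\<rho> x))"
  proof
    fix q assume q: "q \<in> mcball p (s + \<delta> / 2)"
    then have "d p q < s + \<delta>" "q \<in> M" using \<delta> by auto
    then obtain z where z: "z \<in> M" "d p z < s" "d z q < \<delta>"
      using between[OF p, of q s \<delta>] s0 \<delta> by auto
    then have "z \<in> mcball p s" using p by simp
    then obtain x where x: "x \<in> F" "x \<in> M" "d x z < \<rho> x / 2" using cov by auto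
    have "d x q \<le> \<rho> x" using triangle[OF x(2) z(1) \<open>q \<in> M\<close>] x z \<delta>_le[OF x(1)] by simp
    then show "q \<in> (\<Union>x\<in>F. mcball x (\<rho> x))" using x \<open>q \<in> M\<close> by auto
  qed
  moreover have "compactin mtopology (\<Union>x\<in>F. mcball x (\<rho> x))"
    using F(1) FM \<rho>(2) by (intro compactin_Union) auto
  ultimately have "s + \<delta> / 2 \<in> S"
    unfolding S_def using closed_compactin closedin_mcball by blast
  then have "s + \<delta> / 2 \<le> s"
    unfolding s_def by (rule cSup_upper[OF _ bS])
  with \<delta> show False by simp
qed

text \<open>The Riemannian distance satisfies the hypotheses of the Hopf--Rinow theorem: intermediate points arise
  by cutting an almost shortest curve in the ratio of the two given numbers, and small metric balls
  lie in compact chart balls.\<close>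

theorem bounded_in_compact:
  fixes M :: "('a, 'n::finite) manifold"
  assumes M: "riemannian_manifold UNIV M" and conn: "connected_space (mtop M)"
    and compl: "complete_manifold M" and bdd: "bounded_in_mfd M S"
  shows "\<exists>C. compactin (mtop M) C \<and> S \<subseteq> C"
proof -
  interpret D: Metric_space "points M" "mfd_dist M"
    by (rule Metric_space_mfd_dist[OF M conn])
  note top = mtopology_mfd_dist[OF M conn]
  have comp: "D.mcomplete"
    unfolding D.mcomplete_def
  proof (intro allI impI)
    fix \<sigma> assume \<sigma>: "D.MCauchy \<sigma>"
    then have r: "range \<sigma> \<subseteq> points M"
      by (simp add: D.MCauchy_def)
    have "\<exists>n0. \<forall>m\<ge>n0. \<forall>n\<ge>n0. riemannian_dist M (\<sigma> m) (\<sigma> n) < e" if "e > 0" for e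
    proof -
      obtain N where "\<forall>n n'. N \<le> n \<longrightarrow> N \<le> n' \<longrightarrow> mfd_dist M (\<sigma> n) (\<sigma> n') < e"
        using \<sigma> \<open>e > 0\<close> unfolding D.MCauchy_def by blast
      moreover have "mfd_dist M (\<sigma> n) (\<sigma> n') = riemannian_dist M (\<sigma> n) (\<sigma> n')" for n n'
        using r by (auto simp: mfd_dist_def)
      ultimately show ?thesis by auto
    qed
    then obtain p where p: "p \<in> points M" "(\<lambda>n. riemannian_dist M (\<sigma> n) p) \<longlonglongrightarrow> 0"
      using compl r unfolding complete_manifold_def by blast
    have "(\<lambda>n. mfd_dist M (\<sigma> n) p) = (\<lambda>n. riemannian_dist M (\<sigma> n) p)"
      using r p(1) by (auto simp: mfd_dist_def fun_eq_iff)
    then have "limitin D.mtopology \<sigma> p sequentially"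
      using p r by (simp add: D.limitin_metric_dist_null image_subset_iff)
    then show "\<exists>x. limitin D.mtopology \<sigma> x sequentially" by blast
  qed
  have loc: "\<exists>r>0. compactin D.mtopology (D.mcball x r)" if x: "x \<in> points M" for x
  proof -
    obtain c where c: "c \<in> atlas M" "x \<in> chart_dom c"
      using chart_at_in[OF M x] by blast
    have tc: "topological_chart UNIV (mtop M) c"
      by (rule riemannian_manifold_chart[OF M c(1)])
    obtain r where r: "0 < r" "cball (chart_map c x) r \<subseteq> chart_img c"
      using chart_img_open[OF tc] c(2) open_contains_cball by blast
    have b: "ball (chart_map c x) r \<subseteq> chart_img c" using r(2) by auto
    have "openin D.mtopology (chart_inv c ` ball (chart_map c x) r)"
      unfolding top by (rule chart_openin_inv[OF tc _ b]) simp
    moreover have "x \<in> chart_inv c ` ball (chart_map c x) r"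
      using r(1) chart_inv_map[OF tc c(2)] by (metis centre_in_ball imageI)
    ultimately obtain s where s: "s > 0" "D.mcball x s \<subseteq> chart_inv c ` ball (chart_map c x) r"
      unfolding D.openin_mtopology_mcball by blast
    have "compactin D.mtopology (chart_inv c ` cball (chart_map c x) r)"
      unfolding top by (rule chart_compactin_inv[OF tc _ r(2)]) simp
    then have "compactin D.mtopology (D.mcball x s)"
    proof (rule closed_compactin)
      have "ball (chart_map c x) r \<subseteq> cball (chart_map c x) r" by auto
      then show "D.mcball x s \<subseteq> chart_inv c ` cball (chart_map c x) r"
        using s(2) by blast
    qed (rule D.closedin_mcball)
    with s(1) show ?thesis by blast
  qed
  have between: "\<exists>z\<in>points M. mfd_dist M x z < a \<and> mfd_dist M z y < b"
    if xy: "x \<in> points M" "y \<in> points M" and ab: "0 < a" "0 < b" "mfd_dist M x y < a + b" for x y a b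
  proof -
    have "riemannian_dist M x y < a + b" using xy ab by (simp add: mfd_dist_def)
    then obtain L where L: "L < a + b" "joins M L x y"
      using riemannian_dist_less[OF M conn xy] by blast
    have L0: "0 \<le> L" by (rule joins_nonneg[OF M L(2)])
    define s where "s = L * (a / (a + b))"
    have \<theta>: "a / (a + b) \<le> 1" "0 \<le> a / (a + b)" using ab by auto
    have s: "0 \<le> s" "s \<le> L"
      unfolding s_def by (rule mult_nonneg_nonneg[OF L0 \<theta>(2)], rule mult_left_le[OF \<theta>(1) L0])
    have sa: "s < a"
    proof -
      have "L * (a / (a + b)) < (a + b) * (a / (a + b))"
        using L(1) ab by (intro mult_strict_right_mono) auto
      then show ?thesis using ab by (simp add: s_def)
    qed
    have sb: "L - s < b"
    proof -
      have "L - s = L * (b / (a + b))"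
        using ab by (simp add: s_def field_simps)
      also have "\<dots> < (a + b) * (b / (a + b))"
        using L(1) ab by (intro mult_strict_right_mono) auto
      finally show ?thesis using ab by simp
    qed
    obtain z where z: "joins M s x z" "joins M (L - s) z y"
      using joins_split[OF M L(2) s] by blast
    have "z \<in> points M" using joins_in_points(2)[OF z(1)] .
    moreover have "mfd_dist M x z < a" "mfd_dist M z y < b"
      using riemannian_dist_le[OF M z(1)] riemannian_dist_le[OF M z(2)] sa sb xy calculation
      by (simp_all add: mfd_dist_def)
    ultimately show ?thesis by blast
  qed
  obtain p B where p: "p \<in> points M" "\<forall>q\<in>S. riemannian_dist M p q \<le> B" and S: "S \<subseteq> points M"
    using bdd by (auto simp: bounded_in_mfd_def)
  have "compactin (mtop M) (D.mcball p B)"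
    using D.Hopf_Rinow[OF comp loc between p(1)] unfolding top by blast
  moreover have "S \<subseteq> D.mcball p B"
    using p S by (auto simp: mfd_dist_def)
  ultimately show ?thesis by blast
qed

section \<open>Translating the estimate\<close>

lemma FTC_nn_integral:
  fixes \<phi> :: "real \<Rightarrow> real"
  assumes T: "0 \<le> T" and der: "\<And>t. t \<in> {0..T} \<Longrightarrow> (\<phi> has_real_derivative \<phi>' t) (at t)"
    and cont: "continuous_on {0..T} \<phi>'"
  shows "ennreal \<bar>\<phi> 0\<bar> \<le> ennreal \<bar>\<phi> T\<bar> + (\<integral>\<^sup>+t\<in>{0..T}. ennreal \<bar>\<phi>' t\<bar> \<partial>lborel)"
proof -
  have I: "(\<phi>' has_integral (\<phi> T - \<phi> 0)) {0..T}"
    using der by (intro fundamental_theorem_of_calculus[OF T])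
      (auto simp: has_real_derivative_iff_has_vector_derivative[symmetric] intro: has_field_derivative_at_within)
  have ca: "continuous_on {0..T} (\<lambda>t. \<bar>\<phi>' t\<bar>)"
    using cont by (intro continuous_intros)
  define J where "J = integral {0..T} (\<lambda>t. \<bar>\<phi>' t\<bar>)"
  have J: "((\<lambda>t. \<bar>\<phi>' t\<bar>) has_integral J) {0..T}"
    unfolding J_def by (intro integrable_integral integrable_continuous_interval ca)
  have "\<bar>\<phi> T - \<phi> 0\<bar> \<le> J"
    using integral_norm_bound_integral[of \<phi>' "{0..T}" "\<lambda>t. \<bar>\<phi>' t\<bar>"] I J
    by (auto simp: has_integral_iff)
  moreover have J0: "0 \<le> J"
    using J by (rule has_integral_nonneg) simp
  ultimately have "ennreal \<bar>\<phi> 0\<bar> \<le> ennreal (\<bar>\<phi> T\<bar> + J)"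
    by (intro ennreal_leI) linarith
  also have "\<dots> = ennreal \<bar>\<phi> T\<bar> + ennreal J"
    using J0 by simp
  also have "ennreal J = (\<integral>\<^sup>+t. ennreal (indicator {0..T} t *\<^sub>R \<bar>\<phi>' t\<bar>) \<partial>lborel)"
  proof (rule nn_integral_has_integral_lborel[symmetric])
    show "(\<lambda>t. indicator {0..T} t *\<^sub>R \<bar>\<phi>' t\<bar>) \<in> borel_measurable borel"
      by (rule borel_measurable_continuous_on_indicator[OF _ ca]) simp
    have "((\<lambda>t. if t \<in> {0..T} then \<bar>\<phi>' t\<bar> else 0) has_integral J) UNIV"
      using J by (simp only: has_integral_restrict_UNIV)
    moreover have "(\<lambda>t. if t \<in> {0..T} then \<bar>\<phi>' t\<bar> else 0) = (\<lambda>t. indicator {0..T} t *\<^sub>R \<bar>\<phi>' t\<bar>)"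
      by (auto simp: fun_eq_iff)
    ultimately show "((\<lambda>t. indicator {0..T} t *\<^sub>R \<bar>\<phi>' t\<bar>) has_integral J) UNIV" by simp
  qed auto
  also have "\<dots> = (\<integral>\<^sup>+t\<in>{0..T}. ennreal \<bar>\<phi>' t\<bar> \<partial>lborel)"
    by (intro nn_integral_cong) (auto simp: indicator_def)
  finally show ?thesis .
qed

lemma nn_integral_lborel_translate:
  fixes g :: "'a::euclidean_space \<Rightarrow> ennreal"
  assumes [measurable]: "g \<in> borel_measurable borel"
  shows "(\<integral>\<^sup>+x. g (x + c) \<partial>lborel) = (\<integral>\<^sup>+x. g x \<partial>lborel)"
proof -
  have "(\<integral>\<^sup>+x. g x \<partial>lborel) = (\<integral>\<^sup>+x. g x \<partial>(distr lborel borel ((+) c)))"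
    by (simp add: lborel_distr_plus)
  also have "\<dots> = (\<integral>\<^sup>+x. g (c + x) \<partial>lborel)"
    by (subst nn_integral_distr) auto
  finally show ?thesis by (simp add: add.commute)
qed

text \<open>The fundamental theorem of calculus along segments in the direction \<open>v\<close>, integrated over \<open>S\<close>. After the
  exchange of the integrals, a point of \<open>P\<close> is counted with the time during which it lies in the
  moving set \<open>S + t v\<close>, which is at most \<open>a\<close>.\<close>

lemma nn_integral_translate_bound:
  fixes U :: "real^'n::finite \<Rightarrow> real" and w :: "real^'n \<Rightarrow> ennreal"
  assumes U: "C1_on P U U'" and P [measurable]: "P \<in> sets borel" and S [measurable]: "S \<in> sets borel" and T: "0 \<le> T"
    and seg: "\<And>x t. x \<in> S \<Longrightarrow> t \<in> {0..T} \<Longrightarrow> x + t *\<^sub>R v \<in> P"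
    and w: "(\<lambda>x. w x * indicator P x) \<in> borel_measurable borel"
    and inv: "\<And>x t. x \<in> S \<Longrightarrow> t \<in> {0..T} \<Longrightarrow> w (x + t *\<^sub>R v) = w x"
    and time: "\<And>y. emeasure lborel {t \<in> {0..T}. y - t *\<^sub>R v \<in> S} \<le> a"
  shows "(\<integral>\<^sup>+x\<in>S. ennreal \<bar>U x\<bar> * w x \<partial>lborel)
    \<le> (\<integral>\<^sup>+x\<in>{x. x - T *\<^sub>R v \<in> S}. ennreal \<bar>U x\<bar> * w x \<partial>lborel) + a * (\<integral>\<^sup>+x\<in>P. ennreal \<bar>U' x v\<bar> * w x \<partial>lborel)"
proof -
  define F where "F x = ennreal \<bar>U x\<bar> * w x * indicator P x" for x
  define G where "G x = ennreal \<bar>U' x v\<bar> * w x * indicator P x" for x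
  have F [measurable]: "F \<in> borel_measurable borel"
  proof -
    have "(\<lambda>x. indicator P x *\<^sub>R \<bar>U x\<bar>) \<in> borel_measurable borel"
      using C1_on_continuous[OF U] by (intro borel_measurable_continuous_on_indicator continuous_intros) auto
    then have "(\<lambda>x. ennreal (indicator P x *\<^sub>R \<bar>U x\<bar>) * (w x * indicator P x)) \<in> borel_measurable borel"
      using w by measurable
    moreover have "(\<lambda>x. ennreal (indicator P x *\<^sub>R \<bar>U x\<bar>) * (w x * indicator P x)) = F"
      by (auto simp: F_def fun_eq_iff indicator_def)
    ultimately show ?thesis by simp
  qed
  have G [measurable]: "G \<in> borel_measurable borel"
  proof -
    have "(\<lambda>x. indicator P x *\<^sub>R \<bar>U' x v\<bar>) \<in> borel_measurable borel"
      using U by (intro borel_measurable_continuous_on_indicator continuous_intros) (auto simp: C1_on_def)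
    then have "(\<lambda>x. ennreal (indicator P x *\<^sub>R \<bar>U' x v\<bar>) * (w x * indicator P x)) \<in> borel_measurable borel"
      using w by measurable
    moreover have "(\<lambda>x. ennreal (indicator P x *\<^sub>R \<bar>U' x v\<bar>) * (w x * indicator P x)) = G"
      by (auto simp: G_def fun_eq_iff indicator_def)
    ultimately show ?thesis by simp
  qed
  have point: "ennreal \<bar>U x\<bar> * w x * indicator S x
      \<le> F (x + T *\<^sub>R v) * indicator S x + (\<integral>\<^sup>+t. G (x + t *\<^sub>R v) * indicator S x * indicator {0..T} t \<partial>lborel)" for x
  proof (cases "x \<in> S")
    case True
    have der: "((\<lambda>t. U (x + t *\<^sub>R v)) has_real_derivative U' (x + t *\<^sub>R v) v) (at t)" if t: "t \<in> {0..T}" for t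
    proof -
      have d: "(U has_derivative U' (x + t *\<^sub>R v)) (at (x + t *\<^sub>R v))"
        using U seg[OF True t] by (auto simp: C1_on_def)
      have "((\<lambda>t. x + t *\<^sub>R v) has_derivative (\<lambda>t. t *\<^sub>R v)) (at t)"
        by (auto intro!: derivative_eq_intros)
      from diff_chain_at[OF this d]
      have "((\<lambda>t. U (x + t *\<^sub>R v)) has_derivative (\<lambda>s. U' (x + t *\<^sub>R v) (s *\<^sub>R v))) (at t)"
        by (simp add: o_def)
      moreover have "(\<lambda>s. U' (x + t *\<^sub>R v) (s *\<^sub>R v)) = (\<lambda>s. s *\<^sub>R U' (x + t *\<^sub>R v) v)"
        using has_derivative_linear[OF d] by (simp add: linear_cmul)
      ultimately show ?thesis
        by (simp add: has_field_derivative_def mult.commute[of _ "U' (x + t *\<^sub>R v) v"])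
    qed
    have cont: "continuous_on {0..T} (\<lambda>t. U' (x + t *\<^sub>R v) v)"
      by (rule continuous_on_compose2[of P "\<lambda>y. U' y v"])
         (use U seg[OF True] in \<open>auto simp: C1_on_def intro!: continuous_intros\<close>)
    have "ennreal \<bar>U x\<bar> * w x
        \<le> (ennreal \<bar>U (x + T *\<^sub>R v)\<bar> + (\<integral>\<^sup>+t\<in>{0..T}. ennreal \<bar>U' (x + t *\<^sub>R v) v\<bar> \<partial>lborel)) * w x"
      using FTC_nn_integral[OF T der cont] by (intro mult_right_mono) auto
    also have "\<dots> = ennreal \<bar>U (x + T *\<^sub>R v)\<bar> * w x
        + (\<integral>\<^sup>+t. ennreal \<bar>U' (x + t *\<^sub>R v) v\<bar> * indicator {0..T} t * w x \<partial>lborel)"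
    proof -
      have "(\<lambda>t. indicator {0..T} t *\<^sub>R \<bar>U' (x + t *\<^sub>R v) v\<bar>) \<in> borel_measurable borel"
        using cont by (intro borel_measurable_continuous_on_indicator continuous_intros) auto
      then have "(\<lambda>t. ennreal (indicator {0..T} t *\<^sub>R \<bar>U' (x + t *\<^sub>R v) v\<bar>)) \<in> borel_measurable borel"
        by measurable
      moreover have "(\<lambda>t. ennreal (indicator {0..T} t *\<^sub>R \<bar>U' (x + t *\<^sub>R v) v\<bar>))
          = (\<lambda>t. ennreal \<bar>U' (x + t *\<^sub>R v) v\<bar> * indicator {0..T} t)"
        by (auto simp: fun_eq_iff indicator_def)
      ultimately have "(\<lambda>t. ennreal \<bar>U' (x + t *\<^sub>R v) v\<bar> * indicator {0..T} t) \<in> borel_measurable borel"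
        by (simp only:)
      then show ?thesis
        by (simp add: distrib_right nn_integral_multc)
    qed
    also have "ennreal \<bar>U (x + T *\<^sub>R v)\<bar> * w x = F (x + T *\<^sub>R v)"
      using seg[OF True, of T] inv[OF True, of T] T by (simp add: F_def)
    also have "(\<integral>\<^sup>+t. ennreal \<bar>U' (x + t *\<^sub>R v) v\<bar> * indicator {0..T} t * w x \<partial>lborel)
        = (\<integral>\<^sup>+t. G (x + t *\<^sub>R v) * indicator S x * indicator {0..T} t \<partial>lborel)"
      using seg[OF True] inv[OF True] True
      by (intro nn_integral_cong) (auto simp: G_def indicator_def)
    finally show ?thesis using True by simp
  qed simp
  have "(\<integral>\<^sup>+x\<in>S. ennreal \<bar>U x\<bar> * w x \<partial>lborel)
      \<le> (\<integral>\<^sup>+x. F (x + T *\<^sub>R v) * indicator S x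
           + (\<integral>\<^sup>+t. G (x + t *\<^sub>R v) * indicator S x * indicator {0..T} t \<partial>lborel) \<partial>lborel)"
    by (rule nn_integral_mono) (rule point)
  also have "\<dots> = (\<integral>\<^sup>+x. F (x + T *\<^sub>R v) * indicator S x \<partial>lborel)
      + (\<integral>\<^sup>+x. (\<integral>\<^sup>+t. G (x + t *\<^sub>R v) * indicator S x * indicator {0..T} t \<partial>lborel) \<partial>lborel)"
    by (rule nn_integral_add) measurable
  also have "(\<integral>\<^sup>+x. F (x + T *\<^sub>R v) * indicator S x \<partial>lborel)
      = (\<integral>\<^sup>+x\<in>{x. x - T *\<^sub>R v \<in> S}. ennreal \<bar>U x\<bar> * w x \<partial>lborel)"
  proof -
    have m: "(\<lambda>x. F x * indicator S (x - T *\<^sub>R v)) \<in> borel_measurable borel" by measurable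
    have "(\<integral>\<^sup>+x. F (x + T *\<^sub>R v) * indicator S x \<partial>lborel) = (\<integral>\<^sup>+x. F x * indicator S (x - T *\<^sub>R v) \<partial>lborel)"
      using nn_integral_lborel_translate[OF m, of "T *\<^sub>R v"] by simp
    also have "\<dots> = (\<integral>\<^sup>+x\<in>{x. x - T *\<^sub>R v \<in> S}. ennreal \<bar>U x\<bar> * w x \<partial>lborel)"
    proof (rule nn_integral_cong)
      fix x show "F x * indicator S (x - T *\<^sub>R v) = ennreal \<bar>U x\<bar> * w x * indicator {x. x - T *\<^sub>R v \<in> S} x"
        using seg[of "x - T *\<^sub>R v" T] T by (auto simp: F_def indicator_def)
    qed
    finally show ?thesis .
  qed
  also have "(\<integral>\<^sup>+x. (\<integral>\<^sup>+t. G (x + t *\<^sub>R v) * indicator S x * indicator {0..T} t \<partial>lborel) \<partial>lborel)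
      = (\<integral>\<^sup>+t. (\<integral>\<^sup>+x. G (x + t *\<^sub>R v) * indicator S x * indicator {0..T} t \<partial>lborel) \<partial>lborel)"
    by (rule lborel_pair.Fubini'[symmetric]) measurable
  also have "\<dots> = (\<integral>\<^sup>+t. (\<integral>\<^sup>+x. G x * indicator S (x - t *\<^sub>R v) * indicator {0..T} t \<partial>lborel) \<partial>lborel)"
  proof (rule nn_integral_cong)
    fix t :: real
    have m: "(\<lambda>x. G x * indicator S (x - t *\<^sub>R v) * indicator {0..T} t) \<in> borel_measurable borel" by measurable
    show "(\<integral>\<^sup>+x. G (x + t *\<^sub>R v) * indicator S x * indicator {0..T} t \<partial>lborel)
        = (\<integral>\<^sup>+x. G x * indicator S (x - t *\<^sub>R v) * indicator {0..T} t \<partial>lborel)"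
      using nn_integral_lborel_translate[OF m, of "t *\<^sub>R v"] by simp
  qed
  also have "\<dots> = (\<integral>\<^sup>+x. (\<integral>\<^sup>+t. G x * indicator S (x - t *\<^sub>R v) * indicator {0..T} t \<partial>lborel) \<partial>lborel)"
    by (rule lborel_pair.Fubini') measurable
  also have "\<dots> = (\<integral>\<^sup>+x. G x * emeasure lborel {t \<in> {0..T}. x - t *\<^sub>R v \<in> S} \<partial>lborel)"
  proof (rule nn_integral_cong)
    fix x :: "real^'n"
    have [measurable]: "{t \<in> {0..T}. x - t *\<^sub>R v \<in> S} \<in> sets borel" by measurable
    have "(\<integral>\<^sup>+t. G x * indicator S (x - t *\<^sub>R v) * indicator {0..T} t \<partial>lborel)
        = (\<integral>\<^sup>+t. G x * indicator {t \<in> {0..T}. x - t *\<^sub>R v \<in> S} t \<partial>lborel)"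
      by (intro nn_integral_cong) (auto simp: indicator_def)
    also have "\<dots> = G x * emeasure lborel {t \<in> {0..T}. x - t *\<^sub>R v \<in> S}"
      by (rule nn_integral_cmult_indicator) simp
    finally show "(\<integral>\<^sup>+t. G x * indicator S (x - t *\<^sub>R v) * indicator {0..T} t \<partial>lborel)
        = G x * emeasure lborel {t \<in> {0..T}. x - t *\<^sub>R v \<in> S}" .
  qed
  also have "\<dots> \<le> (\<integral>\<^sup>+x. G x * a \<partial>lborel)"
    by (intro nn_integral_mono mult_left_mono time) simp
  also have "\<dots> = a * (\<integral>\<^sup>+x\<in>P. ennreal \<bar>U' x v\<bar> * w x \<partial>lborel)"
  proof -
    have "(\<integral>\<^sup>+x. G x * a \<partial>lborel) = (\<integral>\<^sup>+x. G x \<partial>lborel) * a"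
      by (rule nn_integral_multc) simp
    then show ?thesis
      by (simp only: G_def mult.commute[of a])
  qed
  finally show ?thesis
    by (simp add: add_left_mono)
qed

section \<open>Sets on which the gradient controls a function\<close>

lemma riemannian_measureD:
  assumes "riemannian_measure M vol"
  shows "space vol = points M" "sets vol = sigma_sets (points M) {U. openin (mtop M) U}"
  using assms by (auto simp: riemannian_measure_def)

lemma openin_sets_vol: "riemannian_measure M vol \<Longrightarrow> openin (mtop M) U \<Longrightarrow> U \<in> sets vol"
  by (simp add: riemannian_measureD sigma_sets.Basic)

lemma continuous_map_measurable_vol:
  assumes vol: "riemannian_measure M vol" and g: "continuous_map (mtop M) euclidean g"
  shows "g \<in> borel_measurable vol"
proof (rule borel_measurableI)
  fix S :: "'c set" assume "open S"
  then have "openin (mtop M) {p \<in> points M. g p \<in> S}"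
    by (intro openin_continuous_map_preimage[OF g]) simp
  then have "{p \<in> points M. g p \<in> S} \<in> sets vol"
    by (rule openin_sets_vol[OF vol])
  moreover have "g -` S \<inter> space vol = {p \<in> points M. g p \<in> S}"
    using riemannian_measureD[OF vol] by auto
  ultimately show "g -` S \<inter> space vol \<in> sets vol" by simp
qed

lemma smooth_function_continuous_map:
  assumes M: "riemannian_manifold UNIV M" and u: "smooth_on_mfd M (points M) u"
  shows "continuous_map (mtop M) euclidean u"
  unfolding continuous_map_def
proof (intro conjI allI impI)
  fix S :: "real set" assume "openin euclidean S"
  then have S: "open S" by simp
  show "openin (mtop M) {p \<in> points M. u p \<in> S}"
  proof (subst openin_subopen, rule ballI)
    fix p assume p: "p \<in> {p \<in> points M. u p \<in> S}"
    then obtain c where c: "c \<in> atlas M" "p \<in> chart_dom c"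
      using chart_at_in[OF M] by blast
    have tc: "topological_chart UNIV (mtop M) c"
      by (rule riemannian_manifold_chart[OF M c(1)])
    have "continuous_on (chart_img c) (u \<circ> chart_inv c)"
      by (rule C1_on_continuous[OF test_function_C1_on[OF M adapted_chart_atlas[OF M c(1)] u]])
    then have o: "open (chart_img c \<inter> (u \<circ> chart_inv c) -` S)"
      by (rule continuous_open_preimage[OF _ chart_img_open[OF tc] S])
    let ?T = "chart_inv c ` (chart_img c \<inter> (u \<circ> chart_inv c) -` S)"
    have "openin (mtop M) ?T"
      by (rule chart_openin_inv[OF tc o]) simp
    moreover have "p \<in> ?T"
      using p c by (intro image_eqI[of _ _ "chart_map c p"]) (auto simp: chart_inv_map[OF tc])
    moreover have "?T \<subseteq> {p \<in> points M. u p \<in> S}"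
      using chart_inv_dom[OF tc] chart_dom_subset[OF tc] by auto
    ultimately show "\<exists>T. openin (mtop M) T \<and> p \<in> T \<and> T \<subseteq> {p \<in> points M. u p \<in> S}"
      by blast
  qed
qed simp

lemma test_functionD: "u \<in> test_functions M \<Longrightarrow> smooth_on_mfd M (points M) u"
  by (simp add: test_functions_def)

lemma smooth_function_measurable:
  assumes "riemannian_manifold UNIV M" "riemannian_measure M vol" "smooth_on_mfd M (points M) u"
  shows "u \<in> borel_measurable vol"
  using assms by (intro continuous_map_measurable_vol smooth_function_continuous_map)

lemma chart_map_measurable:
  fixes M :: "('a, 'n::finite) manifold" and c :: "('a, 'n) chart"
  assumes vol: "riemannian_measure M vol" and tc: "topological_chart UNIV (mtop M) c"
  shows "(\<lambda>p. if p \<in> chart_dom c then chart_map c p else 0) \<in> borel_measurable vol"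
proof (rule borel_measurableI)
  fix S :: "(real^'n) set" assume "open S"
  let ?f = "\<lambda>p. if p \<in> chart_dom c then chart_map c p else 0"
  have d: "chart_dom c \<in> sets vol"
    by (rule openin_sets_vol[OF vol chart_dom_open[OF tc]])
  have "openin (subtopology (mtop M) (chart_dom c)) {p \<in> topspace (subtopology (mtop M) (chart_dom c)). chart_map c p \<in> S}"
    using \<open>open S\<close> by (intro openin_continuous_map_preimage[OF chart_map_continuous[OF tc]]) simp
  then have "openin (mtop M) {p \<in> chart_dom c. chart_map c p \<in> S}"
    unfolding topspace_chart_dom[OF tc] using chart_dom_open[OF tc] openin_trans_full by blast
  then have "{p \<in> chart_dom c. chart_map c p \<in> S} \<in> sets vol"
    by (rule openin_sets_vol[OF vol])
  moreover have "?f -` S \<inter> space vol = {p \<in> chart_dom c. chart_map c p \<in> S} \<union> (if 0 \<in> S then space vol - chart_dom c else {})"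
    using chart_dom_subset[OF tc] riemannian_measureD(1)[OF vol] by (auto split: if_splits)
  ultimately show "?f -` S \<inter> space vol \<in> sets vol"
    using d by simp
qed

lemma chart_inv_image_sets:
  fixes M :: "('a, 'n::finite) manifold" and c :: "('a, 'n) chart"
  assumes vol: "riemannian_measure M vol" and tc: "topological_chart UNIV (mtop M) c"
    and S: "S \<in> sets borel" "S \<subseteq> chart_img c"
  shows "chart_inv c ` S \<in> sets vol"
proof -
  let ?f = "\<lambda>p. if p \<in> chart_dom c then chart_map c p else 0"
  have "?f -` S \<inter> space vol \<in> sets vol"
    using measurable_sets[OF chart_map_measurable[OF vol tc] S(1)] .
  moreover have "chart_dom c \<in> sets vol"
    by (rule openin_sets_vol[OF vol chart_dom_open[OF tc]])
  moreover have "chart_inv c ` S = (?f -` S \<inter> space vol) \<inter> chart_dom c"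
    unfolding chart_inv_image[OF tc S(2)]
    using chart_dom_subset[OF tc] riemannian_measureD(1)[OF vol] by auto
  ultimately show ?thesis by simp
qed

lemma L1_norm_chart:
  fixes M :: "('a, 'n::finite) manifold"
  assumes M: "riemannian_manifold UNIV M" and vol: "riemannian_measure M vol" and c: "adapted_chart M c"
    and u: "smooth_on_mfd M (points M) u" and S: "S \<in> sets borel" "S \<subseteq> chart_img c"
  shows "L1_norm vol (chart_inv c ` S) u = (\<integral>\<^sup>+z\<in>S. ennreal \<bar>(u \<circ> chart_inv c) z\<bar> * vol_density c z \<partial>lborel)"
proof -
  have tc: "topological_chart UNIV (mtop M) c"
    using c by (rule adapted_chart_topological)
  note [measurable] = smooth_function_measurable[OF M vol u] chart_inv_image_sets[OF vol tc S]
  have sub: "chart_inv c ` S \<subseteq> chart_dom c"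
    using chart_inv_dom[OF tc] S(2) by blast
  have "L1_norm vol (chart_inv c ` S) u
      = (\<integral>\<^sup>+p\<in>chart_dom c. ennreal \<bar>u p\<bar> * indicator (chart_inv c ` S) p \<partial>vol)"
    unfolding L1_norm_def using sub by (intro nn_integral_cong) (auto simp: indicator_def)
  also have "\<dots> = (\<integral>\<^sup>+z\<in>chart_img c. vol_density c z *
      (ennreal \<bar>u (chart_inv c z)\<bar> * indicator (chart_inv c ` S) (chart_inv c z)) \<partial>lborel)"
    by (rule nn_integral_adapted_chart[OF M vol c]) measurable
  also have "\<dots> = (\<integral>\<^sup>+z\<in>S. ennreal \<bar>(u \<circ> chart_inv c) z\<bar> * vol_density c z \<partial>lborel)"
  proof (rule nn_integral_cong)
    fix z
    have "chart_inv c z \<in> chart_inv c ` S \<longleftrightarrow> z \<in> S" if "z \<in> chart_img c"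
      using that chart_inv_image[OF tc S(2)] chart_map_inv[OF tc that] by auto
    then show "vol_density c z * (ennreal \<bar>u (chart_inv c z)\<bar> * indicator (chart_inv c ` S) (chart_inv c z))
        * indicator (chart_img c) z = ennreal \<bar>(u \<circ> chart_inv c) z\<bar> * vol_density c z * indicator S z"
      using S(2) by (auto simp: indicator_def mult.commute)
  qed
  finally show ?thesis .
qed

text \<open>The only property of the integral that is applied to the gradient norm is monotonicity. The constant
  is therefore moved to the integrand on the left, which is continuous in the chart.\<close>

lemma directional_derivative_integral_le:
  fixes M :: "('a, 'n::finite) manifold"
  assumes M: "riemannian_manifold UNIV M" and vol: "riemannian_measure M vol" and c: "adapted_chart M c"
    and u: "smooth_on_mfd M (points M) u" and P: "P \<in> sets borel" "P \<subseteq> chart_img c"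
    and k: "0 < k" "\<And>z. z \<in> P \<Longrightarrow> tangent_norm c (chart_inv c z) v \<le> k"
  shows "(\<integral>\<^sup>+z\<in>P. ennreal \<bar>frechet_derivative (u \<circ> chart_inv c) (at z) v\<bar> * vol_density c z \<partial>lborel)
    \<le> ennreal k * L1_norm vol (points M) (grad_norm M u)"
proof -
  have tc: "topological_chart UNIV (mtop M) c"
    using c by (rule adapted_chart_topological)
  let ?U = "\<lambda>z. frechet_derivative (u \<circ> chart_inv c) (at z) v"
  define f where "f z = ennreal (indicator P z *\<^sub>R (\<bar>?U z\<bar> / k))" for z
  have "continuous_on P (\<lambda>z. \<bar>?U z\<bar> / k)"
    using C1_on_subset[OF test_function_C1_on[OF M c u] P(2)] k(1)
    by (intro continuous_intros) (auto simp: C1_on_def)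
  then have f: "f \<in> borel_measurable borel"
    unfolding f_def using borel_measurable_continuous_on_indicator[OF P(1)] by measurable
  define g where "g p = f (if p \<in> chart_dom c then chart_map c p else 0)" for p
  have g [measurable]: "g \<in> borel_measurable vol"
    unfolding g_def by (rule measurable_compose[OF chart_map_measurable[OF vol tc] f])
  note [measurable] = openin_sets_vol[OF vol chart_dom_open[OF tc]]
  have "(\<integral>\<^sup>+z\<in>P. ennreal \<bar>?U z\<bar> * vol_density c z \<partial>lborel)
      = (\<integral>\<^sup>+z\<in>chart_img c. vol_density c z * (ennreal k * g (chart_inv c z)) \<partial>lborel)"
  proof (rule nn_integral_cong)
    fix z
    show "ennreal \<bar>?U z\<bar> * vol_density c z * indicator P z
        = vol_density c z * (ennreal k * g (chart_inv c z)) * indicator (chart_img c) z"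
    proof (cases "z \<in> P")
      case True
      then have zi: "z \<in> chart_img c" using P(2) by blast
      have "ennreal k * g (chart_inv c z) = ennreal k * ennreal (\<bar>?U z\<bar> / k)"
        using chart_inv_dom[OF tc zi] chart_map_inv[OF tc zi] True by (simp add: g_def f_def)
      also have "\<dots> = ennreal \<bar>?U z\<bar>"
        using k(1) by (subst ennreal_mult[symmetric]) auto
      finally show ?thesis
        using True zi by (simp add: mult.commute)
    next
      case False
      then show ?thesis
        using chart_inv_dom[OF tc] chart_map_inv[OF tc] by (auto simp: g_def f_def indicator_def)
    qed
  qed
  also have "\<dots> = (\<integral>\<^sup>+p\<in>chart_dom c. ennreal k * g p \<partial>vol)"
    by (rule nn_integral_adapted_chart[OF M vol c, symmetric]) measurable
  also have "\<dots> = ennreal k * (\<integral>\<^sup>+p\<in>chart_dom c. g p \<partial>vol)"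
    by (subst nn_integral_cmult[symmetric]) (auto simp: mult.assoc)
  also have "\<dots> \<le> ennreal k * L1_norm vol (points M) (grad_norm M u)"
    unfolding L1_norm_def
  proof (intro mult_left_mono nn_integral_mono)
    fix p
    show "g p * indicator (chart_dom c) p \<le> ennreal \<bar>grad_norm M u p\<bar> * indicator (points M) p"
    proof (cases "p \<in> chart_dom c \<and> chart_map c p \<in> P")
      case True
      then have p: "p \<in> chart_dom c" "chart_map c p \<in> P" by auto
      have inv: "chart_inv c (chart_map c p) = p" by (rule chart_inv_map[OF tc p(1)])
      have "\<bar>?U (chart_map c p)\<bar> \<le> tangent_norm c p v * grad_norm M u p"
        using directional_derivative_le_grad_norm[OF M c u, of "chart_map c p" v] p inv by simp
      also have "\<dots> \<le> k * \<bar>grad_norm M u p\<bar>"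
      proof -
        have d: "chart_at M p \<in> atlas M" "p \<in> chart_dom (chart_at M p)"
          using chart_at_in[OF M] p(1) chart_dom_subset[OF tc] by blast+
        obtain J where "tangent_norm c p v = tangent_norm (chart_at M p) p (J v)"
          by (rule transition_derivative[OF M c d(1) p(1) d(2)]) blast
        then have "0 \<le> tangent_norm c p v"
          using tangent_norm_nonneg[OF riemannian_manifold_chart(2)[OF M d(1)] d(2)] by simp
        then have "tangent_norm c p v * grad_norm M u p \<le> tangent_norm c p v * \<bar>grad_norm M u p\<bar>"
          by (intro mult_left_mono) auto
        also have "\<dots> \<le> k * \<bar>grad_norm M u p\<bar>"
          using k(2)[OF p(2)] inv by (intro mult_right_mono) auto
        finally show ?thesis .
      qed
      finally have "\<bar>?U (chart_map c p)\<bar> / k \<le> \<bar>grad_norm M u p\<bar>"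
        using k(1) by (simp add: field_simps)
      then have "g p \<le> ennreal \<bar>grad_norm M u p\<bar>"
        using p by (simp add: g_def f_def ennreal_leI)
      then show ?thesis
        using p chart_dom_subset[OF tc] by (auto simp: indicator_def)
    next
      case False
      then show ?thesis by (auto simp: g_def f_def indicator_def)
    qed
  qed simp
  finally show ?thesis .
qed

definition gradient_controlled :: "('a, 'n::finite) manifold \<Rightarrow> 'a measure \<Rightarrow> 'a set \<Rightarrow> bool" where
  "gradient_controlled M vol W \<longleftrightarrow>
     (\<exists>C::real. \<forall>u\<in>test_functions M.
        L1_norm vol W u \<le> ennreal C * L1_norm vol (points M) (grad_norm M u))"

lemma L1_norm_mono: "V \<subseteq> W \<Longrightarrow> L1_norm vol V u \<le> L1_norm vol W u"
  unfolding L1_norm_def by (intro nn_integral_mono) (auto simp: indicator_def)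

lemma gradient_controlled_subset:
  assumes "gradient_controlled M vol W" "V \<subseteq> W"
  shows "gradient_controlled M vol V"
  using assms L1_norm_mono[OF assms(2)] unfolding gradient_controlled_def by (meson order_trans)

lemma L1_norm_Un_le:
  assumes "u \<in> borel_measurable vol" "V \<in> sets vol" "W \<in> sets vol"
  shows "L1_norm vol (V \<union> W) u \<le> L1_norm vol V u + L1_norm vol W u"
proof -
  note [measurable] = assms
  have "L1_norm vol (V \<union> W) u \<le> (\<integral>\<^sup>+p. ennreal \<bar>u p\<bar> * indicator V p + ennreal \<bar>u p\<bar> * indicator W p \<partial>vol)"
    unfolding L1_norm_def by (intro nn_integral_mono) (auto simp: indicator_def)
  also have "\<dots> = L1_norm vol V u + L1_norm vol W u"
    unfolding L1_norm_def by (intro nn_integral_add) auto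
  finally show ?thesis .
qed

lemma gradient_controlled_Union:
  assumes M: "riemannian_manifold UNIV M" and vol: "riemannian_measure M vol"
    and "finite \<W>" "\<And>W. W \<in> \<W> \<Longrightarrow> W \<in> sets vol \<and> gradient_controlled M vol W"
  shows "gradient_controlled M vol (\<Union>\<W>)"
  using assms(3,4)
proof (induction \<W>)
  case empty
  show ?case
    by (auto simp: gradient_controlled_def L1_norm_def intro!: exI[of _ 0])
next
  case (insert W \<W>)
  obtain C where C: "\<And>u. u \<in> test_functions M \<Longrightarrow> L1_norm vol W u \<le> ennreal C * L1_norm vol (points M) (grad_norm M u)"
    using insert.prems unfolding gradient_controlled_def by (metis insertI1)
  obtain D where D: "\<And>u. u \<in> test_functions M \<Longrightarrow> L1_norm vol (\<Union>\<W>) u \<le> ennreal D * L1_norm vol (points M) (grad_norm M u)"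
    using insert.IH insert.prems unfolding gradient_controlled_def by (metis insertI2)
  have sets: "W \<in> sets vol" "\<Union>\<W> \<in> sets vol"
    using insert.prems insert.hyps(1) by (auto intro: sets.finite_Union)
  have "L1_norm vol (\<Union>(insert W \<W>)) u \<le> ennreal (max 0 C + max 0 D) * L1_norm vol (points M) (grad_norm M u)"
    if u: "u \<in> test_functions M" for u
  proof -
    have "L1_norm vol (\<Union>(insert W \<W>)) u \<le> L1_norm vol W u + L1_norm vol (\<Union>\<W>) u"
      using L1_norm_Un_le[OF smooth_function_measurable[OF M vol test_functionD[OF u]] sets] by simp
    also have "\<dots> \<le> ennreal C * L1_norm vol (points M) (grad_norm M u)
        + ennreal D * L1_norm vol (points M) (grad_norm M u)"
      by (intro add_mono C D u)
    also have "\<dots> = ennreal (max 0 C + max 0 D) * L1_norm vol (points M) (grad_norm M u)"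
      by (simp add: distrib_right ennreal_max_0)
    finally show ?thesis .
  qed
  then show ?case
    unfolding gradient_controlled_def by blast
qed

lemma chart_ball_density_bounds:
  fixes M :: "('a, 'n::finite) manifold"
  assumes M: "riemannian_manifold UNIV M" and c: "c \<in> atlas M" and r: "0 < r" "cball x r \<subseteq> chart_img c"
  obtains m m' :: real where "0 < m" "0 < m'" "\<And>z. z \<in> cball x r \<Longrightarrow> ennreal m \<le> vol_density c z"
    "\<And>z. z \<in> cball x r \<Longrightarrow> vol_density c z \<le> ennreal m'"
proof -
  have tc: "topological_chart UNIV (mtop M) c" and sc: "smooth_metric UNIV c"
    using riemannian_manifold_chart[OF M c] by auto
  define f where "f z = sqrt (det (chart_gram c (chart_inv c z)))" for z
  have "continuous_on (chart_img c) f"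
    unfolding f_def by (intro continuous_intros continuous_on_det gram_continuous[OF sc])
  then have cf: "continuous_on (cball x r) f"
    using r(2) by (rule continuous_on_subset)
  have pos: "0 < f z" if "z \<in> cball x r" for z
  proof -
    have "chart_inv c z \<in> chart_dom c" using that r(2) chart_inv_dom[OF tc] by blast
    then show ?thesis
      using det_pos_of_pos_definite[OF gram_pos[OF sc]] by (simp add: f_def)
  qed
  have ne: "cball x r \<noteq> {}" using r(1) by simp
  obtain a where a: "a \<in> cball x r" "\<And>z. z \<in> cball x r \<Longrightarrow> f a \<le> f z"
    using continuous_attains_inf[OF compact_cball ne cf] by blast
  obtain b where b: "b \<in> cball x r" "\<And>z. z \<in> cball x r \<Longrightarrow> f z \<le> f b"
    using continuous_attains_sup[OF compact_cball ne cf] by blast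
  show ?thesis
    by (rule that[OF pos[OF a(1)] pos[OF b(1)]])
       (use a(2) b(2) in \<open>auto simp: f_def[symmetric] intro: ennreal_leI\<close>)
qed

text \<open>In the compact ball the volume density lies between two positive constants, so the translation bound
  for Lebesgue measure carries over to the Riemannian measure.\<close>

lemma gradient_controlled_translate:
  fixes M :: "('a, 'n::finite) manifold"
  assumes M: "riemannian_manifold UNIV M" and vol: "riemannian_measure M vol" and c: "c \<in> atlas M"
    and r: "0 < r" "cball x0 r \<subseteq> chart_img c" and B: "0 < B"
    and up: "\<And>z v. z \<in> cball x0 r \<Longrightarrow> tangent_norm c (chart_inv c z) v \<le> B * norm v"
    and xy: "ball x s \<subseteq> ball x0 r" "ball y s \<subseteq> ball x0 r"
    and good: "gradient_controlled M vol (chart_inv c ` ball y s)"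
  shows "gradient_controlled M vol (chart_inv c ` ball x s)"
proof -
  have a: "adapted_chart M c" by (rule adapted_chart_atlas[OF M c])
  obtain m m' where m: "0 < m" "0 < m'" "\<And>z. z \<in> cball x0 r \<Longrightarrow> ennreal m \<le> vol_density c z"
    "\<And>z. z \<in> cball x0 r \<Longrightarrow> vol_density c z \<le> ennreal m'"
    by (rule chart_ball_density_bounds[OF M c r]) blast
  obtain C where C: "\<And>u. u \<in> test_functions M \<Longrightarrow>
      L1_norm vol (chart_inv c ` ball y s) u \<le> ennreal C * L1_norm vol (points M) (grad_norm M u)"
    using good unfolding gradient_controlled_def by blast
  define v where "v = y - x"
  \<comment> \<open>a bound for the Riemannian length of \<open>v\<close>, positive also if \<open>v = 0\<close>\<close>
  define k where "k = B * norm v + 1"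
  have k: "0 < k" using B by (simp add: k_def add_nonneg_pos)
  have b: "ball x0 r \<subseteq> cball x0 r" by auto
  have bi: "ball x0 r \<subseteq> chart_img c" using b r(2) by blast
  have "L1_norm vol (chart_inv c ` ball x s) u
      \<le> ennreal (m' / m * (max 0 C + k)) * L1_norm vol (points M) (grad_norm M u)"
    if u: "u \<in> test_functions M" for u
  proof -
    let ?U = "u \<circ> chart_inv c"
    let ?U' = "\<lambda>z. frechet_derivative ?U (at z)"
    let ?g = "L1_norm vol (points M) (grad_norm M u)"
    note us = test_functionD[OF u]
    have U: "C1_on (ball x0 r) ?U ?U'"
      by (rule C1_on_subset[OF test_function_C1_on[OF M a us] bi])
    have lower: "ennreal m * (\<integral>\<^sup>+z\<in>S. h z \<partial>lborel) \<le> (\<integral>\<^sup>+z\<in>S. h z * vol_density c z \<partial>lborel)"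
      if S: "S \<subseteq> ball x0 r" and h: "(\<lambda>z. h z * indicator S z) \<in> borel_measurable borel" for S and h :: "real^'n \<Rightarrow> ennreal"
    proof -
      have "ennreal m * (\<integral>\<^sup>+z\<in>S. h z \<partial>lborel) = (\<integral>\<^sup>+z. ennreal m * (h z * indicator S z) \<partial>lborel)"
        by (rule nn_integral_cmult[symmetric]) (use h in simp)
      also have "\<dots> \<le> (\<integral>\<^sup>+z\<in>S. h z * vol_density c z \<partial>lborel)"
      proof (rule nn_integral_mono)
        fix z show "ennreal m * (h z * indicator S z) \<le> h z * vol_density c z * indicator S z"
        proof (cases "z \<in> S")
          case True
          then have "ennreal m \<le> vol_density c z" using S m(3) b by blast
          from mult_left_mono[OF this, of "h z"] show ?thesis
            using True by (simp add: mult.commute)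
        qed simp
      qed
      finally show ?thesis .
    qed
    have Um: "(\<lambda>z. ennreal \<bar>?U z\<bar> * indicator S z) \<in> borel_measurable borel"
      if "S \<in> sets borel" "S \<subseteq> ball x0 r" for S
    proof -
      have "continuous_on S (\<lambda>z. \<bar>?U z\<bar>)"
        using C1_on_continuous[OF C1_on_subset[OF U that(2)]] by (intro continuous_intros)
      from borel_measurable_continuous_on_indicator[OF that(1) this]
      have "(\<lambda>z. ennreal (indicator S z *\<^sub>R \<bar>?U z\<bar>)) \<in> borel_measurable borel" by measurable
      moreover have "(\<lambda>z. ennreal (indicator S z *\<^sub>R \<bar>?U z\<bar>)) = (\<lambda>z. ennreal \<bar>?U z\<bar> * indicator S z)"
        by (auto simp: fun_eq_iff indicator_def)
      ultimately show ?thesis by (simp only:)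
    qed
    have Um': "(\<lambda>z. ennreal \<bar>?U' z v\<bar> * indicator (ball x0 r) z) \<in> borel_measurable borel"
    proof -
      have "continuous_on (ball x0 r) (\<lambda>z. \<bar>?U' z v\<bar>)"
        using U by (intro continuous_intros) (simp add: C1_on_def)
      from borel_measurable_continuous_on_indicator[OF _ this]
      have "(\<lambda>z. ennreal (indicator (ball x0 r) z *\<^sub>R \<bar>?U' z v\<bar>)) \<in> borel_measurable borel" by measurable
      moreover have "(\<lambda>z. ennreal (indicator (ball x0 r) z *\<^sub>R \<bar>?U' z v\<bar>)) = (\<lambda>z. ennreal \<bar>?U' z v\<bar> * indicator (ball x0 r) z)"
        by (auto simp: fun_eq_iff indicator_def)
      ultimately show ?thesis by (simp only:)
    qed
    have trans: "(\<integral>\<^sup>+z\<in>ball x s. ennreal \<bar>?U z\<bar> * 1 \<partial>lborel)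
        \<le> (\<integral>\<^sup>+z\<in>{z. z - 1 *\<^sub>R v \<in> ball x s}. ennreal \<bar>?U z\<bar> * 1 \<partial>lborel)
          + 1 * (\<integral>\<^sup>+z\<in>ball x0 r. ennreal \<bar>?U' z v\<bar> * 1 \<partial>lborel)"
    proof (rule nn_integral_translate_bound[OF U])
      fix z :: "real^'n" and t :: real assume z: "z \<in> ball x s" and t: "t \<in> {0..1}"
      have "z + v \<in> ball y s"
        using z by (simp add: v_def dist_norm algebra_simps)
      then have "z \<in> ball x0 r" "z + v \<in> ball x0 r" using z xy by auto
      then have "(1 - t) *\<^sub>R z + t *\<^sub>R (z + v) \<in> ball x0 r"
        using t convexD[OF convex_ball[of x0 r], of z "z + v" "1 - t" t] by simp
      then show "z + t *\<^sub>R v \<in> ball x0 r"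
        by (simp add: algebra_simps)
    next
      fix z :: "real^'n"
      have "emeasure lborel {t \<in> {0..1}. z - t *\<^sub>R v \<in> ball x s} \<le> emeasure lborel {0..1::real}"
        by (intro emeasure_mono) auto
      then show "emeasure lborel {t \<in> {0..1}. z - t *\<^sub>R v \<in> ball x s} \<le> 1" by simp
    qed (simp_all add: borel_measurable_indicator)
    have ys: "{z. z - 1 *\<^sub>R v \<in> ball x s} = ball y s"
      by (auto simp: v_def dist_norm algebra_simps)
    let ?Iy = "\<integral>\<^sup>+z\<in>ball y s. ennreal \<bar>?U z\<bar> \<partial>lborel"
    let ?Id = "\<integral>\<^sup>+z\<in>ball x0 r. ennreal \<bar>?U' z v\<bar> \<partial>lborel"
    have "L1_norm vol (chart_inv c ` ball x s) u = (\<integral>\<^sup>+z\<in>ball x s. ennreal \<bar>?U z\<bar> * vol_density c z \<partial>lborel)"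
      using xy bi by (intro L1_norm_chart[OF M vol a us]) auto
    also have "\<dots> \<le> (\<integral>\<^sup>+z. ennreal m' * (ennreal \<bar>?U z\<bar> * indicator (ball x s) z) \<partial>lborel)"
    proof (rule nn_integral_mono)
      fix z show "ennreal \<bar>?U z\<bar> * vol_density c z * indicator (ball x s) z
          \<le> ennreal m' * (ennreal \<bar>?U z\<bar> * indicator (ball x s) z)"
      proof (cases "z \<in> ball x s")
        case True
        then have "vol_density c z \<le> ennreal m'" using xy(1) m(4) b by blast
        from mult_left_mono[OF this, of "ennreal \<bar>?U z\<bar>"] show ?thesis
          using True by (simp add: mult.commute)
      qed simp
    qed
    also have "\<dots> = ennreal m' * (\<integral>\<^sup>+z\<in>ball x s. ennreal \<bar>?U z\<bar> \<partial>lborel)"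
      by (rule nn_integral_cmult) (use Um[OF _ xy(1)] in simp)
    also have "\<dots> \<le> ennreal m' * (?Iy + ?Id)"
      using trans unfolding ys by (intro mult_left_mono) simp_all
    also have "\<dots> = ennreal (m' / m) * (ennreal m * ?Iy + ennreal m * ?Id)"
    proof -
      have "ennreal m' = ennreal (m' / m) * ennreal m"
        using m by (subst ennreal_mult[symmetric]) auto
      then show ?thesis by (simp add: distrib_left mult.assoc)
    qed
    also have "\<dots> \<le> ennreal (m' / m) * (ennreal C * ?g + ennreal k * ?g)"
    proof (intro mult_left_mono add_mono)
      have "ennreal m * ?Iy \<le> L1_norm vol (chart_inv c ` ball y s) u"
        using lower[OF xy(2) Um[OF _ xy(2)]] xy bi by (subst L1_norm_chart[OF M vol a us]) auto
      also have "\<dots> \<le> ennreal C * ?g" by (rule C[OF u])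
      finally show "ennreal m * ?Iy \<le> ennreal C * ?g" .
      have "ennreal m * ?Id \<le> (\<integral>\<^sup>+z\<in>ball x0 r. ennreal \<bar>?U' z v\<bar> * vol_density c z \<partial>lborel)"
        by (rule lower[OF order_refl Um'])
      also have "\<dots> \<le> ennreal k * ?g"
      proof (rule directional_derivative_integral_le[OF M vol a us _ bi k])
        show "tangent_norm c (chart_inv c z) v \<le> k" if "z \<in> ball x0 r" for z
          using up[of z v] that b by (auto simp: k_def intro: order_trans)
      qed simp
      finally show "ennreal m * ?Id \<le> ennreal k * ?g" .
    qed simp
    also have "\<dots> = ennreal (m' / m * (max 0 C + k)) * ?g"
    proof -
      have "ennreal (m' / m * (max 0 C + k)) = ennreal (m' / m) * ennreal (max 0 C + k)"
        using m k by (intro ennreal_mult) auto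
      also have "ennreal (max 0 C + k) = ennreal C + ennreal k"
        using k by (simp add: ennreal_plus ennreal_max_0)
      finally show ?thesis
        by (simp only: distrib_right mult.assoc)
    qed
    finally show ?thesis .
  qed
  then show ?thesis
    unfolding gradient_controlled_def by blast
qed

text \<open>The points with a controlled neighbourhood form an open set. It is closed: if it comes near to \<open>z\<close>, then a
  small ball around one of its points can be translated to \<open>z\<close> within a chart ball.\<close>

lemma gradient_controlled_nhd:
  fixes M :: "('a, 'n::finite) manifold"
  assumes M: "riemannian_manifold UNIV M" and conn: "connected_space (mtop M)" and vol: "riemannian_measure M vol"
    and W0: "openin (mtop M) W0" "W0 \<noteq> {}" "gradient_controlled M vol W0" and p: "p \<in> points M"
  shows "\<exists>W. openin (mtop M) W \<and> p \<in> W \<and> gradient_controlled M vol W"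
proof -
  define Z where "Z = \<Union>{W. openin (mtop M) W \<and> gradient_controlled M vol W}"
  have Zo: "openin (mtop M) Z"
    unfolding Z_def by (rule openin_Union) auto
  have ZM: "Z \<subseteq> points M" using Zo by (rule openin_subset)
  have "openin (mtop M) (points M - Z)"
  proof (subst openin_subopen, rule ballI)
    fix z assume z: "z \<in> points M - Z"
    then have zM: "z \<in> points M" by simp
    obtain c r l B where c: "c \<in> atlas M" "z \<in> chart_dom c" and r: "0 < r" "cball (chart_map c z) r \<subseteq> chart_img c"
      and B: "0 < B" and up: "\<And>x v. x \<in> cball (chart_map c z) r \<Longrightarrow> tangent_norm c (chart_inv c x) v \<le> B * norm v"
      by (rule chart_ball_bounds[OF M zM]) blast
    have tc: "topological_chart UNIV (mtop M) c"
      by (rule riemannian_manifold_chart[OF M c(1)])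
    let ?x = "chart_map c z"
    have bi: "ball ?x r \<subseteq> chart_img c" using r(2) by auto
    let ?T = "chart_inv c ` ball ?x (r / 2)"
    have Ti: "ball ?x (r / 2) \<subseteq> chart_img c" using bi r(1) by auto
    have "q \<notin> Z" if q: "q \<in> ?T" for q
    proof
      assume "q \<in> Z"
      then obtain W where W: "openin (mtop M) W" "q \<in> W" "gradient_controlled M vol W"
        by (auto simp: Z_def)
      let ?y = "chart_map c q"
      have qd: "q \<in> chart_dom c" "?y \<in> ball ?x (r / 2)"
        using q unfolding chart_inv_image[OF tc Ti] by auto
      have "open (chart_map c ` (W \<inter> chart_dom c))"
        by (rule chart_open_image[OF tc]) (auto intro: W chart_dom_open[OF tc])
      moreover have "?y \<in> chart_map c ` (W \<inter> chart_dom c)" using W qd by blast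
      ultimately obtain e where e: "0 < e" "ball ?y e \<subseteq> chart_map c ` (W \<inter> chart_dom c)"
        by (rule openE)
      \<comment> \<open>\<open>s \<le> r / 2\<close> keeps the ball around \<open>?y\<close>, whose centre is within \<open>r / 2\<close> of \<open>?x\<close>, in the chart ball\<close>
      define s where "s = min e (r / 2)"
      have s: "0 < s" "s \<le> e" "s \<le> r / 2" using e r by (auto simp: s_def)
      have ys: "ball ?y s \<subseteq> ball ?x r"
      proof
        fix w assume "w \<in> ball ?y s"
        then show "w \<in> ball ?x r"
          using qd(2) s(3) dist_triangle[of ?x w ?y] by (simp add: dist_commute)
      qed
      have xs: "ball ?x s \<subseteq> ball ?x r" using s r by auto
      have "chart_inv c ` ball ?y s \<subseteq> W"
      proof
        fix w assume "w \<in> chart_inv c ` ball ?y s"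
        then obtain b where b: "b \<in> ball ?y s" "w = chart_inv c b" by blast
        then have "b \<in> chart_map c ` (W \<inter> chart_dom c)" using e(2) s(2) by auto
        then show "w \<in> W" using b chart_inv_map[OF tc] by auto
      qed
      then have "gradient_controlled M vol (chart_inv c ` ball ?y s)"
        by (rule gradient_controlled_subset[OF W(3)])
      then have "gradient_controlled M vol (chart_inv c ` ball ?x s)"
        using up by (rule gradient_controlled_translate[OF M vol c(1) r B _ xs ys, rotated])
      moreover have "openin (mtop M) (chart_inv c ` ball ?x s)"
        using xs bi by (intro chart_openin_inv[OF tc]) auto
      moreover have "z \<in> chart_inv c ` ball ?x s"
        using s(1) chart_inv_map[OF tc c(2)] by (metis centre_in_ball imageI)
      ultimately have "z \<in> Z" by (auto simp: Z_def)
      with z show False by simp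
    qed
    moreover have "openin (mtop M) ?T" by (rule chart_openin_inv[OF tc _ Ti]) simp
    moreover have "z \<in> ?T"
      using r(1) chart_inv_map[OF tc c(2)] by (metis centre_in_ball half_gt_zero imageI)
    ultimately show "\<exists>T. openin (mtop M) T \<and> z \<in> T \<and> T \<subseteq> points M - Z"
      using openin_subset[of "mtop M" ?T] by blast
  qed
  with Zo ZM have "Z = {} \<or> Z = points M"
    using conn unfolding connected_space_clopen_in closedin_def by blast
  moreover have "W0 \<subseteq> Z" using W0 by (auto simp: Z_def)
  ultimately have "p \<in> Z" using W0(2) p by blast
  then show ?thesis by (auto simp: Z_def)
qed

lemma gradient_controlled_compact:
  fixes M :: "('a, 'n::finite) manifold"
  assumes M: "riemannian_manifold UNIV M" and conn: "connected_space (mtop M)" and vol: "riemannian_measure M vol"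
    and W0: "openin (mtop M) W0" "W0 \<noteq> {}" "gradient_controlled M vol W0" and Q: "compactin (mtop M) Q"
  shows "gradient_controlled M vol Q"
proof -
  let ?\<U> = "{W. openin (mtop M) W \<and> gradient_controlled M vol W}"
  have "\<exists>\<F>. finite \<F> \<and> \<F> \<subseteq> ?\<U> \<and> Q \<subseteq> \<Union>\<F>"
  proof (rule compactinD[OF Q])
    show "Q \<subseteq> \<Union>?\<U>"
      using gradient_controlled_nhd[OF M conn vol W0] compactin_subset_topspace[OF Q] by blast
  qed auto
  then obtain \<F> where F: "finite \<F>" "\<F> \<subseteq> ?\<U>" "Q \<subseteq> \<Union>\<F>" by blast
  have "gradient_controlled M vol (\<Union>\<F>)"
    using F openin_sets_vol[OF vol] by (intro gradient_controlled_Union[OF M vol]) auto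
  then show ?thesis using F(3) by (rule gradient_controlled_subset)
qed

text \<open>The support is compact, and every point has a neighbourhood on which the function is integrable.\<close>

lemma test_function_integrable:
  fixes M :: "('a, 'n::finite) manifold"
  assumes M: "riemannian_manifold UNIV M" and vol: "riemannian_measure M vol" and u: "u \<in> test_functions M"
  shows "L1_norm vol (points M) u < \<infinity>"
proof -
  note us = test_functionD[OF u]
  define Q where "Q = mtop M closure_of {p \<in> points M. u p \<noteq> 0}"
  have Q: "compactin (mtop M) Q"
    using u by (simp add: test_functions_def Q_def)
  let ?\<U> = "{W. openin (mtop M) W \<and> L1_norm vol W u < \<infinity>}"
  have nhd: "\<exists>W. W \<in> ?\<U> \<and> p \<in> W" if p: "p \<in> points M" for p
  proof -
    obtain c where c: "c \<in> atlas M" "p \<in> chart_dom c"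
      using chart_at_in[OF M p] by blast
    have tc: "topological_chart UNIV (mtop M) c"
      by (rule riemannian_manifold_chart[OF M c(1)])
    have a: "adapted_chart M c" by (rule adapted_chart_atlas[OF M c(1)])
    let ?x = "chart_map c p"
    obtain r where r: "0 < r" "cball ?x r \<subseteq> chart_img c"
      using chart_img_open[OF tc] c(2) open_contains_cball by blast
    have b: "ball ?x r \<subseteq> cball ?x r" by auto
    obtain m m' where m: "0 < m'" "\<And>z. z \<in> cball ?x r \<Longrightarrow> vol_density c z \<le> ennreal m'"
      by (rule chart_ball_density_bounds[OF M c(1) r]) blast
    have "continuous_on (cball ?x r) (\<lambda>z. \<bar>(u \<circ> chart_inv c) z\<bar>)"
      by (intro continuous_intros C1_on_continuous[OF C1_on_subset[OF test_function_C1_on[OF M a us] r(2)]])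
    then obtain y where y: "y \<in> cball ?x r"
        "\<And>z. z \<in> cball ?x r \<Longrightarrow> \<bar>(u \<circ> chart_inv c) z\<bar> \<le> \<bar>(u \<circ> chart_inv c) y\<bar>"
      using continuous_attains_sup[OF compact_cball, of ?x r "\<lambda>z. \<bar>(u \<circ> chart_inv c) z\<bar>"] r(1) by auto
    let ?W = "chart_inv c ` ball ?x r"
    have "L1_norm vol ?W u = (\<integral>\<^sup>+z\<in>ball ?x r. ennreal \<bar>(u \<circ> chart_inv c) z\<bar> * vol_density c z \<partial>lborel)"
      using b r(2) by (intro L1_norm_chart[OF M vol a us]) auto
    also have "\<dots> \<le> (\<integral>\<^sup>+z. ennreal \<bar>(u \<circ> chart_inv c) y\<bar> * ennreal m' * indicator (ball ?x r) z \<partial>lborel)"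
    proof (rule nn_integral_mono)
      fix z show "ennreal \<bar>(u \<circ> chart_inv c) z\<bar> * vol_density c z * indicator (ball ?x r) z
          \<le> ennreal \<bar>(u \<circ> chart_inv c) y\<bar> * ennreal m' * indicator (ball ?x r) z"
      proof (cases "z \<in> ball ?x r")
        case True
        then show ?thesis
          using y(2)[of z] m(2)[of z] b by (auto intro!: mult_mono ennreal_leI)
      qed simp
    qed
    also have "\<dots> = ennreal \<bar>(u \<circ> chart_inv c) y\<bar> * ennreal m' * emeasure lborel (ball ?x r)"
      by (rule nn_integral_cmult_indicator) simp
    also have "\<dots> < \<infinity>"
      using emeasure_lborel_ball_finite[of ?x r] by (simp add: ennreal_mult_less_top)
    finally have "L1_norm vol ?W u < \<infinity>" .
    moreover have "openin (mtop M) ?W" using b r(2) by (intro chart_openin_inv[OF tc]) auto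
    moreover have "p \<in> ?W"
      using r(1) chart_inv_map[OF tc c(2)] by (metis centre_in_ball imageI)
    ultimately show ?thesis by blast
  qed
  have "\<exists>\<F>. finite \<F> \<and> \<F> \<subseteq> ?\<U> \<and> Q \<subseteq> \<Union>\<F>"
  proof (rule compactinD[OF Q])
    show "Q \<subseteq> \<Union>?\<U>"
      using nhd compactin_subset_topspace[OF Q] by blast
  qed auto
  then obtain \<F> where F: "finite \<F>" "\<F> \<subseteq> ?\<U>" "Q \<subseteq> \<Union>\<F>" by blast
  have "\<Union>\<F> \<in> sets vol \<and> L1_norm vol (\<Union>\<F>) u < \<infinity>"
    using F(1,2)
  proof (induction \<F>)
    case empty
    then show ?case by (simp add: L1_norm_def)
  next
    case (insert W \<F>)
    then have W: "W \<in> sets vol" "L1_norm vol W u < \<infinity>" and IH: "\<Union>\<F> \<in> sets vol" "L1_norm vol (\<Union>\<F>) u < \<infinity>"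
      using openin_sets_vol[OF vol] by auto
    have "L1_norm vol (W \<union> \<Union>\<F>) u \<le> L1_norm vol W u + L1_norm vol (\<Union>\<F>) u"
      by (rule L1_norm_Un_le[OF smooth_function_measurable[OF M vol us] W(1) IH(1)])
    also have "\<dots> < \<infinity>" using W IH by simp
    finally show ?case using W IH by auto
  qed
  moreover have "L1_norm vol (points M) u \<le> L1_norm vol (\<Union>\<F>) u"
    unfolding L1_norm_def
  proof (rule nn_integral_mono)
    fix p
    have "p \<in> \<Union>\<F>" if "p \<in> points M" "u p \<noteq> 0"
      using that F(3) closure_of_subset[of "{p \<in> points M. u p \<noteq> 0}" "mtop M"] by (auto simp: Q_def)
    then show "ennreal \<bar>u p\<bar> * indicator (points M) p \<le> ennreal \<bar>u p\<bar> * indicator (\<Union>\<F>) p"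
      by (cases "u p = 0") (auto simp: indicator_def)
  qed
  ultimately show ?thesis by (auto intro: le_less_trans)
qed

section \<open>Half-spaces in an end\<close>

text \<open>A summable sequence comes arbitrarily close to \<open>0\<close>.\<close>

lemma ennreal_le_of_summable_slack:
  fixes b :: "nat \<Rightarrow> ennreal"
  assumes le: "\<And>k. I \<le> b k + X" and fin: "(\<Sum>k. b k) < \<infinity>"
  shows "I \<le> X"
proof (rule ccontr)
  assume "\<not> I \<le> X"
  then have XI: "X < I" by simp
  define \<delta> where "\<delta> = I - X"
  have \<delta>: "0 < \<delta>" using XI by (simp add: \<delta>_def diff_gt_0_iff_gt_ennreal)
  have \<delta>b: "\<delta> \<le> b k" for k
    unfolding \<delta>_def using le[of k] XI by (auto simp: ennreal_minus_le_iff add.commute)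
  have sums: "of_nat m * \<delta> \<le> (\<Sum>k. b k)" for m
  proof -
    have "of_nat m * \<delta> = (\<Sum>k<m. \<delta>)" by simp
    also have "\<dots> \<le> (\<Sum>k<m. b k)" by (intro sum_mono \<delta>b)
    also have "\<dots> \<le> (\<Sum>k. b k)" by (rule sum_le_suminf) auto
    finally show ?thesis .
  qed
  obtain e where e: "(\<Sum>k. b k) = ennreal e" "0 \<le> e"
    using fin by (cases "\<Sum>k. b k") auto
  have "\<delta> < top" using sums[of 1] fin by (auto intro: le_less_trans)
  then obtain d where d: "\<delta> = ennreal d" "0 \<le> d"
    by (cases \<delta>) auto
  have d0: "0 < d" using \<delta> d by simp
  obtain m where "e < real m * d"
    using reals_Archimedean3[OF d0] by blast
  moreover have "real m * d \<le> e"
    using sums[of m] e d by (simp add: ennreal_of_nat_eq_real_of_nat flip: ennreal_mult)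
  ultimately show False by simp
qed

text \<open>A ball in \<open>H\<close> can be pushed to infinity along the direction \<open>j\<close>, through a region whose volume density is
  invariant under the translations. The translates by multiples of the diameter are disjoint, and
  the function is integrable; hence the first term of the translation bound can be made arbitrarily
  small. The second term stays bounded, because a fixed point meets the moving ball during a time of
  at most the diameter.\<close>

lemma half_space_controlled:
  fixes M :: "('a, 'n::finite) manifold"
  assumes M: "riemannian_manifold UNIV M" and vol: "riemannian_measure M vol" and c: "adapted_chart M c"
    and H: "open H" "H \<subseteq> chart_img c" "z0 \<in> H"
    and shift: "\<And>z t. z \<in> H \<Longrightarrow> 0 \<le> t \<Longrightarrow> z + t *\<^sub>R axis j 1 \<in> H"
    and unit: "\<And>z. z \<in> H \<Longrightarrow> tangent_norm c (chart_inv c z) (axis j 1) \<le> 1"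
    and dens: "\<And>z t. z \<in> H \<Longrightarrow> 0 \<le> t \<Longrightarrow> vol_density c (z + t *\<^sub>R axis j 1) = vol_density c z"
  shows "\<exists>W. openin (mtop M) W \<and> W \<noteq> {} \<and> gradient_controlled M vol W"
proof -
  have tc: "topological_chart UNIV (mtop M) c"
    using c by (rule adapted_chart_topological)
  let ?v = "axis j 1 :: real^'n"
  obtain e where e: "0 < e" "ball z0 e \<subseteq> H"
    by (rule openE[OF H(1,3)])
  define S where "S = ball z0 e"
  have SH: "S \<subseteq> H" and S: "S \<in> sets borel" using e by (auto simp: S_def)
  have Hb [measurable]: "H \<in> sets borel" using H(1) by simp
  have wH: "(\<lambda>z. vol_density c z * indicator H z) \<in> borel_measurable borel"
  proof -
    have "(\<lambda>z. (vol_density c z * indicator (chart_img c) z) * indicator H z) \<in> borel_measurable borel"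
      using vol_density_measurable[OF c] by measurable
    moreover have "(\<lambda>z. (vol_density c z * indicator (chart_img c) z) * indicator H z) = (\<lambda>z. vol_density c z * indicator H z)"
      using H(2) by (auto simp: fun_eq_iff indicator_def)
    ultimately show ?thesis by (simp only:)
  qed
  have j_coord: "\<bar>z $ j - T - z0 $ j\<bar> < e" if "z - T *\<^sub>R ?v \<in> S" for z T
  proof -
    have "\<bar>(z - T *\<^sub>R ?v - z0) $ j\<bar> \<le> norm (z - T *\<^sub>R ?v - z0)"
      by (rule component_le_norm_cart)
    also have "\<dots> < e" using that by (simp add: S_def dist_norm norm_minus_commute)
    finally show ?thesis by simp
  qed
  have "L1_norm vol (chart_inv c ` S) u \<le> ennreal (2 * e) * L1_norm vol (points M) (grad_norm M u)"
    if u: "u \<in> test_functions M" for u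
  proof -
    let ?U = "u \<circ> chart_inv c"
    let ?U' = "\<lambda>z. frechet_derivative ?U (at z)"
    let ?g = "L1_norm vol (points M) (grad_norm M u)"
    note us = test_functionD[OF u]
    have U: "C1_on H ?U ?U'"
      by (rule C1_on_subset[OF test_function_C1_on[OF M c us] H(2)])
    \<comment> \<open>the integrals over the translates by multiples of the diameter \<open>2 e\<close>\<close>
    define b where "b k = (\<integral>\<^sup>+z\<in>{z. z - (2 * e * real k) *\<^sub>R ?v \<in> S}. ennreal \<bar>?U z\<bar> * vol_density c z \<partial>lborel)" for k
    have "L1_norm vol (chart_inv c ` S) u \<le> b k + ennreal (2 * e) * ?g" for k
    proof -
      let ?T = "2 * e * real k"
      have T: "0 \<le> ?T" using e by simp
      have "L1_norm vol (chart_inv c ` S) u = (\<integral>\<^sup>+z\<in>S. ennreal \<bar>?U z\<bar> * vol_density c z \<partial>lborel)"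
        using SH H(2) by (intro L1_norm_chart[OF M vol c us S]) auto
      also have "\<dots> \<le> b k + ennreal (2 * e) * (\<integral>\<^sup>+z\<in>H. ennreal \<bar>?U' z ?v\<bar> * vol_density c z \<partial>lborel)"
        unfolding b_def
      proof (rule nn_integral_translate_bound[OF U Hb S T _ wH])
        show "z + t *\<^sub>R ?v \<in> H" if "z \<in> S" "t \<in> {0..?T}" for z t
          using that SH shift by auto
        show "vol_density c (z + t *\<^sub>R ?v) = vol_density c z" if "z \<in> S" "t \<in> {0..?T}" for z t
          using that SH dens by auto
        show "emeasure lborel {t \<in> {0..?T}. y - t *\<^sub>R ?v \<in> S} \<le> ennreal (2 * e)" for y
        proof -
          have "{t \<in> {0..?T}. y - t *\<^sub>R ?v \<in> S} \<subseteq> {y $ j - z0 $ j - e .. y $ j - z0 $ j + e}"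
            using j_coord by (fastforce simp: abs_less_iff)
          then have "emeasure lborel {t \<in> {0..?T}. y - t *\<^sub>R ?v \<in> S}
              \<le> emeasure lborel {y $ j - z0 $ j - e .. y $ j - z0 $ j + e}"
            by (intro emeasure_mono) auto
          also have "\<dots> = ennreal (2 * e)" using e by simp
          finally show ?thesis .
        qed
      qed
      also have "\<dots> \<le> b k + ennreal (2 * e) * (ennreal 1 * ?g)"
        by (intro add_left_mono mult_left_mono directional_derivative_integral_le[OF M vol c us Hb H(2)] unit) auto
      finally show ?thesis by simp
    qed
    moreover have "(\<Sum>k. b k) < \<infinity>"
    proof -
      let ?S = "\<lambda>k::nat. {z. z - (2 * e * real k) *\<^sub>R ?v \<in> S}"
      have SkH: "?S k \<subseteq> H" for k
      proof
        fix z assume "z \<in> ?S k"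
        then have "z - (2 * e * real k) *\<^sub>R ?v \<in> H" using SH by auto
        from shift[OF this, of "2 * e * real k"] show "z \<in> H" using e by simp
      qed
      have Sk: "?S k \<in> sets borel" for k
      proof -
        have "(\<lambda>z. z - (2 * e * real k) *\<^sub>R ?v) -` S \<inter> space borel \<in> sets borel"
          by (rule measurable_sets[OF _ S]) measurable
        then show ?thesis by (simp add: vimage_def)
      qed
      have disj: "disjoint_family ?S"
        unfolding disjoint_family_on_def
      proof (intro ballI impI)
        fix k k' :: nat assume kk: "k \<noteq> k'"
        show "?S k \<inter> ?S k' = {}"
        proof (rule ccontr)
          assume "?S k \<inter> ?S k' \<noteq> {}"
          then obtain z where z: "z - (2 * e * real k) *\<^sub>R ?v \<in> S" "z - (2 * e * real k') *\<^sub>R ?v \<in> S" by auto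
          have "\<bar>2 * e * real k - 2 * e * real k'\<bar> < 2 * e"
            using j_coord[OF z(1)] j_coord[OF z(2)] by linarith
          then have "2 * e * \<bar>real k - real k'\<bar> < 2 * e * 1"
            using e by (simp add: abs_mult flip: right_diff_distrib)
          then have "\<bar>real k - real k'\<bar> < 1" using e by simp
          then show False using kk by linarith
        qed
      qed
      have Fm: "(\<lambda>z. ennreal \<bar>?U z\<bar> * vol_density c z * indicator (?S k) z) \<in> borel_measurable borel" for k
      proof -
        have "continuous_on (?S k) (\<lambda>z. \<bar>?U z\<bar>)"
          by (intro continuous_intros C1_on_continuous[OF C1_on_subset[OF U SkH]])
        from borel_measurable_continuous_on_indicator[OF Sk this]
        have "(\<lambda>z. ennreal (indicator (?S k) z *\<^sub>R \<bar>?U z\<bar>) * (vol_density c z * indicator H z)) \<in> borel_measurable borel"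
          using wH by measurable
        moreover have "(\<lambda>z. ennreal (indicator (?S k) z *\<^sub>R \<bar>?U z\<bar>) * (vol_density c z * indicator H z))
            = (\<lambda>z. ennreal \<bar>?U z\<bar> * vol_density c z * indicator (?S k) z)"
          using SkH[of k] by (auto simp: fun_eq_iff indicator_def)
        ultimately show ?thesis by (simp only:)
      qed
      have "(\<Sum>k. b k) = (\<integral>\<^sup>+z. (\<Sum>k. ennreal \<bar>?U z\<bar> * vol_density c z * indicator (?S k) z) \<partial>lborel)"
        unfolding b_def by (rule nn_integral_suminf[symmetric]) (use Fm in simp)
      also have "\<dots> = (\<integral>\<^sup>+z\<in>(\<Union>k. ?S k). ennreal \<bar>?U z\<bar> * vol_density c z \<partial>lborel)"
        by (intro nn_integral_cong) (simp only: ennreal_suminf_cmult suminf_indicator[OF disj])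
      also have "\<dots> \<le> (\<integral>\<^sup>+z\<in>H. ennreal \<bar>?U z\<bar> * vol_density c z \<partial>lborel)"
        using SkH by (intro nn_integral_mono) (auto simp: indicator_def)
      also have "\<dots> = L1_norm vol (chart_inv c ` H) u"
        by (rule L1_norm_chart[OF M vol c us Hb H(2), symmetric])
      also have "\<dots> \<le> L1_norm vol (points M) u"
        using H(2) chart_inv_dom[OF tc] chart_dom_subset[OF tc] by (intro L1_norm_mono) blast
      also have "\<dots> < \<infinity>" by (rule test_function_integrable[OF M vol u])
      finally show ?thesis .
    qed
    ultimately show ?thesis by (rule ennreal_le_of_summable_slack)
  qed
  then have "gradient_controlled M vol (chart_inv c ` S)"
    unfolding gradient_controlled_def by blast
  moreover have "openin (mtop M) (chart_inv c ` S)"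
    using SH H(2) by (intro chart_openin_inv[OF tc]) (auto simp: S_def)
  moreover have "chart_inv c ` S \<noteq> {}" using e by (simp add: S_def)
  ultimately show ?thesis by blast
qed

section \<open>Charts of the ends\<close>

text \<open>Partial derivatives at a point of an open set depend only on the values in that set.\<close>

lemma Ck_cong:
  fixes f g :: "real^'n::finite \<Rightarrow> 'b::real_normed_vector"
  assumes "open S" "\<And>x. x \<in> S \<Longrightarrow> f x = g x" "Ck k UNIV S f"
  shows "Ck k UNIV S g"
  using assms(2,3)
proof (induction k arbitrary: f g)
  case 0
  then show ?case using continuous_on_eq[of S f g] by simp
next
  case (Suc k)
  have "g differentiable (at x within S)" if x: "x \<in> S" for x
  proof -
    have "f differentiable (at x within S)" using Suc.prems(2) x by simp
    then obtain f' where "(f has_derivative f') (at x within S)" by (auto simp: differentiable_def)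
    then have "(g has_derivative f') (at x within S)"
      using has_derivative_transform[OF x] Suc.prems(1) by metis
    then show ?thesis by (auto simp: differentiable_def)
  qed
  moreover have "Ck k UNIV S (partial j g)" for j
  proof (rule Suc.IH)
    show "Ck k UNIV S (partial j f)" using Suc.prems(2) by simp
    fix x assume x: "x \<in> S"
    have "open ((\<lambda>t::real. x + t *\<^sub>R axis j 1) -` S)"
      by (intro open_vimage assms(1) continuous_intros)
    from eventually_nhds_in_open[OF this, of 0]
    have "eventually (\<lambda>t. x + t *\<^sub>R axis j 1 \<in> S) (nhds (0::real))"
      using x by (simp add: vimage_def)
    then have "eventually (\<lambda>t. f (x + t *\<^sub>R axis j 1) = g (x + t *\<^sub>R axis j 1)) (nhds (0::real))"
      by eventually_elim (rule Suc.prems(1))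
    then show "partial j f x = partial j g x"
      unfolding partial_def by (intro vector_derivative_cong_eq) auto
  qed
  ultimately show ?case by simp
qed

lemma smooth_in_cong:
  fixes f g :: "real^'n::finite \<Rightarrow> 'b::real_normed_vector"
  assumes "open S" "\<And>x. x \<in> S \<Longrightarrow> f x = g x" "smooth_in UNIV S f"
  shows "smooth_in UNIV S g"
  using assms Ck_cong unfolding smooth_in_def by blast

text \<open>The Jacobian of \<open>\<sigma>\<close> is inverse to that of \<open>\<tau>\<close>.\<close>

lemma pulls_back_inverse:
  fixes \<sigma> \<tau> :: "real^'n::finite \<Rightarrow> real^'n"
  assumes \<sigma>: "(\<sigma> has_derivative \<sigma>') (at y)" and \<tau>: "(\<tau> has_derivative \<tau>') (at (\<sigma> y))"
    and S: "open S" "y \<in> S" "\<And>z. z \<in> S \<Longrightarrow> \<tau> (\<sigma> z) = z"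
    and pb: "pulls_back UNIV \<tau> (\<sigma> y) g h"
  shows "pulls_back UNIV \<sigma> y h g"
proof -
  have "(\<tau> \<circ> \<sigma> has_derivative \<tau>' \<circ> \<sigma>') (at y)"
    by (rule diff_chain_at[OF \<sigma> \<tau>])
  then have "((\<lambda>z. z) has_derivative \<tau>' \<circ> \<sigma>') (at y)"
    by (rule has_derivative_transform_within_open[OF _ S(1,2)]) (simp add: S(3))
  then have id: "\<tau>' \<circ> \<sigma>' = (\<lambda>z. z)"
    using has_derivative_unique has_derivative_ident by blast
  have "h $ i $ j = axis i 1 \<bullet> (h *v axis j 1)" for i j
    by (simp add: inner_axis' matrix_vector_mult_basis column_def)
  then show ?thesis
    using pulls_back_UNIV(1)[OF \<tau> pb] id
    by (simp add: pulls_back_def partial_eq[OF \<sigma>] fun_eq_iff)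
qed

text \<open>An isometry turns a chart of the target into a chart of the source that carries the same Gram matrix.\<close>

definition pullback_chart :: "'a set \<Rightarrow> ('a \<Rightarrow> 'b) \<Rightarrow> ('b, 'n::finite) chart \<Rightarrow> ('a, 'n) chart" where
  "pullback_chart E f D = \<lparr> chart_dom = {p \<in> E. f p \<in> chart_dom D},
     chart_map = chart_map D \<circ> f, chart_gram = chart_gram D \<circ> f \<rparr>"

context
  fixes M :: "('a, 'n::finite) manifold" and P :: "('b, 'n) manifold"
    and E :: "'a set" and Q :: "'b set" and f :: "'a \<Rightarrow> 'b" and D :: "('b, 'n) chart"
  assumes M: "riemannian_manifold UNIV M" and E: "openin (mtop M) E" and Q: "openin (mtop P) Q"
    and iso: "riemannian_isometry M E P Q f"
    and DP: "D \<in> atlas P" and tD: "topological_chart UNIV (mtop P) D"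
begin

lemma isometry_homeo: "homeomorphic_map (subtopology (mtop M) E) (subtopology (mtop P) Q) f"
  using iso by (simp add: riemannian_isometry_def)

lemma isometry_bij: "inj_on f E" "f ` E = Q"
proof -
  have t: "topspace (subtopology (mtop M) E) = E" "topspace (subtopology (mtop P) Q) = Q"
    using openin_subset[OF E] openin_subset[OF Q] by auto
  show "inj_on f E" "f ` E = Q"
    using homeomorphic_imp_injective_map[OF isometry_homeo] homeomorphic_imp_surjective_map[OF isometry_homeo]
    unfolding t by auto
qed

lemma isometry_inv_continuous: "continuous_map (subtopology (mtop P) Q) (mtop M) (inv_into E f)"
proof -
  obtain g where g: "homeomorphic_maps (subtopology (mtop M) E) (subtopology (mtop P) Q) f g"
    using isometry_homeo homeomorphic_map_maps by blast
  then have c: "continuous_map (subtopology (mtop P) Q) (mtop M) g"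
    and gf: "\<And>p. p \<in> E \<Longrightarrow> g (f p) = p"
    using openin_subset[OF E] by (auto simp: homeomorphic_maps_def continuous_map_in_subtopology)
  show ?thesis
  proof (rule continuous_map_eq[OF c])
    fix q assume "q \<in> topspace (subtopology (mtop P) Q)"
    then have "q \<in> f ` E" using isometry_bij(2) by simp
    then obtain p where "p \<in> E" "q = f p" by blast
    then show "g q = inv_into E f q"
      using gf isometry_bij(1) by simp
  qed
qed

lemma pullback_chart_img: "chart_img (pullback_chart E f D) = chart_map D ` (Q \<inter> chart_dom D)"
  using isometry_bij(2) by (auto simp: pullback_chart_def image_comp[symmetric] intro!: image_eqI)

lemma pullback_chart_inj: "inj_on (chart_map (pullback_chart E f D)) (chart_dom (pullback_chart E f D))"
  using chart_inj[OF tD] isometry_bij(1) by (auto simp: pullback_chart_def inj_on_def)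

lemma pullback_chart_inv:
  assumes "z \<in> chart_img (pullback_chart E f D)"
  shows "chart_inv (pullback_chart E f D) z = inv_into E f (chart_inv D z)"
proof -
  obtain p where p: "p \<in> E" "f p \<in> chart_dom D" "z = chart_map D (f p)"
    using assms by (auto simp: pullback_chart_def)
  have "chart_inv (pullback_chart E f D) z = p"
    unfolding chart_inv_def
    by (rule inv_into_f_eq[OF pullback_chart_inj]) (use p in \<open>auto simp: pullback_chart_def\<close>)
  then show ?thesis
    using p chart_inv_map[OF tD p(2)] isometry_bij(1) by simp
qed

lemma pullback_chart_topological: "topological_chart UNIV (mtop M) (pullback_chart E f D)"
proof -
  let ?c = "pullback_chart E f D"
  have dom: "chart_dom ?c = {p \<in> E. f p \<in> chart_dom D}" and map: "chart_map ?c = chart_map D \<circ> f"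
    by (auto simp: pullback_chart_def)
  have cf: "continuous_map (subtopology (mtop M) E) (mtop P) f"
    using homeomorphic_imp_continuous_map[OF isometry_homeo] continuous_map_in_subtopology by blast
  have tE: "topspace (subtopology (mtop M) E) = E"
    using openin_subset[OF E] by auto
  have "openin (subtopology (mtop M) E) {p \<in> topspace (subtopology (mtop M) E). f p \<in> chart_dom D}"
    by (rule openin_continuous_map_preimage[OF cf chart_dom_open[OF tD]])
  then have o: "openin (mtop M) (chart_dom ?c)"
    unfolding tE dom using E openin_trans_full by blast
  have img_o: "open (chart_img ?c)"
    unfolding pullback_chart_img
    by (rule chart_open_image[OF tD]) (auto intro: Q chart_dom_open[OF tD])
  have QD: "chart_inv D z \<in> Q" "chart_inv D z \<in> chart_dom D" if "z \<in> chart_img ?c" for z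
    using that unfolding pullback_chart_img by (auto simp: chart_inv_map[OF tD])
  have "homeomorphic_maps (subtopology (mtop M) (chart_dom ?c)) (top_of_set (chart_img ?c))
      (chart_map ?c) (inv_into E f \<circ> chart_inv D)"
    unfolding homeomorphic_maps_def
  proof (intro conjI ballI)
    have "continuous_map (subtopology (mtop M) (chart_dom ?c)) (mtop P) f"
      by (rule continuous_map_from_subtopology_mono[OF cf]) (auto simp: dom)
    then have "continuous_map (subtopology (mtop M) (chart_dom ?c)) (subtopology (mtop P) (chart_dom D)) f"
      by (auto simp: continuous_map_in_subtopology dom)
    from continuous_map_compose[OF this chart_map_continuous[OF tD]]
    show "continuous_map (subtopology (mtop M) (chart_dom ?c)) (top_of_set (chart_img ?c)) (chart_map ?c)"
      by (auto simp: continuous_map_in_subtopology map)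
    have "continuous_map (top_of_set (chart_img ?c)) (mtop P) (chart_inv D)"
      by (rule continuous_map_from_subtopology_mono[OF chart_inv_continuous[OF tD]])
         (auto simp: pullback_chart_img)
    then have "continuous_map (top_of_set (chart_img ?c)) (subtopology (mtop P) Q) (chart_inv D)"
      using QD by (auto simp: continuous_map_in_subtopology simp del: image_subset_iff)
    from continuous_map_compose[OF this isometry_inv_continuous]
    have "continuous_map (top_of_set (chart_img ?c)) (mtop M) (inv_into E f \<circ> chart_inv D)" .
    moreover have "(inv_into E f \<circ> chart_inv D) z \<in> chart_dom ?c" if "z \<in> chart_img ?c" for z
    proof -
      have "chart_inv D z \<in> f ` E" using QD(1)[OF that] isometry_bij(2) by simp
      then show ?thesis
        using QD(2)[OF that] by (simp add: dom inv_into_into f_inv_into_f)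
    qed
    ultimately show "continuous_map (top_of_set (chart_img ?c)) (subtopology (mtop M) (chart_dom ?c)) (inv_into E f \<circ> chart_inv D)"
      unfolding continuous_map_in_subtopology by auto
  next
    fix p assume "p \<in> topspace (subtopology (mtop M) (chart_dom ?c))"
    then have "p \<in> E" "f p \<in> chart_dom D" by (auto simp: dom)
    then show "(inv_into E f \<circ> chart_inv D) (chart_map ?c p) = p"
      using isometry_bij(1) by (simp add: map chart_inv_map[OF tD])
  next
    fix z assume "z \<in> topspace (top_of_set (chart_img ?c))"
    then have z: "z \<in> chart_img ?c" by simp
    have "chart_inv D z \<in> f ` E" using QD(1)[OF z] isometry_bij(2) by simp
    moreover have "z \<in> chart_img D" using z unfolding pullback_chart_img by blast
    ultimately show "chart_map ?c ((inv_into E f \<circ> chart_inv D) z) = z"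
      by (simp add: map f_inv_into_f chart_map_inv[OF tD])
  qed
  then have "homeomorphic_map (subtopology (mtop M) (chart_dom ?c)) (top_of_set (chart_img ?c)) (chart_map ?c)"
    using homeomorphic_map_maps by blast
  with o img_o show ?thesis
    by (simp add: topological_chart_def)
qed

text \<open>The isometry pulls the metric back in one direction, from the charts of \<open>M\<close> to \<open>D\<close>; the direction
  required here follows because the chart change is invertible.\<close>

lemma pullback_chart_adapted:
  assumes gram: "\<And>i j. continuous_on (chart_img D) (\<lambda>z. chart_gram D (chart_inv D z) $ i $ j)"
  shows "adapted_chart M (pullback_chart E f D)"
  unfolding adapted_chart_def
proof (intro conjI allI ballI)
  let ?c = "pullback_chart E f D"
  have dom: "chart_dom ?c = {p \<in> E. f p \<in> chart_dom D}" and map: "chart_map ?c = chart_map D \<circ> f"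
    and gr: "chart_gram ?c = chart_gram D \<circ> f"
    by (auto simp: pullback_chart_def)
  show tc: "topological_chart UNIV (mtop M) ?c" by (rule pullback_chart_topological)
  have fi: "f (chart_inv ?c z) = chart_inv D z" if z: "z \<in> chart_img ?c" for z
  proof -
    have "chart_inv D z \<in> f ` E"
      using z isometry_bij(2) unfolding pullback_chart_img by (auto simp: chart_inv_map[OF tD])
    then show ?thesis
      by (simp add: pullback_chart_inv[OF z] f_inv_into_f)
  qed
  show "continuous_on (chart_img ?c) (\<lambda>z. chart_gram ?c (chart_inv ?c z) $ i $ j)" for i j
  proof (rule continuous_on_eq)
    show "continuous_on (chart_img ?c) (\<lambda>z. chart_gram D (chart_inv D z) $ i $ j)"
      by (rule continuous_on_subset[OF gram]) (auto simp: pullback_chart_img)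
  qed (simp add: gr fi)
  fix e assume e: "e \<in> atlas M"
  have te: "topological_chart UNIV (mtop M) e" by (rule riemannian_manifold_chart[OF M e])
  let ?O = "chart_map ?c ` (chart_dom ?c \<inter> chart_dom e)"
  have Oo: "open ?O"
    by (rule chart_open_image[OF tc]) (auto intro: chart_dom_open[OF tc] chart_dom_open[OF te])
  have O_eq: "?O = chart_map D ` {q \<in> chart_dom D \<inter> Q. inv_into E f q \<in> chart_dom e}"
  proof
    show "?O \<subseteq> chart_map D ` {q \<in> chart_dom D \<inter> Q. inv_into E f q \<in> chart_dom e}"
      using isometry_bij by (auto simp: dom map intro!: imageI)
    show "chart_map D ` {q \<in> chart_dom D \<inter> Q. inv_into E f q \<in> chart_dom e} \<subseteq> ?O"
    proof
      fix z assume "z \<in> chart_map D ` {q \<in> chart_dom D \<inter> Q. inv_into E f q \<in> chart_dom e}"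
      then obtain q where q: "q \<in> chart_dom D" "q \<in> Q" "inv_into E f q \<in> chart_dom e" "z = chart_map D q" by blast
      then have "q \<in> f ` E" using isometry_bij(2) by simp
      then show "z \<in> ?O"
        using q by (intro image_eqI[of _ _ "inv_into E f q"]) (auto simp: dom map f_inv_into_f inv_into_into)
    qed
  qed
  have Oi: "?O \<subseteq> chart_img ?c" by blast
  let ?\<sigma> = "chart_map e \<circ> chart_inv ?c"
  have sm: "smooth_in UNIV ?O ?\<sigma>"
  proof (rule smooth_in_cong[OF Oo])
    show "smooth_in UNIV ?O (chart_map e \<circ> inv_into E f \<circ> chart_inv D)"
      unfolding O_eq using iso e DP by (simp add: riemannian_isometry_def smooth_map_mfd_def)
    show "(chart_map e \<circ> inv_into E f \<circ> chart_inv D) z = ?\<sigma> z" if "z \<in> ?O" for z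
      using pullback_chart_inv[of z] that by auto
  qed
  show "compatible_charts UNIV ?c e"
    unfolding compatible_charts_def
  proof (intro conjI ballI)
    show "smooth_in UNIV ?O ?\<sigma>" by (rule sm)
    fix p assume p: "p \<in> chart_dom ?c \<inter> chart_dom e"
    then have pE: "p \<in> E" "f p \<in> chart_dom D" "p \<in> chart_dom e" "p \<in> chart_dom ?c" by (auto simp: dom)
    let ?\<tau> = "chart_map D \<circ> f \<circ> chart_inv e"
    let ?y = "chart_map ?c p"
    have \<sigma>y: "?\<sigma> ?y = chart_map e p" by (simp add: chart_inv_map[OF tc pE(4)])
    have yO: "?y \<in> ?O" using p by blast
    have s: "(?\<sigma> has_derivative frechet_derivative ?\<sigma> (at ?y)) (at ?y)"
      using smooth_in_C1_on[OF sm Oo] yO unfolding C1_on_def by blast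
    let ?V = "chart_map e ` {p \<in> chart_dom e \<inter> E. f p \<in> chart_dom D}"
    have V_eq: "{p \<in> chart_dom e \<inter> E. f p \<in> chart_dom D} = chart_dom e \<inter> chart_dom ?c"
      by (auto simp: dom)
    have Vo: "open ?V"
      unfolding V_eq
      by (rule chart_open_image[OF te]) (auto intro: chart_dom_open[OF tc] chart_dom_open[OF te])
    have "smooth_in UNIV ?V ?\<tau>"
      using iso e DP by (simp add: riemannian_isometry_def smooth_map_mfd_def)
    then have "C1_on ?V ?\<tau> (\<lambda>x. frechet_derivative ?\<tau> (at x))"
      by (rule smooth_in_C1_on) (rule Vo)
    then have t: "(?\<tau> has_derivative frechet_derivative ?\<tau> (at (?\<sigma> ?y))) (at (?\<sigma> ?y))"
      unfolding \<sigma>y using pE unfolding C1_on_def by blast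
    have pb: "pulls_back UNIV ?\<tau> (?\<sigma> ?y) (chart_gram e p) (chart_gram D (f p))"
      unfolding \<sigma>y using iso e DP pE by (simp add: riemannian_isometry_def)
    have inv: "?\<tau> (?\<sigma> z) = z" if z: "z \<in> ?O" for z
    proof -
      obtain q where "q \<in> chart_dom ?c" "q \<in> chart_dom e" "z = chart_map ?c q" using z by blast
      then show ?thesis
        by (simp add: chart_inv_map[OF tc] chart_inv_map[OF te]) (simp add: map)
    qed
    have "chart_gram ?c p = chart_gram D (f p)" by (simp add: gr)
    then show "pulls_back UNIV ?\<sigma> ?y (chart_gram ?c p) (chart_gram e p)"
      using pulls_back_inverse[OF s t Oo yO inv pb] by (simp only:)
  qed
qed

end

definition coord_proj :: "'n::finite set \<Rightarrow> real^'n \<Rightarrow> real^'n" where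
  "coord_proj A z = (\<chi> i. if i \<in> A then z $ i else 0)"

lemma coord_proj_nth: "coord_proj A z $ i = (if i \<in> A then z $ i else 0)"
  by (simp add: coord_proj_def)

lemma coord_proj_simps:
  "coord_proj A z \<in> coords A"
  "x \<in> coords A \<Longrightarrow> y \<in> coords (- A) \<Longrightarrow> coord_proj A (x + y) = x"
  "x \<in> coords A \<Longrightarrow> y \<in> coords (- A) \<Longrightarrow> coord_proj (- A) (x + y) = y"
  "coord_proj A z + coord_proj (- A) z = z"
  by (auto simp: coords_def vec_eq_iff coord_proj_nth)

lemma continuous_on_coord_proj: "continuous_on S (coord_proj A)"
proof -
  have "linear (coord_proj A)"
    by (intro linearI) (auto simp: vec_eq_iff coord_proj_nth)
  then show ?thesis
    by (simp add: linear_conv_bounded_linear bounded_linear.continuous_on continuous_on_id linear_continuous_on)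
qed

text \<open>The charts that make up the atlas of a Riemannian product with Euclidean space.\<close>

definition prod_chart :: "'n::finite set \<Rightarrow> ('b, 'n) chart \<Rightarrow> ((real^'n) \<times> 'b, 'n) chart" where
  "prod_chart A c = \<lparr> chart_dom = coords A \<times> chart_dom c,
                      chart_map = (\<lambda>(x, p). x + chart_map c p),
                      chart_gram = (\<lambda>(x, p). \<chi> i j.
                        if i \<in> A \<or> j \<in> A then (if i = j then 1 else 0)
                        else chart_gram c p $ i $ j) \<rparr>"

lemma euclidean_product_simps:
  "mtop (euclidean_product A F) = prod_topology (top_of_set (coords A)) (mtop F)"
  "atlas (euclidean_product A F) = prod_chart A ` atlas F"
  by (simp_all add: euclidean_product_def prod_chart_def[abs_def])

context
  fixes A :: "'n::finite set" and Y :: "'b topology" and d :: "('b, 'n) chart"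
  assumes td: "topological_chart (- A) Y d"
begin

lemma chart_img_coords: "chart_img d \<subseteq> coords (- A)"
proof -
  have "openin (top_of_set (coords (- A))) (chart_img d)"
    using td by (simp add: topological_chart_def)
  then show ?thesis using openin_subset by fastforce
qed

lemma prod_chart_img: "chart_img (prod_chart A d) = {z. coord_proj (- A) z \<in> chart_img d}"
proof (intro set_eqI iffI)
  fix z assume "z \<in> chart_img (prod_chart A d)"
  then obtain x p where "x \<in> coords A" "p \<in> chart_dom d" "z = x + chart_map d p"
    by (auto simp: prod_chart_def)
  moreover have "chart_map d p \<in> coords (- A)" using chart_img_coords calculation by blast
  ultimately show "z \<in> {z. coord_proj (- A) z \<in> chart_img d}"
    by (simp add: coord_proj_simps(3))
next
  fix z assume "z \<in> {z. coord_proj (- A) z \<in> chart_img d}"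
  then obtain p where p: "p \<in> chart_dom d" "coord_proj (- A) z = chart_map d p" by auto
  show "z \<in> chart_img (prod_chart A d)"
    using p coord_proj_simps(1)[of A z] coord_proj_simps(4)[of A z]
    by (intro image_eqI[of _ _ "(coord_proj A z, p)"]) (auto simp: prod_chart_def)
qed

lemma prod_chart_inverse:
  assumes "x \<in> coords A" "p \<in> chart_dom d"
  shows "coord_proj A (x + chart_map d p) = x" "chart_inv d (coord_proj (- A) (x + chart_map d p)) = p"
proof -
  have "chart_map d p \<in> coords (- A)" using chart_img_coords assms by blast
  then show "coord_proj A (x + chart_map d p) = x" "chart_inv d (coord_proj (- A) (x + chart_map d p)) = p"
    using assms chart_inv_map[OF td assms(2)] by (simp_all add: coord_proj_simps)
qed

lemma prod_chart_inv:
  assumes "z \<in> chart_img (prod_chart A d)"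
  shows "chart_inv (prod_chart A d) z = (coord_proj A z, chart_inv d (coord_proj (- A) z))"
proof -
  obtain x p where xp: "x \<in> coords A" "p \<in> chart_dom d" "z = x + chart_map d p"
    using assms by (auto simp: prod_chart_def)
  have "inj_on (chart_map (prod_chart A d)) (chart_dom (prod_chart A d))"
  proof (rule inj_onI)
    fix v w assume vw: "v \<in> chart_dom (prod_chart A d)" "w \<in> chart_dom (prod_chart A d)"
      "chart_map (prod_chart A d) v = chart_map (prod_chart A d) w"
    obtain x p y q where e: "v = (x, p)" "w = (y, q)" by (cases v, cases w)
    then have "x \<in> coords A" "p \<in> chart_dom d" "y \<in> coords A" "q \<in> chart_dom d"
      "x + chart_map d p = y + chart_map d q"
      using vw by (auto simp: prod_chart_def)
    then show "v = w"
      unfolding e using prod_chart_inverse[of x p] prod_chart_inverse[of y q] by simp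
  qed
  then have "chart_inv (prod_chart A d) z = (x, p)"
    unfolding chart_inv_def by (rule inv_into_f_eq) (use xp in \<open>auto simp: prod_chart_def\<close>)
  then show ?thesis
    using prod_chart_inverse[OF xp(1,2)] xp(3) by simp
qed

lemma prod_chart_img_open: "open (chart_img (prod_chart A d))"
proof -
  obtain O1 where O1: "open O1" "chart_img d = coords (- A) \<inter> O1"
    using td by (auto simp: topological_chart_def openin_open)
  have "chart_img (prod_chart A d) = coord_proj (- A) -` O1"
    unfolding prod_chart_img O1(2) using coord_proj_simps(1)[of "- A"] by auto
  then show ?thesis
    using open_vimage[OF O1(1)] continuous_on_coord_proj by metis
qed

lemma prod_chart_topological:
  "topological_chart UNIV (prod_topology (top_of_set (coords A)) Y) (prod_chart A d)"
proof -
  let ?D = "prod_chart A d" and ?X = "prod_topology (top_of_set (coords A)) Y"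
  let ?g = "\<lambda>z. (coord_proj A z, chart_inv d (coord_proj (- A) z))"
  have dom: "chart_dom ?D = coords A \<times> chart_dom d"
    by (simp add: prod_chart_def)
  have sub: "subtopology ?X (chart_dom ?D) = prod_topology (top_of_set (coords A)) (subtopology Y (chart_dom d))"
    by (simp add: dom subtopology_Times subtopology_subtopology)
  have o: "openin ?X (chart_dom ?D)"
    unfolding dom openin_prod_Times_iff using chart_dom_open[OF td] by auto
  have "homeomorphic_maps (subtopology ?X (chart_dom ?D)) (top_of_set (chart_img ?D)) (chart_map ?D) ?g"
    unfolding homeomorphic_maps_def
  proof (intro conjI ballI)
    have c1: "continuous_map (subtopology ?X (chart_dom ?D)) euclidean fst"
      unfolding sub using continuous_map_fst continuous_map_into_fulltopology by blast
    have "continuous_map (subtopology ?X (chart_dom ?D)) euclidean (chart_map d \<circ> snd)"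
      unfolding sub by (rule continuous_map_compose[OF continuous_map_snd chart_map_continuous[OF td]])
    from continuous_map_add[OF c1 this]
    have "continuous_map (subtopology ?X (chart_dom ?D)) euclidean (chart_map ?D)"
      by (simp add: prod_chart_def case_prod_unfold o_def)
    then show "continuous_map (subtopology ?X (chart_dom ?D)) (top_of_set (chart_img ?D)) (chart_map ?D)"
      by (auto simp: continuous_map_in_subtopology)
    have "continuous_map (top_of_set (chart_img ?D)) (top_of_set (coords A)) (coord_proj A)"
      using coord_proj_simps(1) continuous_on_coord_proj by auto
    moreover have "continuous_map (top_of_set (chart_img ?D)) (subtopology Y (chart_dom d)) (chart_inv d \<circ> coord_proj (- A))"
    proof (rule continuous_map_compose)
      show "continuous_map (top_of_set (chart_img ?D)) (top_of_set (chart_img d)) (coord_proj (- A))"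
        using continuous_on_coord_proj prod_chart_img by auto
      show "continuous_map (top_of_set (chart_img d)) (subtopology Y (chart_dom d)) (chart_inv d)"
        by (rule homeomorphic_imp_continuous_map[OF chart_homeo_inv[OF td]])
    qed
    ultimately show "continuous_map (top_of_set (chart_img ?D)) (subtopology ?X (chart_dom ?D)) ?g"
      unfolding sub by (simp add: continuous_map_paired o_def)
  next
    fix v assume "v \<in> topspace (subtopology ?X (chart_dom ?D))"
    then show "?g (chart_map ?D v) = v"
      using prod_chart_inverse by (cases v) (auto simp: prod_chart_def)
  next
    fix z assume "z \<in> topspace (top_of_set (chart_img ?D))"
    then have "coord_proj (- A) z \<in> chart_img d" using prod_chart_img by auto
    then show "chart_map ?D (?g z) = z"
      by (simp add: prod_chart_def chart_map_inv[OF td] coord_proj_simps(4))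
  qed
  then have "homeomorphic_map (subtopology ?X (chart_dom ?D)) (top_of_set (chart_img ?D)) (chart_map ?D)"
    using homeomorphic_map_maps by blast
  with o prod_chart_img_open show ?thesis
    by (simp add: topological_chart_def)
qed

lemma prod_chart_gram:
  assumes "z \<in> chart_img (prod_chart A d)"
  shows "chart_gram (prod_chart A d) (chart_inv (prod_chart A d) z) $ i $ j
    = (if i \<in> A \<or> j \<in> A then (if i = j then 1 else 0)
       else chart_gram d (chart_inv d (coord_proj (- A) z)) $ i $ j)"
  unfolding prod_chart_inv[OF assms] by (simp add: prod_chart_def)

lemma prod_chart_gram_continuous:
  assumes "smooth_metric (- A) d"
  shows "continuous_on (chart_img (prod_chart A d))
    (\<lambda>z. chart_gram (prod_chart A d) (chart_inv (prod_chart A d) z) $ i $ j)"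
proof (cases "i \<in> A \<or> j \<in> A")
  case True
  then show ?thesis
    by (intro continuous_on_eq[OF continuous_on_const[of _ "if i = j then 1 else 0"]])
       (auto simp: prod_chart_gram)
next
  case False
  have "Ck 0 (- A) (chart_img d) (\<lambda>x. chart_gram d (chart_inv d x) $ i $ j)"
    using assms False unfolding smooth_metric_def smooth_in_def by blast
  then have "continuous_on (chart_img d) (\<lambda>x. chart_gram d (chart_inv d x) $ i $ j)" by simp
  then have "continuous_on (chart_img (prod_chart A d)) (\<lambda>z. chart_gram d (chart_inv d (coord_proj (- A) z)) $ i $ j)"
    by (rule continuous_on_compose2[OF _ continuous_on_coord_proj]) (auto simp: prod_chart_img)
  then show ?thesis
    by (rule continuous_on_eq) (use False in \<open>auto simp: prod_chart_gram\<close>)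
qed

end

text \<open>The removed compact set has bounded Euclidean component. In a product chart, the half-space of points
  whose \<open>j\<close>-th coordinate exceeds that bound therefore belongs to the end. The Gram matrix there
  does not involve the Euclidean coordinates, and its \<open>j\<close>-th basis vector has length \<open>1\<close>.\<close>

lemma end_controlled:
  fixes M :: "('a, 'n::finite) manifold" and F :: "('b, 'n) manifold"
  assumes M: "riemannian_manifold UNIV M" and vol: "riemannian_measure M vol"
    and F: "riemannian_manifold (- A) F" and j: "j \<in> A" and E: "openin (mtop M) E"
    and C: "compactin (mtop (euclidean_product A F)) C"
    and iso: "riemannian_isometry M E (euclidean_product A F) (points (euclidean_product A F) - C) f"
  shows "\<exists>W. openin (mtop M) W \<and> W \<noteq> {} \<and> gradient_controlled M vol W"
proof -
  let ?P = "euclidean_product A F"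
  let ?Q = "points ?P - C"
  have HP: "Hausdorff_space (mtop ?P)"
    using F unfolding euclidean_product_simps riemannian_manifold_def
    by (simp add: Hausdorff_space_prod_topology Hausdorff_space_subtopology)
  have Q: "openin (mtop ?P) ?Q"
    using compactin_imp_closedin[OF HP C] by (intro openin_diff) auto
  obtain q0 where q0: "q0 \<in> points F"
    using F unfolding riemannian_manifold_def by blast
  have "q0 \<in> (\<Union>d\<in>atlas F. chart_dom d)"
    using F q0 by (simp add: riemannian_manifold_def)
  then obtain d where d: "d \<in> atlas F" "q0 \<in> chart_dom d" by blast
  have td: "topological_chart (- A) (mtop F) d" and sd: "smooth_metric (- A) d"
    using F d(1) by (auto simp: riemannian_manifold_def)
  define D where "D = prod_chart A d"
  have DP: "D \<in> atlas ?P" using d by (simp add: D_def euclidean_product_simps)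
  have tD: "topological_chart UNIV (mtop ?P) D"
    unfolding D_def euclidean_product_simps by (rule prod_chart_topological[OF td])
  define c where "c = pullback_chart E f D"
  have c: "adapted_chart M c"
    unfolding c_def
    by (rule pullback_chart_adapted[OF M E Q iso DP tD])
       (simp add: D_def prod_chart_gram_continuous[OF td sd])
  have c_img: "chart_img c = chart_map D ` (?Q \<inter> chart_dom D)"
    unfolding c_def by (rule pullback_chart_img[OF M E Q iso DP tD])
  have "compactin (top_of_set (coords A)) (fst ` C)"
    using image_compactin[OF C, of "top_of_set (coords A)" fst] continuous_map_fst
    unfolding euclidean_product_simps by blast
  then have "compact (fst ` C)" by (simp add: compactin_subtopology)
  then obtain R where R: "0 < R" "\<And>x. x \<in> fst ` C \<Longrightarrow> norm x \<le> R"
    using compact_imp_bounded bounded_pos by metis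
  define H where "H = {z. coord_proj (- A) z \<in> chart_img d \<and> R < z $ j}"
  have H_eq: "H = chart_img D \<inter> {z. R < z $ j}"
    unfolding H_def D_def prod_chart_img[OF td] by auto
  have HD: "H \<subseteq> chart_img D" unfolding H_eq by blast
  have Hc: "H \<subseteq> chart_img c"
  proof
    fix z assume z: "z \<in> H"
    then have zD: "z \<in> chart_img D" using HD by blast
    have inv: "chart_inv D z = (coord_proj A z, chart_inv d (coord_proj (- A) z))"
      using prod_chart_inv[OF td] zD unfolding D_def by blast
    have "R < norm (coord_proj A z)"
      using component_le_norm_cart[of "coord_proj A z" j] j z by (auto simp: coord_proj_nth H_def)
    then have "chart_inv D z \<notin> C"
      using R(2)[of "fst (chart_inv D z)"] inv by (metis fst_conv imageI not_less)
    moreover have "chart_inv D z \<in> chart_dom D" by (rule chart_inv_dom[OF tD zD])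
    ultimately show "z \<in> chart_img c"
      unfolding c_img using chart_dom_subset[OF tD] chart_map_inv[OF tD zD]
      by (intro image_eqI[of _ _ "chart_inv D z"]) auto
  qed
  have Ho: "open H"
    unfolding H_eq by (intro open_Int chart_img_open[OF tD] open_Collect_less continuous_intros)
  \<comment> \<open>some point of the half-space: \<open>q0\<close> gives the component in the closed factor\<close>
  define z0 where "z0 = (R + 1) *\<^sub>R axis j 1 + chart_map d q0"
  have md: "chart_map d q0 \<in> coords (- A)" using chart_img_coords[OF td] d by blast
  have a: "(R + 1) *\<^sub>R axis j 1 \<in> coords A" using j by (auto simp: coords_def axis_def)
  have z0: "z0 \<in> H"
    using coord_proj_simps(3)[OF a md] d md j by (auto simp: H_def z0_def coords_def)
  have proj_shift: "coord_proj (- A) (z + t *\<^sub>R axis j 1) = coord_proj (- A) z" for z :: "real^'n" and t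
    using j by (auto simp: vec_eq_iff coord_proj_nth axis_def)
  have shift: "z + t *\<^sub>R axis j 1 \<in> H" if "z \<in> H" "0 \<le> t" for z t
    using that by (simp add: H_def proj_shift)
  have gram: "chart_gram c (chart_inv c z) = chart_gram D (chart_inv D z)" if z: "z \<in> H" for z
  proof -
    have zc: "z \<in> chart_img c" using z Hc by blast
    then have "chart_inv D z \<in> ?Q" unfolding c_img by (auto simp: chart_inv_map[OF tD])
    then have "chart_inv D z \<in> f ` E"
      using isometry_bij(2)[OF M E Q iso DP tD] by simp
    then have "f (chart_inv c z) = chart_inv D z"
      using pullback_chart_inv[OF M E Q iso DP tD] zc unfolding c_def by (metis f_inv_into_f)
    then show ?thesis by (simp add: c_def pullback_chart_def)
  qed
  show ?thesis
  proof (rule half_space_controlled[OF M vol c Ho Hc z0 shift])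
    fix z assume z: "z \<in> H"
    have "chart_gram c (chart_inv c z) $ j $ j = 1"
      unfolding gram[OF z] using prod_chart_gram[OF td, of z j j] subsetD[OF HD z] j unfolding D_def by simp
    then show "tangent_norm c (chart_inv c z) (axis j 1) \<le> 1"
      by (simp add: tangent_norm_def inner_axis' matrix_vector_mult_basis column_def)
  next
    fix z t assume z: "z \<in> H" and t: "0 \<le> (t::real)"
    have z': "z + t *\<^sub>R axis j 1 \<in> H" by (rule shift[OF z t])
    have "chart_gram D (chart_inv D (z + t *\<^sub>R axis j 1)) $ i $ k = chart_gram D (chart_inv D z) $ i $ k" for i k
      using prod_chart_gram[OF td, of z i k] prod_chart_gram[OF td, of "z + t *\<^sub>R axis j 1" i k]
        subsetD[OF HD z] subsetD[OF HD z'] unfolding D_def proj_shift by simp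
    then have "chart_gram D (chart_inv D (z + t *\<^sub>R axis j 1)) = chart_gram D (chart_inv D z)"
      by (simp add: vec_eq_iff)
    then show "vol_density c (z + t *\<^sub>R axis j 1) = vol_density c z"
      by (simp add: gram[OF z] gram[OF z'])
  qed
qed

theorem lemma4p10:
  fixes M :: "('a, 'n::finite) manifold"
    and F :: "nat \<Rightarrow> ('b, 'n) manifold"
    and A :: "nat \<Rightarrow> 'n set"
    and n :: "nat \<Rightarrow> nat"
    and l :: nat
    and K Kt :: "'a set"
    and E :: "nat \<Rightarrow> 'a set"
    and vol :: "'a measure"
  assumes "l \<ge> 2"
    and "\<And>i. i \<in> {1..l} \<Longrightarrow> card (A i) = n i"
    and "Min (n ` {1..l}) \<ge> 3"
    and "manifold_with_ends M l A F K E"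
    and "riemannian_measure M vol"
    and "K \<subseteq> mtop M interior_of Kt"
    and "bounded_in_mfd M Kt"
    and "smooth_boundary M Kt"
    and "Kt \<in> sets vol"
  shows "\<exists>C::real. \<forall>u\<in>test_functions M.
           L1_norm vol Kt u \<le> ennreal C * L1_norm vol (points M) (grad_norm M u)"
proof -
  have one: "1 \<in> {1..l}" using assms(1) by simp
  have M: "riemannian_manifold UNIV M" and conn: "connected_space (mtop M)" and compl: "complete_manifold M"
    using assms(4) by (auto simp: manifold_with_ends_def)
  have F: "riemannian_manifold (- A 1) (F 1)"
    using assms(4) one by (auto simp: manifold_with_ends_def closed_riemannian_manifold_def)
  have E: "openin (mtop M) (E 1)"
    using assms(4) one by (auto simp: manifold_with_ends_def)
  obtain C f where C: "compactin (mtop (euclidean_product (A 1) (F 1))) C"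
    and iso: "riemannian_isometry M (E 1) (euclidean_product (A 1) (F 1))
      (points (euclidean_product (A 1) (F 1)) - C) f"
    using assms(4) one unfolding manifold_with_ends_def by meson
  have "Min (n ` {1..l}) \<le> n 1"
    using one by (intro Min_le) auto
  \<comment> \<open>the starting ball is moved along a Euclidean direction \<open>j\<close> of the first end\<close>
  then have "A 1 \<noteq> {}"
    using assms(2)[OF one] assms(3) by auto
  then obtain j where j: "j \<in> A 1" by blast
  obtain W where W: "openin (mtop M) W" "W \<noteq> {}" "gradient_controlled M vol W"
    using end_controlled[OF M assms(5) F j E C iso] by blast
  obtain Q where Q: "compactin (mtop M) Q" "Kt \<subseteq> Q"
    using bounded_in_compact[OF M conn compl assms(7)] by blast
  have "gradient_controlled M vol Kt"
    using gradient_controlled_compact[OF M conn assms(5) W Q(1)] Q(2)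
    by (rule gradient_controlled_subset)
  then show ?thesis
    by (simp add: gradient_controlled_def)
qed

end
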